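(* Let $\mathbb{K}$ be a field of characteristic zero, $\mathfrak{g}$ a Lie algebra over $\mathbb{K}$, $M$ a $\mathfrak{g}$-module, and $H\in \mathrm{Hom}(\wedge^2\mathfrak{g},M)$ a $2$-cocycle in the cohomology of $\mathfrak{g}$ with coefficients in $M$. Then the graded vector space $\bigoplus_{n\ge 0}\mathrm{Hom}(\wedge^n M,\mathfrak{g})$ (with $\mathrm{Hom}(\wedge^nM,\mathfrak{g})$ in degree $n$) is an $L_\infty$-algebra with $l_1=0$, $l_2=\llbracket\ ,\ \rrbracket$, $l_3=\llbracket\ ,\ ,\ \rrbracket$ and trivial higher maps. A linear map $T:M\to\mathfrak{g}$ is an $H$-twisted Rota-Baxter operator if and only if $T\in\mathrm{Hom}(M,\mathfrak{g})$ is a Maurer-Cartan element in this $L_\infty$-algebra.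
   Context: The $\mathfrak g$-action on $M$ is written $x\bullet u$. A $2$-cocycle is a skew-symmetric bilinear map $H:\mathfrak g\times\mathfrak g\to M$ with $x\bullet H(y,z)+y\bullet H(z,x)+z\bullet H(x,y)+H(x,[y,z])+H(y,[z,x])+H(z,[x,y])=0$. A linear map $T:M\to\mathfrak g$ is an $H$-twisted Rota-Baxter operator if $[Tu,Tv]=T(Tu\bullet v-Tv\bullet u+H(Tu,Tv))$ for all $u,v\in M$. $L_\infty$-algebra: a graded vector space $L=\bigoplus_i L_i$ with multilinear maps $l_k:L^{\otimes k}\to L$ of degree $2-k$ ($k\ge1$) such that (i) $l_k(x_{\sigma(1)},\dots,x_{\sigma(k)})=(-1)^\sigma\epsilon(\sigma)\,l_k(x_1,\dots,x_k)$ for $\sigma\in S_k$, where $(-1)^\sigma$ is the signature and $\epsilon(\sigma)$ the Koszul sign; (ii) for each $n\ge1$, $\sum_{i+j=n+1}\sum_\sigma(-1)^\sigma\epsilon(\sigma)(-1)^{i(j-1)}l_j(l_i(x_{\sigma(1)},\dots,x_{\sigma(i)}),x_{\sigma(i+1)},\dots,x_{\sigma(n)})=0$, with $\sigma$ running over $(i,n-i)$-unshuffles, $i\ge 1$. A Maurer-Cartan element is $\alpha\in L_1$ with $l_1(\alpha)+\frac1{2!}l_2(\alpha,\alpha)-\frac1{3!}l_3(\alpha,\alpha,\alpha)-\cdots=0$; when only $l_2,l_3$ are nonzero this reads $\frac12 l_2(\alpha,\alpha)-\frac16 l_3(\alpha,\alpha,\alpha)=0$. Brackets: $Sh(a,b,c)$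 denotes permutations of $\{1,\dots,a+b+c\}$ increasing on each of the three consecutive blocks of sizes $a,b,c$ (similarly $Sh(a,b)$); a sum over $Sh(a,b,-1)$ is zero. For $P\in\mathrm{Hom}(\wedge^pM,\mathfrak g)$, $Q\in\mathrm{Hom}(\wedge^qM,\mathfrak g)$, $R\in\mathrm{Hom}(\wedge^rM,\mathfrak g)$: $$\begin{aligned}\llbracket P,Q\rrbracket(u_1,\dots,u_{p+q})=&\sum_{\sigma\in Sh(q,1,p-1)}(-1)^\sigma P\big(Q(u_{\sigma(1)},\dots,u_{\sigma(q)})\bullet u_{\sigma(q+1)},u_{\sigma(q+2)},\dots,u_{\sigma(p+q)}\big)\\&-(-1)^{pq}\sum_{\sigma\in Sh(p,1,q-1)}(-1)^\sigma Q\big(P(u_{\sigma(1)},\dots,u_{\sigma(p)})\bullet u_{\sigma(p+1)},u_{\sigma(p+2)},\dots,u_{\sigma(p+q)}\big)\\&+(-1)^{pq}\sum_{\sigma\in Sh(p,q)}(-1)^\sigma\big[P(u_{\sigma(1)},\dots,u_{\sigma(p)}),Q(u_{\sigma(p+1)},\dots,u_{\sigma(p+q)})\big],\end{aligned}$$ $$\begin{aligned}&\llbracket P,Q,R\rrbracket(u_1,\dots,u_{p+q+r-1})\\&=(-1)^{pqr}\,\frac12\bigg\{\sum_{\sigma\in Sh(q,r,p-1)}(-1)^\sigma P\big(H(Q(u_{\sigma(1)},\dots,u_{\sigma(q)}),R(u_{\sigma(q+1)},\dots,u_{\sigma(q+r)})),u_{\sigma(q+r+1)},\dots,u_{\sigma(p+q+r-1)}\big)\\&-(-1)^{qr}\sum_{\sigma\in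 Sh(r,q,p-1)}(-1)^\sigma P\big(H(R(u_{\sigma(1)},\dots,u_{\sigma(r)}),Q(u_{\sigma(r+1)},\dots,u_{\sigma(q+r)})),u_{\sigma(q+r+1)},\dots,u_{\sigma(p+q+r-1)}\big)\\&-(-1)^{pq}\sum_{\sigma\in Sh(p,r,q-1)}(-1)^\sigma Q\big(H(P(u_{\sigma(1)},\dots,u_{\sigma(p)}),R(u_{\sigma(p+1)},\dots,u_{\sigma(p+r)})),u_{\sigma(p+r+1)},\dots,u_{\sigma(p+q+r-1)}\big)\\&+(-1)^{p(q+r)}\sum_{\sigma\in Sh(r,p,q-1)}(-1)^\sigma Q\big(H(R(u_{\sigma(1)},\dots,u_{\sigma(r)}),P(u_{\sigma(r+1)},\dots,u_{\sigma(p+r)})),u_{\sigma(p+r+1)},\dots,u_{\sigma(p+q+r-1)}\big)\\&+(-1)^{(p+q)r}\sum_{\sigma\in Sh(p,q,r-1)}(-1)^\sigma R\big(H(P(u_{\sigma(1)},\dots,u_{\sigma(p)}),Q(u_{\sigma(p+1)},\dots,u_{\sigma(p+q)})),u_{\sigma(p+q+1)},\dots,u_{\sigma(p+q+r-1)}\big)\\&-(-1)^{pq+qr+rp}\sum_{\sigma\in Sh(q,p,r-1)}(-1)^\sigma R\big(H(Q(u_{\sigma(1)},\dots,u_{\sigma(q)}),P(u_{\sigma(q+1)},\dots,u_{\sigma(p+q)})),u_{\sigma(p+q+1)},\dots,u_{\sigma(p+q+r-1)}\big)\bigg\}.\end{aligned}$$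
   Formalization: The printed common sign (-1)^{pqr} of the ternary bracket makes the L∞ identities fail; here each term with outer map of degree a and inner maps of degrees b, c carries (-1)^{a+1+bc} instead (the same when all degrees are odd, so the Maurer-Cartan equation is unchanged). *)

theory Defs
  imports Complex_Main "HOL-Combinatorics.Permutations" "HOL-Library.Function_Algebras"
begin

section \<open>Lie algebras, modules, 2-cocycles, twisted Rota-Baxter operators\<close>

locale lie_algebra = vector_space scale
  for scale :: "'k::field \<Rightarrow> 'g::ab_group_add \<Rightarrow> 'g" +
  fixes bracket :: "'g \<Rightarrow> 'g \<Rightarrow> 'g"
  assumes bracket_linear_right: "Vector_Spaces.linear scale scale (bracket x)"
    and bracket_linear_left: "Vector_Spaces.linear scale scale (\<lambda>x. bracket x y)"
    and bracket_self: "bracket x x = 0"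
    and jacobi: "bracket x (bracket y z) + bracket y (bracket z x) + bracket z (bracket x y) = 0"

locale lie_module = lie_algebra sg bracket + M: vector_space sM
  for sg :: "'k::field \<Rightarrow> 'g::ab_group_add \<Rightarrow> 'g"
    and bracket :: "'g \<Rightarrow> 'g \<Rightarrow> 'g"
    and sM :: "'k \<Rightarrow> 'm::ab_group_add \<Rightarrow> 'm" +
  fixes act :: "'g \<Rightarrow> 'm \<Rightarrow> 'm"
  assumes act_linear_right: "Vector_Spaces.linear sM sM (act x)"
    and act_linear_left: "Vector_Spaces.linear sg sM (\<lambda>x. act x u)"
    and act_bracket: "act (bracket x y) u = act x (act y u) - act y (act x u)"

definition two_cocycle ::
  "('k::field \<Rightarrow> 'g::ab_group_add \<Rightarrow> 'g) \<Rightarrow> ('g \<Rightarrow> 'g \<Rightarrow> 'g) \<Rightarrow> ('k \<Rightarrow> 'm::ab_group_add \<Rightarrow> 'm)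
   \<Rightarrow> ('g \<Rightarrow> 'm \<Rightarrow> 'm) \<Rightarrow> ('g \<Rightarrow> 'g \<Rightarrow> 'm) \<Rightarrow> bool" where
  "two_cocycle sg bracket sM act H \<longleftrightarrow>
     (\<forall>x. Vector_Spaces.linear sg sM (H x)) \<and>
     (\<forall>y. Vector_Spaces.linear sg sM (\<lambda>x. H x y)) \<and>
     (\<forall>x y. H x y = - H y x) \<and>
     (\<forall>x y z. act x (H y z) + act y (H z x) + act z (H x y)
        + H x (bracket y z) + H y (bracket z x) + H z (bracket x y) = 0)"

definition twisted_rota_baxter ::
  "('k::field \<Rightarrow> 'g::ab_group_add \<Rightarrow> 'g) \<Rightarrow> ('g \<Rightarrow> 'g \<Rightarrow> 'g) \<Rightarrow> ('k \<Rightarrow> 'm::ab_group_add \<Rightarrow> 'm)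
   \<Rightarrow> ('g \<Rightarrow> 'm \<Rightarrow> 'm) \<Rightarrow> ('g \<Rightarrow> 'g \<Rightarrow> 'm) \<Rightarrow> ('m \<Rightarrow> 'g) \<Rightarrow> bool" where
  "twisted_rota_baxter sg bracket sM act H T \<longleftrightarrow>
     Vector_Spaces.linear sM sg T \<and>
     (\<forall>u v. bracket (T u) (T v) = T (act (T u) v - act (T v) u + H (T u) (T v)))"


section \<open>Shuffles and Koszul signs\<close>

text \<open>
  Permutations act on positions counted from 0, and \<^term>\<open>permute_list \<sigma> [x\<^sub>0, x\<^sub>1]\<close> has
  \<open>x\<^bsub>\<sigma>(i)\<^esub>\<close> at position \<open>i\<close>.  The last block size of \<open>Sh3\<close> is an integer because the value -1
  has to give the empty set.
\<close>

definition Sh2 :: "nat \<Rightarrow> nat \<Rightarrow> (nat \<Rightarrow> nat) set" where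
  "Sh2 a b = {\<sigma>. \<sigma> permutes {..<a + b} \<and> strict_mono_on {..<a} \<sigma> \<and> strict_mono_on {a..<a + b} \<sigma>}"

definition Sh3 :: "nat \<Rightarrow> nat \<Rightarrow> int \<Rightarrow> (nat \<Rightarrow> nat) set" where
  "Sh3 a b c = (if c < 0 then {} else
     {\<sigma>. \<sigma> permutes {..<a + b + nat c} \<and> strict_mono_on {..<a} \<sigma> \<and>
         strict_mono_on {a..<a + b} \<sigma> \<and> strict_mono_on {a + b..<a + b + nat c} \<sigma>})"

definition koszul_sign :: "int list \<Rightarrow> (nat \<Rightarrow> nat) \<Rightarrow> int" where
  "koszul_sign ds \<sigma> =
     (\<Prod>(i, j) \<in> {(i, j). i < j \<and> j < length ds \<and> \<sigma> j < \<sigma> i}.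
        if odd (ds ! \<sigma> i * ds ! \<sigma> j) then -1 else 1)"


section \<open>L-infinity algebras and Maurer-Cartan elements\<close>

text \<open>
  The graded vector space is the internal direct sum of the subspaces \<open>L i\<close> of an ambient vector
  space; \<open>l k\<close> is applied to lists of length \<open>k\<close> with entries in that direct sum.
\<close>

locale linfinity_algebra = vector_space scale
  for scale :: "'k::field_char_0 \<Rightarrow> 'v::ab_group_add \<Rightarrow> 'v" +
  fixes L :: "int \<Rightarrow> 'v set"
    and l :: "nat \<Rightarrow> 'v list \<Rightarrow> 'v"
  assumes subspace_L: "subspace (L i)"
    and direct_sum: "finite I \<Longrightarrow> (\<And>i. i \<in> I \<Longrightarrow> x i \<in> L i) \<Longrightarrow> (\<Sum>i\<in>I. x i) = 0 \<Longrightarrow> i \<in> I \<Longrightarrow> x i = 0"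
    and multilinear:
      "k \<ge> 1 \<Longrightarrow> length xs = k \<Longrightarrow> set xs \<subseteq> span (\<Union>i. L i) \<Longrightarrow> j < k \<Longrightarrow>
       a \<in> span (\<Union>i. L i) \<Longrightarrow> b \<in> span (\<Union>i. L i) \<Longrightarrow>
       l k (xs[j := scale c a + b]) = scale c (l k (xs[j := a])) + l k (xs[j := b])"
    and degree:
      "k \<ge> 1 \<Longrightarrow> length xs = k \<Longrightarrow> length ds = k \<Longrightarrow> (\<And>j. j < k \<Longrightarrow> xs ! j \<in> L (ds ! j)) \<Longrightarrow>
       l k xs \<in> L (sum_list ds + 2 - int k)"
    and graded_skew:
      "k \<ge> 1 \<Longrightarrow> length xs = k \<Longrightarrow> length ds = k \<Longrightarrow> (\<And>j. j < k \<Longrightarrow> xs ! j \<in> L (ds ! j)) \<Longrightarrow>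
       \<sigma> permutes {..<k} \<Longrightarrow>
       l k (permute_list \<sigma> xs) = scale (of_int (sign \<sigma> * koszul_sign ds \<sigma>)) (l k xs)"
    and higher_jacobi:
      "n \<ge> 1 \<Longrightarrow> length xs = n \<Longrightarrow> length ds = n \<Longrightarrow> (\<And>j. j < n \<Longrightarrow> xs ! j \<in> L (ds ! j)) \<Longrightarrow>
       (\<Sum>(i, j) \<in> {(i, j). 1 \<le> i \<and> 1 \<le> j \<and> i + j = n + 1}. \<Sum>\<sigma> \<in> Sh2 i (n - i).
          scale (of_int (sign \<sigma> * koszul_sign ds \<sigma> * (-1) ^ (i * (j - 1))))
            (l j (l i (take i (permute_list \<sigma> xs)) # drop i (permute_list \<sigma> xs)))) = 0"

text \<open>
  The sign \<open>(-1)\<^bsup>(k-1)(k-2)/2\<^esup>\<close> runs through +, +, -, -, +, +, ...; thus the equation reads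
  \<open>l\<^sub>1(\<alpha>) + 1/2! l\<^sub>2(\<alpha>,\<alpha>) - 1/3! l\<^sub>3(\<alpha>,\<alpha>,\<alpha>) - \<dots> = 0\<close>.  The sum is required to be finite.
\<close>

definition maurer_cartan ::
  "('k::field_char_0 \<Rightarrow> 'v::ab_group_add \<Rightarrow> 'v) \<Rightarrow> (int \<Rightarrow> 'v set) \<Rightarrow> (nat \<Rightarrow> 'v list \<Rightarrow> 'v) \<Rightarrow> 'v \<Rightarrow> bool" where
  "maurer_cartan scale L l \<alpha> \<longleftrightarrow>
     \<alpha> \<in> L 1 \<and> finite {k. k \<ge> 1 \<and> l k (replicate k \<alpha>) \<noteq> 0} \<and>
     (\<Sum>k \<in> {k. k \<ge> 1 \<and> l k (replicate k \<alpha>) \<noteq> 0}.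
        scale ((-1) ^ ((k - 1) * (k - 2) div 2) / fact k) (l k (replicate k \<alpha>))) = 0"


section \<open>The graded space of alternating maps and its brackets\<close>

text \<open>
  An \<open>n\<close>-linear alternating map is a function on lists that vanishes on lists of length other than
  \<open>n\<close>.  In this way all the spaces \<open>Hom(\<And>\<^sup>n M, g)\<close> lie in the vector space \<^typ>\<open>'m list \<Rightarrow> 'g\<close>
  with pointwise operations, and they form a direct sum there: an element of the sum restricts on the
  lists of length \<open>n\<close> to its degree \<open>n\<close> component.
\<close>

definition alt_hom ::
  "('k::field \<Rightarrow> 'm::ab_group_add \<Rightarrow> 'm) \<Rightarrow> ('k \<Rightarrow> 'g::ab_group_add \<Rightarrow> 'g) \<Rightarrow> nat \<Rightarrow> ('m list \<Rightarrow> 'g) set" where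
  "alt_hom sM sg n = {P.
     (\<forall>us. length us \<noteq> n \<longrightarrow> P us = 0) \<and>
     (\<forall>us i. length us = n \<longrightarrow> i < n \<longrightarrow> Vector_Spaces.linear sM sg (\<lambda>v. P (us[i := v]))) \<and>
     (\<forall>us i j. length us = n \<longrightarrow> i < j \<longrightarrow> j < n \<longrightarrow> us ! i = us ! j \<longrightarrow> P us = 0)}"

definition hom_scale :: "('k \<Rightarrow> 'g \<Rightarrow> 'g) \<Rightarrow> 'k \<Rightarrow> ('m list \<Rightarrow> 'g) \<Rightarrow> 'm list \<Rightarrow> 'g" where
  "hom_scale sg c P = (\<lambda>us. sg c (P us))"

definition hom_grading ::
  "('k::field \<Rightarrow> 'm::ab_group_add \<Rightarrow> 'm) \<Rightarrow> ('k \<Rightarrow> 'g::ab_group_add \<Rightarrow> 'g) \<Rightarrow> int \<Rightarrow> ('m list \<Rightarrow> 'g) set" where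
  "hom_grading sM sg i = (if i < 0 then {0} else alt_hom sM sg (nat i))"

definition hom1 :: "('m \<Rightarrow> 'g::zero) \<Rightarrow> 'm list \<Rightarrow> 'g" where
  "hom1 T us = (if length us = 1 then T (hd us) else 0)"

definition binary_bracket ::
  "('k::field \<Rightarrow> 'g::ab_group_add \<Rightarrow> 'g) \<Rightarrow> ('g \<Rightarrow> 'g \<Rightarrow> 'g) \<Rightarrow> ('g \<Rightarrow> 'm \<Rightarrow> 'm)
   \<Rightarrow> nat \<Rightarrow> nat \<Rightarrow> ('m list \<Rightarrow> 'g) \<Rightarrow> ('m list \<Rightarrow> 'g) \<Rightarrow> 'm list \<Rightarrow> 'g" where
  "binary_bracket sg bracket act p q P Q us = (if length us = p + q then
       (\<Sum>\<sigma> \<in> Sh3 q 1 (int p - 1). let v = permute_list \<sigma> us in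
          sg (of_int (sign \<sigma>)) (P (act (Q (take q v)) (v ! q) # drop (q + 1) v)))
     - sg ((-1) ^ (p * q)) (\<Sum>\<sigma> \<in> Sh3 p 1 (int q - 1). let v = permute_list \<sigma> us in
          sg (of_int (sign \<sigma>)) (Q (act (P (take p v)) (v ! p) # drop (p + 1) v)))
     + sg ((-1) ^ (p * q)) (\<Sum>\<sigma> \<in> Sh2 p q. let v = permute_list \<sigma> us in
          sg (of_int (sign \<sigma>)) (bracket (P (take p v)) (Q (drop p v))))
     else 0)"

definition H_insertion ::
  "('k::field \<Rightarrow> 'g::ab_group_add \<Rightarrow> 'g) \<Rightarrow> ('g \<Rightarrow> 'g \<Rightarrow> 'm)
   \<Rightarrow> nat \<Rightarrow> nat \<Rightarrow> nat \<Rightarrow> ('m list \<Rightarrow> 'g) \<Rightarrow> ('m list \<Rightarrow> 'g) \<Rightarrow> ('m list \<Rightarrow> 'g) \<Rightarrow> 'm list \<Rightarrow> 'g" where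
  "H_insertion sg H p q r P Q R us =
     (\<Sum>\<sigma> \<in> Sh3 q r (int p - 1). let v = permute_list \<sigma> us in
        sg (of_int (sign \<sigma>)) (P (H (Q (take q v)) (R (take r (drop q v))) # drop (q + r) v)))"

text \<open>
  In the source all six terms of the ternary bracket carry the common sign \<open>(-1)\<^bsup>pqr\<^esup>\<close>.  With that
  sign the higher Jacobi identity for four arguments fails.  Example: \<open>g\<close> abelian with basis
  \<open>x, y\<close>; \<open>M\<close> with basis \<open>h, u\<close>; \<open>x\<close> sends \<open>u\<close> to \<open>h\<close> and all other basis actions vanish;
  \<open>H(x,y) = h\<close>; \<open>T(h) = x\<close> and \<open>T(u) = 0\<close>.  The left-hand side for the arguments \<open>x, y, T, T\<close>
  takes the value \<open>4 x\<close> at \<open>u\<close>.  Here a term with outer map of degree \<open>a\<close> and inner maps of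
  degrees \<open>b, c\<close> carries \<open>H_insertion_sign a b c\<close> instead.  This equals \<open>(-1)\<^bsup>abc\<^esup>\<close> whenever \<open>a\<close> is
  odd, so the two brackets agree if all degrees are odd, in particular for three maps of degree 1;
  for even \<open>a\<close> it is \<open>- (-1)\<^bsup>bc\<^esup>\<close> in place of 1.
\<close>

definition H_insertion_sign :: "nat \<Rightarrow> nat \<Rightarrow> nat \<Rightarrow> 'k::field" where
  "H_insertion_sign a b c = (-1) ^ (a + 1 + b * c)"

definition ternary_bracket ::
  "('k::field \<Rightarrow> 'g::ab_group_add \<Rightarrow> 'g) \<Rightarrow> ('g \<Rightarrow> 'g \<Rightarrow> 'm)
   \<Rightarrow> nat \<Rightarrow> nat \<Rightarrow> nat \<Rightarrow> ('m list \<Rightarrow> 'g) \<Rightarrow> ('m list \<Rightarrow> 'g) \<Rightarrow> ('m list \<Rightarrow> 'g) \<Rightarrow> 'm list \<Rightarrow> 'g" where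
  "ternary_bracket sg H p q r P Q R us = (if length us + 1 = p + q + r then sg (1 / 2)
     ( sg (H_insertion_sign p q r) (H_insertion sg H p q r P Q R us)
     - sg (H_insertion_sign p r q * (-1) ^ (q * r)) (H_insertion sg H p r q P R Q us)
     - sg (H_insertion_sign q p r * (-1) ^ (p * q)) (H_insertion sg H q p r Q P R us)
     + sg (H_insertion_sign q r p * (-1) ^ (p * (q + r))) (H_insertion sg H q r p Q R P us)
     + sg (H_insertion_sign r p q * (-1) ^ ((p + q) * r)) (H_insertion sg H r p q R P Q us)
     - sg (H_insertion_sign r q p * (-1) ^ (p * q + q * r + r * p)) (H_insertion sg H r q p R Q P us))
     else 0)"

text \<open>
  Multilinear extension of the brackets from homogeneous elements to the direct sum, as a sum over
  the finitely many nonzero components.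
\<close>

definition component :: "nat \<Rightarrow> ('m list \<Rightarrow> 'g::zero) \<Rightarrow> 'm list \<Rightarrow> 'g" where
  "component n P us = (if length us = n then P us else 0)"

definition degrees :: "('m list \<Rightarrow> 'g::zero) \<Rightarrow> nat set" where
  "degrees P = {n. \<exists>us. length us = n \<and> P us \<noteq> 0}"

definition twisted_brackets ::
  "('k::field \<Rightarrow> 'g::ab_group_add \<Rightarrow> 'g) \<Rightarrow> ('g \<Rightarrow> 'g \<Rightarrow> 'g) \<Rightarrow> ('g \<Rightarrow> 'm \<Rightarrow> 'm) \<Rightarrow> ('g \<Rightarrow> 'g \<Rightarrow> 'm)
   \<Rightarrow> nat \<Rightarrow> ('m list \<Rightarrow> 'g) list \<Rightarrow> 'm list \<Rightarrow> 'g" where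
  "twisted_brackets sg bracket act H k Ps =
     (if k = 2 then
        (\<Sum>p \<in> degrees (Ps ! 0). \<Sum>q \<in> degrees (Ps ! 1).
           binary_bracket sg bracket act p q (component p (Ps ! 0)) (component q (Ps ! 1)))
      else if k = 3 then
        (\<Sum>p \<in> degrees (Ps ! 0). \<Sum>q \<in> degrees (Ps ! 1). \<Sum>r \<in> degrees (Ps ! 2).
           ternary_bracket sg H p q r
             (component p (Ps ! 0)) (component q (Ps ! 1)) (component r (Ps ! 2)))
      else 0)"

end

theory Submission
  imports Defs
begin

text \<open>
  Extend scalars by a Grassmann algebra and evaluate alternating maps on a generic odd vector \<open>u\<close>
  of \<open>M\<close>. Shuffle sums become products, and a linear combination of elements of the complex with
  suitable Grassmann coefficients is a single odd function \<open>A\<close> of \<open>u\<close> with values in \<open>g\<close>. Put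
  \<open>W = A \<bullet> u + 1/2 H(A, A)\<close> and let \<open>D\<^sub>W\<close> denote the odd derivation that replaces \<open>u\<close> by \<open>W\<close>.
  Up to sign, the sum of the brackets \<open>l\<^sub>k(A, \<dots>, A) / k!\<close> is \<open>B = D\<^sub>W A - 1/2 [A, A]\<close>, the
  obstruction for the graph of \<open>A\<close> to be invariant under the homological vector field on \<open>g \<oplus> M\<close>
  that encodes bracket, action and cocycle. The Jacobi identity, the module axiom and the cocycle
  condition give \<open>D\<^sub>W W = B \<bullet> u + H(B, A)\<close>, and from this
  \<open>D\<^sub>W B - D\<^bsub>B\<bullet>u + H(B,A)\<^esub> A + [B, A] = 0\<close>. The coefficient of each monomial in the
  Grassmann parameters of this identity is a higher Jacobi identity.
\<close>

text \<open>Up to sign, the left side of the final identity is the derivative of the assignment of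
  \<open>B\<close> to \<open>A\<close>, taken in the direction of \<open>B\<close>: every term
  contains \<open>B\<close> once among factors \<open>A\<close>. Its coefficients are therefore
  brackets with a bracket as first argument, which is the shape of the higher Jacobi identity. Every
  given element has its own parameter and \<open>A\<close> is linear in the parameters, so
  coefficients of products of distinct parameters polarise the brackets and the factorials
  disappear. The factors 1/2 in \<open>W\<close> and \<open>B\<close> balance the two orders of a
  pair of factors \<open>A\<close>; with \<open>W\<close> fixed in this way, the relative signs of
  the six ternary terms follow, and they are those of \<open>H_insertion_sign\<close>. No exterior
  algebra is constructed: a series is represented by its values on words, and coassociativity and
  graded cocommutativity of sums over splittings do the work of the algebra laws. The parameters
  shift all degrees by one, so that a single Koszul rule governs the computation; what remains is to
  compare this rule with the signs of graded skew-symmetry.\<close>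

section \<open>Signed unshuffles of words\<close>

definition signed :: "bool \<Rightarrow> 'a \<Rightarrow> 'a::ab_group_add" where
  "signed s x = (if s then - x else x)"

lemma signed_simps [simp]:
  "signed False x = x" "signed True x = - x" "signed s 0 = 0"
  "signed s (signed t x) = signed (s \<noteq> t) x"
  "signed s (- x) = - signed s x"
  by (auto simp: signed_def)

lemma signed_add: "signed s (x + y) = signed s x + signed s y"
  and signed_apply: "signed s F us = signed s (F us)"
  by (auto simp: signed_def)

lemma additive_signed: "additive h \<Longrightarrow> h (signed s x) = signed s (h x)"
  by (simp add: signed_def additive.minus)

text \<open>Signs are truth values, so multiplying them is exclusive or and comparing two of them is
  a propositional problem. The relation \<open>c\<close> says which exchanges of letters cost a
  sign; as a parameter it lets one theory serve signatures, Koszul signs and products of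
  both.\<close>

primrec crossing :: "('a \<Rightarrow> 'a \<Rightarrow> bool) \<Rightarrow> 'a \<Rightarrow> 'a list \<Rightarrow> bool" where
  "crossing c x [] = False"
| "crossing c x (y # ys) = (c x y \<noteq> crossing c x ys)"

primrec crossings :: "('a \<Rightarrow> 'a \<Rightarrow> bool) \<Rightarrow> 'a list \<Rightarrow> 'a list \<Rightarrow> bool" where
  "crossings c [] ys = False"
| "crossings c (x # xs) ys = (crossing c x ys \<noteq> crossings c xs ys)"

text \<open>
  The coproduct of the exterior algebra on words: the sum of \<open>f a b\<close> over all subwords \<open>a\<close> of \<open>w\<close>
  with complement \<open>b\<close>, with a sign change for each \<open>x\<close> in \<open>b\<close> and later \<open>y\<close> in \<open>a\<close> with \<open>c x y\<close>.
\<close>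

primrec unshuffle :: "('a \<Rightarrow> 'a \<Rightarrow> bool) \<Rightarrow> ('a list \<Rightarrow> 'a list \<Rightarrow> 'b::ab_group_add) \<Rightarrow> 'a list \<Rightarrow> 'b" where
  "unshuffle c f [] = f [] []"
| "unshuffle c f (x # w) = unshuffle c (\<lambda>a b. f (x # a) b) w
     + unshuffle c (\<lambda>a b. signed (crossing c x a) (f a (x # b))) w"

text \<open>Subword and complement exhaust \<open>w\<close>. The multiset equation is the trace of
  this that later proofs use, since lengths, parities and crossing counts depend on the letters only
  as a multiset.\<close>

lemma unshuffle_cong:
  assumes "\<And>a b. mset a + mset b = mset w \<Longrightarrow> f a b = g a b"
  shows "unshuffle c f w = unshuffle c g w"
  using assms
proof (induction w arbitrary: f g)
  case (Cons x w)
  have "unshuffle c (\<lambda>a b. f (x # a) b) w = unshuffle c (\<lambda>a b. g (x # a) b) w"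
    by (rule Cons.IH) (simp add: Cons.prems)
  moreover have "unshuffle c (\<lambda>a b. signed (crossing c x a) (f a (x # b))) w
      = unshuffle c (\<lambda>a b. signed (crossing c x a) (g a (x # b))) w"
    by (rule Cons.IH) (simp add: Cons.prems)
  ultimately show ?case by simp
qed simp

lemma unshuffle_zero [simp]: "unshuffle c (\<lambda>a b. 0) w = 0"
  by (induction w) auto

lemma unshuffle_add: "unshuffle c (\<lambda>a b. f a b + g a b) w = unshuffle c f w + unshuffle c g w"
  by (induction w arbitrary: f g) (auto simp: signed_add algebra_simps)

lemma unshuffle_hom: "additive h \<Longrightarrow> h (unshuffle c f w) = unshuffle c (\<lambda>a b. h (f a b)) w"
  by (induction w arbitrary: f) (auto simp: additive.add additive_signed)

lemma additive_signed_self: "additive (signed s)"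
  by (simp add: additive_def signed_add)

lemmas unshuffle_signed = unshuffle_hom[OF additive_signed_self, symmetric]

lemma unshuffle_minus: "unshuffle c (\<lambda>a b. - f a b) w = - unshuffle c f w"
  using unshuffle_signed[of c True f w] by simp

lemma unshuffle_diff: "unshuffle c (\<lambda>a b. f a b - g a b) w = unshuffle c f w - unshuffle c g w"
  using unshuffle_add[of c f "\<lambda>a b. - g a b"] by (simp add: unshuffle_minus)

lemma unshuffle_map:
  "unshuffle c f (map g w) = unshuffle (\<lambda>x y. c (g x) (g y)) (\<lambda>a b. f (map g a) (map g b)) w"
proof (induction w arbitrary: f)
  case (Cons x w)
  have "crossing c (g x) (map g a) = crossing (\<lambda>x y. c (g x) (g y)) x a" for a
    by (induction a) auto
  then show ?case by (simp add: Cons)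
qed simp

lemma unshuffle_comm:
  "unshuffle c (\<lambda>a b. unshuffle d (\<lambda>p q. f a b p q) v) u
     = unshuffle d (\<lambda>p q. unshuffle c (\<lambda>a b. f a b p q) u) v"
  by (induction u arbitrary: f) (auto simp: unshuffle_add unshuffle_signed[symmetric])

lemma unshuffle_left_only:
  assumes "\<And>a b. b \<noteq> [] \<Longrightarrow> f a b = 0"
  shows "unshuffle c f w = f w []"
  using assms by (induction w arbitrary: f) auto

lemma crossing_append [simp]: "crossing c x (a @ b) = (crossing c x a \<noteq> crossing c x b)"
  by (induction a) auto

lemma crossing_cong_mset: "mset a = mset b \<Longrightarrow> crossing c x a = crossing c x b"
proof (induction a arbitrary: b)
  case (Cons y a)
  then have "y \<in> set b" by (metis list.set_intros(1) mset_eq_setD)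
  then obtain p q where b: "b = p @ y # q" by (meson split_list)
  with Cons.prems have "mset a = mset (p @ q)" by simp
  with Cons.IH[of "p @ q"] b show ?case by auto
qed simp

lemma crossing_split:
  "mset a + mset b = mset w \<Longrightarrow> crossing c x w = (crossing c x a \<noteq> crossing c x b)"
  using crossing_cong_mset[of w "a @ b" c x] by simp

lemma crossings_Nil [simp]: "crossings c a [] = False"
  by (induction a) auto

lemma crossings_Cons_right: "crossings c a (x # b) = (crossing (\<lambda>u v. c v u) x a \<noteq> crossings c a b)"
  by (induction a) auto

lemma crossings_append_right [simp]: "crossings c u (a @ b) = (crossings c u a \<noteq> crossings c u b)"
  by (induction u) auto

text \<open>Coassociativity: both sides run over the splittings of \<open>w\<close> into three
  subwords. A letter that enters the third one passes the first two, on the left side in one move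
  and on the right in two; \<open>crossing_split\<close> equates these signs.\<close>

lemma unshuffle_assoc:
  "unshuffle c (\<lambda>u z. unshuffle c (\<lambda>x y. f x y z) u) w
     = unshuffle c (\<lambda>x v. unshuffle c (\<lambda>y z. f x y z) v) w"
proof (induction w arbitrary: f)
  case (Cons a w)
  have "unshuffle c (\<lambda>u z. signed (crossing c a u) (unshuffle c (\<lambda>x y. f x y (a # z)) u)) w
     = unshuffle c (\<lambda>u z. unshuffle c (\<lambda>x y. signed (crossing c a x \<noteq> crossing c a y) (f x y (a # z))) u) w"
    by (auto intro!: unshuffle_cong arg_cong2[where f = signed] simp: unshuffle_signed[symmetric]
        dest!: crossing_split[where c = c and x = a])
  then show ?case
    by (simp add: unshuffle_add Cons unshuffle_signed[symmetric] signed_add add.assoc)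
qed simp

text \<open>Each pair of letters from different subwords is crossed in exactly one of the two
  orders, so for symmetric \<open>c\<close> the signs of the two splittings differ by all the
  crossings between \<open>a\<close> and \<open>b\<close>.\<close>

lemma unshuffle_cocomm:
  assumes "\<And>x y. c x y = c y x"
  shows "unshuffle c f w = unshuffle c (\<lambda>a b. signed (crossings c a b) (f b a)) w"
proof (induction w arbitrary: f)
  case (Cons x w)
  have sym: "(\<lambda>u v. c v u) = c" using assms by auto
  have "crossing c x a \<noteq> (crossing c x a \<noteq> s) \<longleftrightarrow> s" for a s by auto
  then have 1: "unshuffle c (\<lambda>a b. signed (crossing c x a) (signed (crossings c a (x # b)) (f (x # b) a))) w
     = unshuffle c (\<lambda>a b. f (x # a) b) w"
    by (simp add: Cons.IH[of "\<lambda>a b. f (x # a) b"] crossings_Cons_right sym)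
  have 2: "unshuffle c (\<lambda>a b. signed (crossings c (x # a) b) (f b (x # a))) w
     = unshuffle c (\<lambda>a b. signed (crossing c x a) (f a (x # b))) w"
    by (simp add: Cons.IH[of "\<lambda>a b. signed (crossing c x a) (f a (x # b))"] crossings_Cons_right sym)
       (auto intro!: unshuffle_cong arg_cong2[where f = signed])
  show ?case using 1 2 by (simp add: algebra_simps)
qed simp

text \<open>The coproduct of a concatenation is the product of the coproducts; the sign comes from
  moving \<open>p\<close> in front of \<open>b\<close>.\<close>

lemma unshuffle_append:
  "unshuffle c f (u @ v) = unshuffle c (\<lambda>a b. unshuffle c (\<lambda>p q.
     signed (crossings c b p) (f (a @ p) (b @ q))) v) u"
proof (induction u arbitrary: f)
  case (Cons x u)
  have "unshuffle c (\<lambda>a b. unshuffle c (\<lambda>p q. signed (crossings c b p)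
            (signed (crossing c x (a @ p)) (f (a @ p) (x # b @ q)))) v) u
      = unshuffle c (\<lambda>a b. signed (crossing c x a) (unshuffle c (\<lambda>p q. signed (crossings c (x # b) p)
            (f (a @ p) (x # b @ q))) v)) u"
    by (auto intro!: unshuffle_cong arg_cong2[where f = signed] simp: unshuffle_signed[symmetric])
  then show ?case by (simp add: Cons)
qed simp

section \<open>Shuffle permutations\<close>

definition inversion_sign :: "nat \<Rightarrow> (nat \<Rightarrow> nat) \<Rightarrow> int" where
  "inversion_sign n p = (\<Prod>(i, j)\<in>{(i, j). i < j \<and> j < n}. if p j < p i then -1 else 1)"

lemma finite_pairs: "finite {(i, j). i < j \<and> j < (n::nat)}"
  by (rule finite_subset[of _ "{..<n} \<times> {..<n}"]) auto

text \<open>A pair is inverted by the composite iff exactly one of two things happens: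
  \<open>q\<close> inverts it, or \<open>p\<close> inverts its image under \<open>q\<close>, put in
  increasing order. Sorting the image gives a bijection of the set of pairs, so the second factor is
  again a full inversion count.\<close>

lemma inversion_sign_compose:
  assumes p: "p permutes {..<n}" and q: "q permutes {..<n}"
  shows "inversion_sign n (p \<circ> q) = inversion_sign n p * inversion_sign n q"
proof -
  let ?S = "{(i, j). i < j \<and> j < n}"
  let ?s = "\<lambda>f (i, j). if f j < f i then -1 else 1 :: int"
  let ?m = "\<lambda>f (i, j). (min (f i) (f j), max (f i) (f j)) :: nat \<times> nat"
  have inj: "q i = q j \<longleftrightarrow> i = j" "p i = p j \<longleftrightarrow> i = j" for i j
    using permutes_inj[OF q] permutes_inj[OF p] by (auto dest: injD)
  have q': "inv q permutes {..<n}" using q by (rule permutes_inv)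
  have lt: "i < n \<Longrightarrow> q i < n" "i < n \<Longrightarrow> inv q i < n" for i
    using permutes_in_image[OF q, of i] permutes_in_image[OF q', of i] by auto
  have inv: "inv q (q i) = i" "q (inv q i) = i" for i
    using permutes_inverses[OF q] by auto
  have inj': "inv q i = inv q j \<longleftrightarrow> i = j" for i j
    using permutes_inj[OF q'] by (auto dest: injD)
  have "prod (?s (p \<circ> q)) ?S = (\<Prod>x\<in>?S. ?s p (?m q x) * ?s q x)"
    by (rule prod.cong) (auto simp: inj min_def max_def)
  also have "\<dots> = (\<Prod>x\<in>?S. ?s p (?m q x)) * prod (?s q) ?S"
    by (rule prod.distrib)
  also have "(\<Prod>x\<in>?S. ?s p (?m q x)) = prod (?s p) ?S"
    by (rule prod.reindex_bij_witness[of _ "?m (inv q)" "?m q"])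
      (auto simp: min_def max_def inv inj inj' lt split: if_splits,
        auto simp: not_le le_less inj inj')
  finally show ?thesis by (simp add: inversion_sign_def)
qed

lemma inversion_sign_adjacent:
  assumes "Suc k < n"
  shows "inversion_sign n (transpose k (Suc k)) = -1"
proof -
  have "inversion_sign n (transpose k (Suc k)) = (\<Prod>x\<in>{(i, j). i < j \<and> j < n}. if x = (k, Suc k) then -1 else 1)"
    unfolding inversion_sign_def by (rule prod.cong) (auto simp: transpose_def split: if_splits)
  also have "\<dots> = -1" using assms by (simp add: prod.delta finite_pairs)
  finally show ?thesis .
qed

lemma inversion_sign_transpose:
  assumes "a < b" "b < n"
  shows "inversion_sign n (transpose a b) = -1"
  using assms
proof (induction b)
  case (Suc b)
  show ?case
  proof (cases "a = b")
    case True
    then show ?thesis using Suc by (simp add: inversion_sign_adjacent)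
  next
    case False
    \<comment> \<open>Conjugation by an adjacent transposition brings the two exchanged points one
      step closer.\<close>
    have eq: "transpose a (Suc b) = transpose b (Suc b) \<circ> (transpose a b \<circ> transpose b (Suc b))"
      using False Suc.prems by (auto simp: fun_eq_iff transpose_def)
    have p: "transpose b (Suc b) permutes {..<n}" "transpose a b permutes {..<n}"
      using Suc.prems False by (auto intro!: permutes_swap_id)
    show ?thesis
      unfolding eq inversion_sign_compose[OF permutes_compose[OF p(1) p(2)] p(1)]
        inversion_sign_compose[OF p(1) permutes_compose[OF p(1) p(2)]] inversion_sign_compose[OF p(2) p(1)]
      using Suc False by (simp add: inversion_sign_adjacent)
  qed
qed simp

lemma sign_eq_inversion_sign:
  assumes "p permutes {..<n}"
  shows "sign p = inversion_sign n p"
  using assms finite_lessThan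
proof (induction p rule: permutes_induct)
  case id
  show ?case unfolding inversion_sign_def by (subst prod.neutral) auto
next
  case (swap a b p)
  have "inversion_sign n (transpose a b) = -1"
    using swap inversion_sign_transpose[of a b n] inversion_sign_transpose[of b a n]
    by (cases a b rule: linorder_cases) (auto simp: transpose_commute)
  moreover have "transpose a b permutes {..<n}"
    using swap by (auto intro: permutes_swap_id)
  moreover have "p permutes {..<n}" "permutation p"
    using swap permutation_permutes by blast+
  ultimately show ?case
    using inversion_sign_compose[of "transpose a b" n p]
      sign_compose[OF permutation_swap_id[of a b] \<open>permutation p\<close>] swap
    by (simp only: sign_swap_id if_False)
qed

text \<open>The relation \<open>c\<close> selects the inverted pairs that count: all of them for the
  signature, those of two odd degrees for the Koszul sign.\<close>

primrec inversions :: "(nat \<Rightarrow> nat \<Rightarrow> bool) \<Rightarrow> nat list \<Rightarrow> bool" where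
  "inversions c [] = False"
| "inversions c (x # w) = (crossing (\<lambda>x y. y < x \<and> c x y) x w \<noteq> inversions c w)"

lemma crossing_prod:
  "(\<Prod>j<length w. if c x (w ! j) then -1 else 1) = (if crossing c x w then -1 else 1 :: int)"
  by (induction w) (auto simp: prod.lessThan_Suc_shift simp del: prod.lessThan_Suc)

lemma inversions_prod:
  "(\<Prod>(i, j)\<in>{(i, j). i < j \<and> j < length w}. if w ! j < w ! i \<and> c (w ! i) (w ! j) then -1 else 1)
     = (if inversions c w then -1 else 1 :: int)"
proof (induction w)
  case (Cons x w)
  let ?s = "\<lambda>w (i, j). if w ! j < w ! i \<and> c (w ! i) (w ! j) then -1 else 1 :: int"
  have "{(i, j). i < j \<and> j < length (x # w)}
      = (\<lambda>j. (0, Suc j)) ` {..<length w} \<union> map_prod Suc Suc ` {(i, j). i < j \<and> j < length w}"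
    (is "_ = ?A \<union> ?B")
  proof (intro equalityI subsetI)
    fix z assume "z \<in> {(i, j). i < j \<and> j < length (x # w)}"
    then obtain i j where z: "z = (i, Suc j)" "i < Suc j" "j < length w"
      by (cases z, cases "snd z") auto
    then show "z \<in> ?A \<union> ?B"
      by (cases i) (auto simp: map_prod_def image_iff)
  qed auto
  moreover have "prod (?s (x # w)) (?A \<union> ?B) = prod (?s (x # w)) ?A * prod (?s (x # w)) ?B"
    by (rule prod.union_disjoint) (auto intro!: finite_pairs)
  moreover have "prod (?s (x # w)) ?A = (if crossing (\<lambda>x y. y < x \<and> c x y) x w then -1 else 1)"
    unfolding crossing_prod[symmetric] by (subst prod.reindex) (auto simp: inj_on_def)
  moreover have "prod (?s (x # w)) ?B = (if inversions c w then -1 else 1)"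
    unfolding Cons[symmetric] by (subst prod.reindex) (auto simp: inj_on_def intro!: prod.cong)
  ultimately show ?case by auto
qed simp

lemma sign_eq_inversions:
  assumes "p permutes {..<n}"
  shows "sign p = (if inversions (\<lambda>_ _. True) (map p [0..<n]) then -1 else 1)"
proof -
  have "inversion_sign n p = (\<Prod>(i, j)\<in>{(i, j). i < j \<and> j < length (map p [0..<n])}.
      if map p [0..<n] ! j < map p [0..<n] ! i \<and> True then -1 else 1)"
    unfolding inversion_sign_def by (rule prod.cong) auto
  then show ?thesis
    unfolding sign_eq_inversion_sign[OF assms] using inversions_prod[of "map p [0..<n]" "\<lambda>_ _. True"] by simp
qed

lemma koszul_sign_eq_inversions:
  "koszul_sign ds p = (if inversions (\<lambda>i j. odd (ds ! i * ds ! j)) (map p [0..<length ds]) then -1 else 1)"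
proof -
  let ?w = "map p [0..<length ds]"
  have "koszul_sign ds p = (\<Prod>(i, j)\<in>{(i, j). i < j \<and> j < length ds}.
      if p j < p i \<and> odd (ds ! p i * ds ! p j) then -1 else 1)"
    unfolding koszul_sign_def
    by (rule prod.mono_neutral_cong_left) (auto simp: finite_pairs split: if_splits)
  also have "\<dots> = (\<Prod>(i, j)\<in>{(i, j). i < j \<and> j < length ?w}.
      if ?w ! j < ?w ! i \<and> odd (ds ! (?w ! i) * ds ! (?w ! j)) then -1 else 1)"
    by (rule prod.cong) auto
  finally show ?thesis
    using inversions_prod[of ?w "\<lambda>i j. odd (ds ! i * ds ! j)"] by simp
qed

section \<open>Shuffles as splittings into increasing words\<close>

definition triples :: "nat list \<Rightarrow> (nat list \<times> nat list \<times> nat list) set" where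
  "triples w = {(\<alpha>, \<beta>, \<gamma>). sorted_wrt (<) \<alpha> \<and> sorted_wrt (<) \<beta> \<and> sorted_wrt (<) \<gamma> \<and>
     distinct (\<alpha> @ \<beta> @ \<gamma>) \<and> set (\<alpha> @ \<beta> @ \<gamma>) = set w}"

lemma finite_triples: "finite (triples w)"
proof -
  let ?L = "{\<alpha>. set \<alpha> \<subseteq> set w \<and> length \<alpha> \<le> card (set w)}"
  have "triples w \<subseteq> ?L \<times> ?L \<times> ?L"
    unfolding triples_def by (auto simp: distinct_card[symmetric] intro!: card_mono)
  then show ?thesis by (rule finite_subset) (auto simp: finite_lists_length_le)
qed

lemma sorted_wrt_min_Cons:
  assumes "sorted_wrt (<) \<alpha>" "x \<in> set \<alpha>" "\<forall>y\<in>set \<alpha>. x \<le> (y::nat)"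
  obtains \<alpha>' where "\<alpha> = x # \<alpha>'"
  using assms by (cases \<alpha>) (auto dest: leD)

text \<open>The least letter can only head the list that contains it; this gives a recursion along
  \<open>w\<close>.\<close>

lemma triples_Cons:
  assumes "sorted_wrt (<) (x # w)"
  shows "triples (x # w) = (\<lambda>(\<alpha>, \<beta>, \<gamma>). (x # \<alpha>, \<beta>, \<gamma>)) ` triples w
     \<union> (\<lambda>(\<alpha>, \<beta>, \<gamma>). (\<alpha>, x # \<beta>, \<gamma>)) ` triples w \<union> (\<lambda>(\<alpha>, \<beta>, \<gamma>). (\<alpha>, \<beta>, x # \<gamma>)) ` triples w"
    (is "_ = ?A \<union> ?B \<union> ?C")
proof (intro equalityI subsetI)
  fix t assume "t \<in> triples (x # w)"
  then obtain \<alpha> \<beta> \<gamma> where t: "t = (\<alpha>, \<beta>, \<gamma>)" and s: "sorted_wrt (<) \<alpha>" "sorted_wrt (<) \<beta>" "sorted_wrt (<) \<gamma>"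
    and d: "distinct (\<alpha> @ \<beta> @ \<gamma>)" and u: "set \<alpha> \<union> (set \<beta> \<union> set \<gamma>) = insert x (set w)"
    unfolding triples_def by auto
  have x: "x \<notin> set w" "\<forall>y\<in>set \<alpha> \<union> (set \<beta> \<union> set \<gamma>). x \<le> y" using assms unfolding u by auto
  consider "x \<in> set \<alpha>" | "x \<in> set \<beta>" | "x \<in> set \<gamma>" using u by blast
  then show "t \<in> ?A \<union> ?B \<union> ?C"
  proof cases
    case 1
    then obtain \<alpha>' where "\<alpha> = x # \<alpha>'" using s x sorted_wrt_min_Cons by blast
    then have "(\<alpha>', \<beta>, \<gamma>) \<in> triples w" using s d u x by (auto simp: triples_def)
    then show ?thesis using \<open>\<alpha> = _\<close> t by force
  next
    case 2
    then obtain \<alpha>' where "\<beta> = x # \<alpha>'" using s x sorted_wrt_min_Cons by blast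
    then have "(\<alpha>, \<alpha>', \<gamma>) \<in> triples w" using s d u x by (auto simp: triples_def)
    then show ?thesis using \<open>\<beta> = _\<close> t by force
  next
    case 3
    then obtain \<alpha>' where "\<gamma> = x # \<alpha>'" using s x sorted_wrt_min_Cons by blast
    then have "(\<alpha>, \<beta>, \<alpha>') \<in> triples w" using s d u x by (auto simp: triples_def)
    then show ?thesis using \<open>\<gamma> = _\<close> t by force
  qed
next
  fix t assume "t \<in> ?A \<union> ?B \<union> ?C"
  then show "t \<in> triples (x # w)" using assms by (fastforce simp: triples_def)
qed

lemma crossing_none: "\<forall>y\<in>set w. \<not> c x y \<Longrightarrow> \<not> crossing c x w"
  by (induction w) auto

text \<open>As \<open>x\<close> is smaller than all other letters, it forms inversions with the
  letters before it and with no others. There it is the second entry of the pair, whence the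
  symmetry of \<open>c\<close>.\<close>

lemma inversions_insert:
  assumes "\<forall>y\<in>set a \<union> set b. x < y" "\<And>x y. c x y = c y x"
  shows "inversions c (a @ x # b) = (crossing c x a \<noteq> inversions c (a @ b))"
  using assms(1)
proof (induction a)
  case Nil
  then have "\<not> crossing (\<lambda>x y. y < x \<and> c x y) x b" by (intro crossing_none) auto
  then show ?case by simp
next
  case (Cons y a)
  then show ?case using assms(2)[of y x] by auto
qed

text \<open>The two recursions agree letter by letter: at the head of the second list the least
  letter has passed the first list, at the head of the third it has passed both. Block lengths stay
  free because the recursion changes them; \<open>sum_Sh3\<close> restores them through the
  summand.\<close>

lemma sum_triples:
  fixes f :: "nat list \<Rightarrow> nat list \<Rightarrow> nat list \<Rightarrow> 'b::ab_group_add"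
  assumes "sorted_wrt (<) w" and c: "\<And>x y. c x y = c y x"
  shows "(\<Sum>(\<alpha>, \<beta>, \<gamma>)\<in>triples w. signed (inversions c (\<alpha> @ \<beta> @ \<gamma>)) (f \<alpha> \<beta> \<gamma>))
     = unshuffle c (\<lambda>\<alpha> v. unshuffle c (\<lambda>\<beta> \<gamma>. f \<alpha> \<beta> \<gamma>) v) w"
  using assms(1)
proof (induction w arbitrary: f)
  case Nil
  have "triples [] = {([], [], [])}" by (auto simp: triples_def)
  then show ?case by simp
next
  case (Cons x w)
  let ?F = "\<lambda>(\<alpha>, \<beta>, \<gamma>). signed (inversions c (\<alpha> @ \<beta> @ \<gamma>)) (f \<alpha> \<beta> \<gamma>)"
  let ?A = "(\<lambda>(\<alpha>, \<beta>, \<gamma>). (x # \<alpha>, \<beta>, \<gamma>)) ` triples w"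
  let ?B = "(\<lambda>(\<alpha>, \<beta>, \<gamma>). (\<alpha>, x # \<beta>, \<gamma>)) ` triples w"
  let ?C = "(\<lambda>(\<alpha>, \<beta>, \<gamma>). (\<alpha>, \<beta>, x # \<gamma>)) ` triples w"
  have w: "sorted_wrt (<) w" and x: "\<forall>y\<in>set w. x < y" using Cons.prems by auto
  have x\<alpha>: "\<forall>y\<in>set \<alpha> \<union> set (\<beta> @ \<gamma>). x < y" "\<forall>y\<in>set (\<alpha> @ \<beta>) \<union> set \<gamma>. x < y" "\<forall>y\<in>set [] \<union> set (\<alpha> @ \<beta> @ \<gamma>). x < y"
    if "(\<alpha>, \<beta>, \<gamma>) \<in> triples w" for \<alpha> \<beta> \<gamma>
    using that x by (auto simp: triples_def)
  have xn: "x \<notin> set \<alpha>" "x \<notin> set \<beta>" "x \<notin> set \<gamma>" if "(\<alpha>, \<beta>, \<gamma>) \<in> triples w" for \<alpha> \<beta> \<gamma>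
    using x\<alpha>(1)[OF that] by auto
  have fin: "finite ?A" "finite ?B" "finite ?C" using finite_triples by auto
  have "sum ?F (triples (x # w)) = sum ?F (?A \<union> ?B \<union> ?C)"
    by (simp only: triples_Cons[OF Cons.prems])
  also have "\<dots> = sum ?F ?A + sum ?F ?B + sum ?F ?C"
    by (subst sum.union_disjoint, use fin in \<open>simp\<close>, use fin in simp, use xn in force)
       (subst sum.union_disjoint, use fin in \<open>simp\<close>, use fin in simp, use xn in force, simp)
  also have "sum ?F ?A = (\<Sum>(\<alpha>, \<beta>, \<gamma>)\<in>triples w. signed (inversions c (\<alpha> @ \<beta> @ \<gamma>)) (f (x # \<alpha>) \<beta> \<gamma>))"
    by (subst sum.reindex) (auto simp: inj_on_def intro!: sum.cong arg_cong2[where f = signed]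
        dest: x\<alpha>(3)[THEN inversions_insert[OF _ c], unfolded append_Nil] simp del: inversions.simps)
  also have "sum ?F ?B = (\<Sum>(\<alpha>, \<beta>, \<gamma>)\<in>triples w. signed (inversions c (\<alpha> @ \<beta> @ \<gamma>))
      (signed (crossing c x \<alpha>) (f \<alpha> (x # \<beta>) \<gamma>)))"
    by (subst sum.reindex) (auto simp: inj_on_def intro!: sum.cong arg_cong2[where f = signed] dest: x\<alpha>(1)[THEN inversions_insert[OF _ c]])
  also have "sum ?F ?C = (\<Sum>(\<alpha>, \<beta>, \<gamma>)\<in>triples w. signed (inversions c (\<alpha> @ \<beta> @ \<gamma>))
      (signed (crossing c x \<alpha> \<noteq> crossing c x \<beta>) (f \<alpha> \<beta> (x # \<gamma>))))"
    by (subst sum.reindex) (auto simp: inj_on_def intro!: sum.cong arg_cong2[where f = signed] dest: x\<alpha>(2)[THEN inversions_insert[OF _ c]])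
  finally show ?case
    unfolding Cons.IH[OF w]
    by (simp add: unshuffle_add signed_add unshuffle_signed[symmetric] add.assoc)
qed

lemma sorted_wrt_map_upt:
  "sorted_wrt (<) (map p [i..<j]) \<longleftrightarrow> strict_mono_on {i..<j} (p :: nat \<Rightarrow> nat)"
proof -
  have "sorted_wrt (<) (map p [i..<j]) \<longleftrightarrow> (\<forall>y<j. \<forall>x<y. i \<le> x \<longrightarrow> p x < p y)"
    by (induction j) (auto simp: sorted_wrt_append less_Suc_eq)
  then show ?thesis by (auto simp: strict_mono_on_def)
qed

lemma sum_Sh3:
  fixes f :: "nat list \<Rightarrow> nat list \<Rightarrow> nat list \<Rightarrow> 'b::ab_group_add"
  assumes c: "\<And>x y. c x y = c y x" and n: "n = a + b + k"
  shows "(\<Sum>p\<in>Sh3 a b (int k). signed (inversions c (map p [0..<n]))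
        (f (map p [0..<a]) (map p [a..<a + b]) (map p [a + b..<n])))
     = unshuffle c (\<lambda>\<alpha> v. unshuffle c (\<lambda>\<beta> \<gamma>. if length \<alpha> = a \<and> length \<beta> = b then f \<alpha> \<beta> \<gamma> else 0) v) [0..<n]"
proof -
  \<comment> \<open>Two lengths suffice; the third follows from the total \<open>n\<close>.\<close>
  let ?T = "{(\<alpha>, \<beta>, \<gamma>)\<in>triples [0..<n]. length \<alpha> = a \<and> length \<beta> = b}"
  let ?j = "\<lambda>p. (map p [0..<a], map p [a..<a + b], map p [a + b..<n])"
  \<comment> \<open>Beyond the first \<open>n\<close> positions the permutation has to be the
    identity, as \<open>permutes\<close> demands.\<close>
  let ?i = "\<lambda>(\<alpha>, \<beta>, \<gamma>) k. if k < n then (\<alpha> @ \<beta> @ \<gamma>) ! k else k"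
  have upt: "[0..<n] = [0..<a] @ [a..<a + b] @ [a + b..<n]"
    unfolding n by (metis add.assoc le_add1 upt_add_eq_append zero_le add_0)
  have app: "map p [0..<a] @ map p [a..<a + b] @ map p [a + b..<n] = map p [0..<n]" for p :: "nat \<Rightarrow> nat"
    by (simp add: upt)
  have len: "length \<alpha> + length \<beta> + length \<gamma> = n" if "(\<alpha>, \<beta>, \<gamma>) \<in> triples [0..<n]" for \<alpha> \<beta> \<gamma>
  proof -
    have "distinct (\<alpha> @ \<beta> @ \<gamma>)" "set (\<alpha> @ \<beta> @ \<gamma>) = {0..<n}" using that by (auto simp: triples_def)
    then show ?thesis using distinct_card[of "\<alpha> @ \<beta> @ \<gamma>"] by simp
  qed
  have mapi: "map (?i (\<alpha>, \<beta>, \<gamma>)) [0..<n] = \<alpha> @ \<beta> @ \<gamma>" if "(\<alpha>, \<beta>, \<gamma>) \<in> triples [0..<n]" for \<alpha> \<beta> \<gamma>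
    using len[OF that] by (intro nth_equalityI) auto
  have ji: "?j (?i (\<alpha>, \<beta>, \<gamma>)) = (\<alpha>, \<beta>, \<gamma>)"
    if t: "(\<alpha>, \<beta>, \<gamma>) \<in> triples [0..<n]" "length \<alpha> = a" "length \<beta> = b" for \<alpha> \<beta> \<gamma>
  proof -
    define g where "g = ?i (\<alpha>, \<beta>, \<gamma>)"
    have "map g [0..<a] @ map g [a..<a + b] @ map g [a + b..<n] = \<alpha> @ \<beta> @ \<gamma>"
      using mapi[OF t(1)] unfolding app g_def .
    then have "map g [0..<a] = \<alpha>" "map g [a..<a + b] = \<beta>" "map g [a + b..<n] = \<gamma>"
      using t(2,3) by (simp_all add: append_eq_append_conv del: map_append)
    then show ?thesis by (simp add: g_def)
  qed
  have bij: "?i (\<alpha>, \<beta>, \<gamma>) permutes {..<n}" if "(\<alpha>, \<beta>, \<gamma>) \<in> triples [0..<n]" for \<alpha> \<beta> \<gamma>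
  proof (rule bij_imp_permutes)
    have "distinct (\<alpha> @ \<beta> @ \<gamma>)" "set (\<alpha> @ \<beta> @ \<gamma>) = {..<n}" using that by (auto simp: triples_def)
    then have "bij_betw ((!) (\<alpha> @ \<beta> @ \<gamma>)) {..<n} {..<n}"
      using len[OF that] by (intro bij_betw_nth) auto
    then show "bij_betw (?i (\<alpha>, \<beta>, \<gamma>)) {..<n} {..<n}" by (rule bij_betw_cong[THEN iffD1, rotated]) auto
  qed auto
  have Sh3: "p \<in> Sh3 a b (int k) \<longleftrightarrow> p permutes {..<n} \<and> sorted_wrt (<) (map p [0..<a]) \<and>
     sorted_wrt (<) (map p [a..<a + b]) \<and> sorted_wrt (<) (map p [a + b..<n])" for p
    by (simp add: Sh3_def n sorted_wrt_map_upt atLeast0LessThan)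
  have "(\<Sum>p\<in>Sh3 a b (int k). signed (inversions c (map p [0..<n]))
        (f (map p [0..<a]) (map p [a..<a + b]) (map p [a + b..<n])))
     = (\<Sum>(\<alpha>, \<beta>, \<gamma>)\<in>?T. signed (inversions c (\<alpha> @ \<beta> @ \<gamma>)) (f \<alpha> \<beta> \<gamma>))"
  proof (rule sum.reindex_bij_witness[of _ ?i ?j])
    fix p assume p: "p \<in> Sh3 a b (int k)"
    then have pp: "p permutes {..<n}" by (simp add: Sh3)
    have "set (map p [0..<n]) = {..<n}" "distinct (map p [0..<n])"
      using permutes_image[OF pp] permutes_inj_on[OF pp, of "{0..<n}"] by (auto simp: atLeast0LessThan distinct_map)
    then show "?j p \<in> ?T" using p unfolding app[symmetric] by (auto simp: Sh3 triples_def)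
    show "?i (?j p) = p" using permutes_not_in[OF pp] by (auto simp: app fun_eq_iff simp del: map_append)
    show "(case ?j p of (\<alpha>, \<beta>, \<gamma>) \<Rightarrow> signed (inversions c (\<alpha> @ \<beta> @ \<gamma>)) (f \<alpha> \<beta> \<gamma>)) =
      signed (inversions c (map p [0..<n])) (f (map p [0..<a]) (map p [a..<a + b]) (map p [a + b..<n]))"
      by (simp add: app del: map_append)
  next
    fix t assume t: "t \<in> ?T"
    obtain \<alpha> \<beta> \<gamma> where [simp]: "t = (\<alpha>, \<beta>, \<gamma>)" by (cases t) auto
    have t': "(\<alpha>, \<beta>, \<gamma>) \<in> triples [0..<n]" "length \<alpha> = a" "length \<beta> = b" using t by auto
    show "?j (?i t) = t" using ji[OF t'] by simp
    have "map (?i t) [0..<a] = \<alpha>" "map (?i t) [a..<a + b] = \<beta>" "map (?i t) [a + b..<n] = \<gamma>"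
      using ji[OF t'] by simp_all
    then show "?i t \<in> Sh3 a b (int k)"
      unfolding Sh3 using t' bij[OF t'(1)] by (simp add: triples_def)
  qed
  also have "\<dots> = (\<Sum>(\<alpha>, \<beta>, \<gamma>)\<in>triples [0..<n]. signed (inversions c (\<alpha> @ \<beta> @ \<gamma>))
      (if length \<alpha> = a \<and> length \<beta> = b then f \<alpha> \<beta> \<gamma> else 0))"
    by (rule sum.mono_neutral_cong_left) (auto simp: finite_triples split: if_splits)
  also have "\<dots> = unshuffle c (\<lambda>\<alpha> v. unshuffle c (\<lambda>\<beta> \<gamma>. if length \<alpha> = a \<and> length \<beta> = b then f \<alpha> \<beta> \<gamma> else 0) v) [0..<n]"
    by (rule sum_triples) (auto simp: c sorted_wrt_upt)
  finally show ?thesis .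
qed

lemma Sh2_eq_Sh3: "Sh2 a b = Sh3 a b 0"
  by (auto simp: Sh2_def Sh3_def strict_mono_on_def)

lemma sum_Sh2:
  fixes f :: "nat list \<Rightarrow> nat list \<Rightarrow> 'b::ab_group_add"
  assumes c: "\<And>x y. c x y = c y x" and n: "n = a + b"
  shows "(\<Sum>p\<in>Sh2 a b. signed (inversions c (map p [0..<n])) (f (map p [0..<a]) (map p [a..<n])))
     = unshuffle c (\<lambda>\<alpha> \<beta>. if length \<alpha> = a then f \<alpha> \<beta> else 0) [0..<n]"
proof -
  have "(\<Sum>p\<in>Sh2 a b. signed (inversions c (map p [0..<n])) (f (map p [0..<a]) (map p [a..<n])))
     = (\<Sum>p\<in>Sh3 a b (int 0). signed (inversions c (map p [0..<n]))
        ((\<lambda>\<alpha> \<beta> \<gamma>. f \<alpha> \<beta>) (map p [0..<a]) (map p [a..<a + b]) (map p [a + b..<n])))"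
    by (simp add: Sh2_eq_Sh3 n)
  also have "\<dots> = unshuffle c (\<lambda>\<alpha> v. unshuffle c (\<lambda>\<beta> \<gamma>. if length \<alpha> = a \<and> length \<beta> = b then f \<alpha> \<beta> else 0) v) [0..<n]"
    by (rule sum_Sh3) (auto simp: c n)
  also have "\<dots> = unshuffle c (\<lambda>\<alpha> \<beta>. if length \<alpha> = a then f \<alpha> \<beta> else 0) [0..<n]"
  proof (rule unshuffle_cong)
    fix \<alpha> v assume "mset \<alpha> + mset v = mset [0..<n]"
    then have l: "length \<alpha> + length v = a + b" unfolding n by (metis size_mset size_union length_upt diff_zero)
    have "unshuffle c (\<lambda>\<beta> \<gamma>. if length \<alpha> = a \<and> length \<beta> = b then f \<alpha> \<beta> else 0) v
        = unshuffle c (\<lambda>\<beta> \<gamma>. if \<gamma> = [] then if length \<alpha> = a then f \<alpha> \<beta> else 0 else 0) v"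
    proof (rule unshuffle_cong)
      fix \<beta> \<gamma> assume "mset \<beta> + mset \<gamma> = mset v"
      then have "length \<beta> + length \<gamma> = length v" by (metis size_mset size_union)
      then show "(if length \<alpha> = a \<and> length \<beta> = b then f \<alpha> \<beta> else 0)
          = (if \<gamma> = [] then if length \<alpha> = a then f \<alpha> \<beta> else 0 else 0)"
        using l by auto
    qed
    then show "unshuffle c (\<lambda>\<beta> \<gamma>. if length \<alpha> = a \<and> length \<beta> = b then f \<alpha> \<beta> else 0) v
        = (if length \<alpha> = a then f \<alpha> v else 0)"
      by (simp add: unshuffle_left_only)
  qed
  finally show ?thesis .
qed

text \<open>The sign is computed on positions, where no letter repeats, and only then are positions
  replaced by entries of \<open>us\<close>. For the constant relation crossings depend on lengths
  alone, so repeated entries do no harm.\<close>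

lemma sum_Sh3_list:
  fixes f :: "'a list \<Rightarrow> 'a list \<Rightarrow> 'a list \<Rightarrow> 'b::ab_group_add"
  assumes n: "length us = a + b + k"
  shows "(\<Sum>p\<in>Sh3 a b (int k). signed (inversions (\<lambda>_ _. True) (map p [0..<length us]))
        (f (take a (permute_list p us)) (take b (drop a (permute_list p us))) (drop (a + b) (permute_list p us))))
     = unshuffle (\<lambda>_ _. True) (\<lambda>\<alpha> v. unshuffle (\<lambda>_ _. True)
         (\<lambda>\<beta> \<gamma>. if length \<alpha> = a \<and> length \<beta> = b then f \<alpha> \<beta> \<gamma> else 0) v) us"
proof -
  let ?g = "map ((!) us)"
  have "(\<Sum>p\<in>Sh3 a b (int k). signed (inversions (\<lambda>_ _. True) (map p [0..<length us]))
        (f (take a (permute_list p us)) (take b (drop a (permute_list p us))) (drop (a + b) (permute_list p us))))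
     = (\<Sum>p\<in>Sh3 a b (int k). signed (inversions (\<lambda>_ _. True) (map p [0..<length us]))
        (f (?g (map p [0..<a])) (?g (map p [a..<a + b])) (?g (map p [a + b..<length us]))))"
    by (rule sum.cong) (auto simp: permute_list_def n take_map drop_map add.assoc o_def)
  also have "\<dots> = unshuffle (\<lambda>_ _. True) (\<lambda>\<alpha> v. unshuffle (\<lambda>_ _. True) (\<lambda>\<beta> \<gamma>.
        if length \<alpha> = a \<and> length \<beta> = b then f (?g \<alpha>) (?g \<beta>) (?g \<gamma>) else 0) v) [0..<length us]"
    by (rule sum_Sh3) (auto simp: n)
  also have "\<dots> = unshuffle (\<lambda>_ _. True) (\<lambda>\<alpha> v. unshuffle (\<lambda>_ _. True)
         (\<lambda>\<beta> \<gamma>. if length \<alpha> = a \<and> length \<beta> = b then f \<alpha> \<beta> \<gamma> else 0) v) (?g [0..<length us])"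
    by (simp add: unshuffle_map)
  finally show ?thesis by (simp add: map_nth)
qed

lemma sum_Sh2_list:
  fixes f :: "'a list \<Rightarrow> 'a list \<Rightarrow> 'b::ab_group_add"
  assumes n: "length us = a + b"
  shows "(\<Sum>p\<in>Sh2 a b. signed (inversions (\<lambda>_ _. True) (map p [0..<length us]))
        (f (take a (permute_list p us)) (drop a (permute_list p us))))
     = unshuffle (\<lambda>_ _. True) (\<lambda>\<alpha> \<beta>. if length \<alpha> = a then f \<alpha> \<beta> else 0) us"
proof -
  let ?g = "map ((!) us)"
  have "(\<Sum>p\<in>Sh2 a b. signed (inversions (\<lambda>_ _. True) (map p [0..<length us]))
        (f (take a (permute_list p us)) (drop a (permute_list p us))))
     = (\<Sum>p\<in>Sh2 a b. signed (inversions (\<lambda>_ _. True) (map p [0..<length us]))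
        (f (?g (map p [0..<a])) (?g (map p [a..<length us]))))"
    by (rule sum.cong) (auto simp: permute_list_def n take_map drop_map o_def)
  also have "\<dots> = unshuffle (\<lambda>_ _. True) (\<lambda>\<alpha> \<beta>. if length \<alpha> = a then f (?g \<alpha>) (?g \<beta>) else 0) [0..<length us]"
    by (rule sum_Sh2) (auto simp: n)
  also have "\<dots> = unshuffle (\<lambda>_ _. True) (\<lambda>\<alpha> \<beta>. if length \<alpha> = a then f \<alpha> \<beta> else 0) (?g [0..<length us])"
    by (simp add: unshuffle_map)
  finally show ?thesis by (simp add: map_nth)
qed

section \<open>Alternating maps and their shuffle products\<close>

abbreviation usum :: "('a list \<Rightarrow> 'a list \<Rightarrow> 'b::ab_group_add) \<Rightarrow> 'a list \<Rightarrow> 'b" where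
  "usum \<equiv> unshuffle (\<lambda>_ _. True)"

lemma crossing_True [simp]: "crossing (\<lambda>_ _. True) x w = odd (length w)"
  by (induction w) auto

lemma crossings_True [simp]: "crossings (\<lambda>_ _. True) v w = (odd (length v) \<and> odd (length w))"
  by (induction v) auto

text \<open>Just the two equations, without the vector space axioms contained in
  \<open>Vector_Spaces.linear\<close>: they compose by rewriting and apply directly to function
  spaces with \<open>hom_scale\<close>.\<close>

definition lin :: "('k \<Rightarrow> 'a \<Rightarrow> 'a) \<Rightarrow> ('k \<Rightarrow> 'b \<Rightarrow> 'b) \<Rightarrow> ('a::ab_group_add \<Rightarrow> 'b::ab_group_add) \<Rightarrow> bool" where
  "lin s t f \<longleftrightarrow> (\<forall>x y. f (x + y) = f x + f y) \<and> (\<forall>r x. f (s r x) = t r (f x))"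

lemma linear_iff_lin:
  assumes "vector_space s" "vector_space t"
  shows "Vector_Spaces.linear s t f \<longleftrightarrow> lin s t f"
  using assms unfolding lin_def linear_iff_module_hom module_hom_iff
  by (auto simp: module_iff_vector_space)

lemma linD: "lin s t f \<Longrightarrow> f (x + y) = f x + f y" "lin s t f \<Longrightarrow> f (s r x) = t r (f x)"
    "lin s t f \<Longrightarrow> f 0 = 0" "lin s t f \<Longrightarrow> f (- x) = - f x"
    "lin s t f \<Longrightarrow> additive f"
  using additive.zero[of f] additive.minus[of f] by (auto simp: lin_def additive_def)

text \<open>List contexts instead of indices fit recursion on lists, and no arity is fixed. Equal
  neighbours are enough, because exchanging neighbours brings any two equal entries together
  (\<open>alternating_repeat\<close>).\<close>

definition alternating :: "('k \<Rightarrow> 'm \<Rightarrow> 'm) \<Rightarrow> ('k \<Rightarrow> 'v \<Rightarrow> 'v) \<Rightarrow> ('m::ab_group_add list \<Rightarrow> 'v::ab_group_add) \<Rightarrow> bool" where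
  "alternating s t P \<longleftrightarrow> (\<forall>u v. lin s t (\<lambda>x. P (u @ x # v))) \<and> (\<forall>u v x. P (u @ x # x # v) = 0)"

lemma alternating_swap:
  assumes "alternating s t P"
  shows "P (u @ x # y # v) = - P (u @ y # x # v)"
proof -
  have z: "P (u @ z # z # v) = 0" for z using assms by (auto simp: alternating_def)
  have 1: "P (u @ (a + b) # w) = P (u @ a # w) + P (u @ b # w)" for u w a b
    using assms by (auto simp: alternating_def lin_def)
  have 2: "P (u @ a # (b + c) # w) = P (u @ a # b # w) + P (u @ a # c # w)" for a b c w
    using 1[of "u @ [a]"] by simp
  have "P (u @ (x + y) # (x + y) # v) = P (u @ x # y # v) + P (u @ y # x # v)"
    unfolding 1 2 by (simp add: z)
  then show ?thesis by (simp only: z eq_neg_iff_add_eq_0)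
qed

lemma alternating_repeat:
  assumes "alternating s t P"
  shows "P (u @ x # w @ x # v) = 0"
proof (induction w arbitrary: u)
  case Nil
  then show ?case using assms by (simp add: alternating_def)
next
  case (Cons y w)
  have "P (u @ x # y # w @ x # v) = - P (u @ y # x # w @ x # v)"
    by (rule alternating_swap[OF assms])
  also have "P (u @ y # x # w @ x # v) = 0" using Cons[of "u @ [y]"] by simp
  finally show ?case by simp
qed

text \<open>Negative degrees are covered as well: no list has negative length, so the right side
  leaves only the zero map.\<close>

lemma hom_grading_iff:
  assumes "vector_space s" "vector_space t"
  shows "P \<in> hom_grading s t d \<longleftrightarrow> alternating s t P \<and> (\<forall>us. int (length us) \<noteq> d \<longrightarrow> P us = 0)"
proof -
  have lin0: "lin s t (\<lambda>x. 0)"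
    using module.scale_zero_right assms(2) by (auto simp: lin_def module_iff_vector_space[symmetric])
  show ?thesis
  proof (cases "d < 0")
    case True
    then have "int (length us) \<noteq> d" for us :: "'b list" by simp
    then have "(\<forall>us. int (length us) \<noteq> d \<longrightarrow> P us = 0) \<longleftrightarrow> P = (\<lambda>us. 0)" by (auto simp: fun_eq_iff)
    then show ?thesis using True lin0 by (auto simp: hom_grading_def zero_fun_def alternating_def)
  next
    case False
    have "P \<in> alt_hom s t (nat d) \<longleftrightarrow> alternating s t P \<and> (\<forall>us. int (length us) \<noteq> d \<longrightarrow> P us = 0)"
    proof (intro iffI conjI)
      assume P: "P \<in> alt_hom s t (nat d)"
      show *: "\<forall>us. int (length us) \<noteq> d \<longrightarrow> P us = 0" using P False by (auto simp: alt_hom_def)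
      have Pl: "length us = nat d \<Longrightarrow> i < nat d \<Longrightarrow> Vector_Spaces.linear s t (\<lambda>v. P (us[i := v]))" for us i
        using P by (simp add: alt_hom_def)
      have "lin s t (\<lambda>x. P (u @ x # v))" for u v
      proof (cases "length (u @ undefined # v) = nat d")
        case True
        then have "Vector_Spaces.linear s t (\<lambda>x. P ((u @ undefined # v)[length u := x]))"
          using Pl[OF True, of "length u"] by simp
        then show ?thesis by (simp add: linear_iff_lin[OF assms])
      next
        case f: False
        have "P (u @ x # v) = 0" for x using * f False by auto
        then show ?thesis using lin0 by simp
      qed
      moreover have "P (u @ x # x # v) = 0" for u v x
      proof (cases "length (u @ x # x # v) = nat d")
        case True
        have "(u @ x # x # v) ! length u = (u @ x # x # v) ! Suc (length u)"
          by (simp add: nth_append)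
        moreover have "length u < Suc (length u)" "Suc (length u) < nat d" using True by auto
        ultimately show ?thesis using P True unfolding alt_hom_def by blast
      next
        case f: False
        then show ?thesis using * False by auto
      qed
      ultimately show "alternating s t P" by (simp add: alternating_def)
    next
      assume P: "alternating s t P \<and> (\<forall>us. int (length us) \<noteq> d \<longrightarrow> P us = 0)"
      have "Vector_Spaces.linear s t (\<lambda>x. P (us[i := x]))" if "i < length us" for us i
        unfolding linear_iff_lin[OF assms] upd_conv_take_nth_drop[OF that]
        using P by (auto simp: alternating_def)
      moreover have "P us = 0" if ij: "i < j" "j < length us" "us ! i = us ! j" for us i j
      proof -
        have "us = take i us @ us ! i # drop (Suc i) us" using ij by (intro id_take_nth_drop) simp
        moreover have "drop (Suc i) us = take (j - Suc i) (drop (Suc i) us) @ drop (Suc i) us ! (j - Suc i) # drop (Suc (j - Suc i)) (drop (Suc i) us)"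
          using ij by (intro id_take_nth_drop) auto
        moreover have "drop (Suc i) us ! (j - Suc i) = us ! i" using ij by simp
        ultimately have "us = take i us @ us ! i # take (j - Suc i) (drop (Suc i) us) @ us ! i # drop (Suc (j - Suc i)) (drop (Suc i) us)"
          by metis
        then show ?thesis using alternating_repeat[OF P[THEN conjunct1]] by metis
      qed
      ultimately show "P \<in> alt_hom s t (nat d)" using P False by (auto simp: alt_hom_def)
    qed
    then show ?thesis using False by (simp add: hom_grading_def)
  qed
qed

lemma lin_usum:
  assumes t: "\<And>r. additive (t r)" and "\<And>a b. lin s t (\<lambda>x. g x a b)"
  shows "lin s t (\<lambda>x. unshuffle c (g x) w)"
proof -
  have "additive (\<lambda>x. g x a b)" for a b using assms(2) by (rule linD)
  then show ?thesis
    using assms(2) unfolding lin_def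
    by (auto simp: unshuffle_hom[OF t] unshuffle_add[symmetric] intro!: unshuffle_cong)
qed

lemma lin_signed: "(\<And>r. additive (t r)) \<Longrightarrow> lin s t f \<Longrightarrow> lin s t (\<lambda>x. signed b (f x))"
  by (auto simp: lin_def signed_add additive_signed)

lemma lin_add: "(\<And>r. additive (t r)) \<Longrightarrow> lin s t f \<Longrightarrow> lin s t g \<Longrightarrow> lin s t (\<lambda>x. f x + g x)"
  by (auto simp: lin_def additive.add algebra_simps)

text \<open>Two equal neighbours either go to the same factor, which is alternating, or are
  separated; the two ways of separating them differ by one crossing and cancel.\<close>

lemma alternating_usum:
  assumes t: "\<And>r. additive (t r)"
    and left: "\<And>b. alternating s t (\<lambda>a. f a b)" and right: "\<And>a. alternating s t (\<lambda>b. f a b)"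
  shows "alternating s t (usum f)"
  unfolding alternating_def
proof (intro conjI allI)
  fix u v x
  have ll: "lin s t (\<lambda>x. f (u @ x # v) b)" and lr: "lin s t (\<lambda>x. f a (u @ x # v))" for a b u v
    using left[of b] right[of a] by (auto simp: alternating_def)
  show "lin s t (\<lambda>x. usum f (u @ x # v))"
    unfolding unshuffle_append
    by (auto intro!: lin_usum lin_add lin_signed ll lr t simp: signed_add)
  have zl: "f (u @ x # x # v) b = 0" and zr: "f a (u @ x # x # v) = 0" for a b u v
    using left[of b] right[of a] by (auto simp: alternating_def)
  have "usum (\<lambda>p q. signed (odd (length b) \<and> odd (length p)) (f (a @ p) (b @ q))) (x # x # v) = 0" for a b
    unfolding unshuffle.simps unshuffle_add[symmetric]
    by (rule trans[OF unshuffle_cong unshuffle_zero]) (auto simp: zl zr signed_def)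
  then show "usum f (u @ x # x # v) = 0"
    unfolding unshuffle_append by simp
qed

section \<open>Words with Grassmann parameters\<close>

definition biadditive :: "('a::ab_group_add \<Rightarrow> 'b::ab_group_add \<Rightarrow> 'c::ab_group_add) \<Rightarrow> bool" where
  "biadditive h \<longleftrightarrow> (\<forall>x. additive (h x)) \<and> (\<forall>y. additive (\<lambda>x. h x y))"

lemma biadditive_simps:
  assumes "biadditive h"
  shows "h (x + x') y = h x y + h x' y" "h x (y + y') = h x y + h x y'"
    "h (x - x') y = h x y - h x' y" "h x (y - y') = h x y - h x y'"
    "h (- x) y = - h x y" "h x (- y) = - h x y" "h 0 y = 0" "h x 0 = 0"
proof -
  have 1: "additive (h x)" and 2: "additive (\<lambda>x. h x y)" for x y
    using assms by (auto simp: biadditive_def)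
  show "h (x + x') y = h x y + h x' y" "h x (y + y') = h x y + h x y'"
    "h (x - x') y = h x y - h x' y" "h x (y - y') = h x y - h x y'"
    "h (- x) y = - h x y" "h x (- y) = - h x y" "h 0 y = 0" "h x 0 = 0"
    using additive.add[OF 2] additive.diff[OF 2] additive.minus[OF 2] additive.zero[OF 2]
    by (auto simp: additive.add[OF 1] additive.diff[OF 1] additive.minus[OF 1] additive.zero[OF 1])
qed

lemma biadditive_unshuffle_left:
  assumes "biadditive h"
  shows "h (unshuffle c f w) y = unshuffle c (\<lambda>a b. h (f a b) y) w"
  using unshuffle_hom[of "\<lambda>x. h x y" c f w] assms by (auto simp: biadditive_def)

lemma biadditive_unshuffle_right:
  assumes "biadditive h"
  shows "h x (unshuffle c f w) = unshuffle c (\<lambda>a b. h x (f a b)) w"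
  using unshuffle_hom[of "h x" c f w] assms by (auto simp: biadditive_def)

lemmas biadditive_unshuffle = biadditive_unshuffle_left biadditive_unshuffle_right

lemma linear_imp_additive: "Vector_Spaces.linear s t f \<Longrightarrow> additive f"
  by (simp add: additive_def linear_iff_module_hom module_hom.add)

text \<open>
  A word is a monomial in the Grassmann algebra: \<open>Inl u\<close> is an odd variable with the vector \<open>u\<close>
  attached, \<open>Inr i\<close> is a parameter, odd iff \<open>\<not> d i\<close>. A function on words stands for the generating
  series of its values; \<open>conv\<close> is the product and \<open>deriv_along\<close> the substitution derivation.
\<close>

type_synonym 'm word = "('m + nat) list"

fun odd_letter :: "(nat \<Rightarrow> bool) \<Rightarrow> 'm + nat \<Rightarrow> bool" where
  "odd_letter d (Inl u) = True"
| "odd_letter d (Inr i) = (\<not> d i)"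

primrec odd_word :: "(nat \<Rightarrow> bool) \<Rightarrow> 'm word \<Rightarrow> bool" where
  "odd_word d [] = False"
| "odd_word d (x # w) = (odd_letter d x \<noteq> odd_word d w)"

definition koszul :: "(nat \<Rightarrow> bool) \<Rightarrow> 'm + nat \<Rightarrow> 'm + nat \<Rightarrow> bool" where
  "koszul d x y = (odd_letter d x \<and> odd_letter d y)"

lemma crossing_koszul [simp]: "crossing (koszul d) x w = (odd_letter d x \<and> odd_word d w)"
  by (induction w) (auto simp: koszul_def)

lemma crossings_koszul [simp]: "crossings (koszul d) v w = (odd_word d v \<and> odd_word d w)"
  by (induction v) auto

lemma odd_word_append [simp]: "odd_word d (a @ b) = (odd_word d a \<noteq> odd_word d b)"
  by (induction a) auto

lemma odd_word_split:
  assumes "mset a + mset b = mset w"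
  shows "odd_word d w = (odd_word d a \<noteq> odd_word d b)"
  \<comment> \<open>Moving an odd letter past a word counts the odd letters of that word, so
    parities add up as crossings do.\<close>
  using crossing_split[OF assms, of "koszul d" "Inl undefined"] by simp

definition conv :: "(nat \<Rightarrow> bool) \<Rightarrow> ('a \<Rightarrow> 'b \<Rightarrow> 'c::ab_group_add) \<Rightarrow> ('m word \<Rightarrow> 'a) \<Rightarrow> ('m word \<Rightarrow> 'b) \<Rightarrow> 'm word \<Rightarrow> 'c" where
  "conv d h F G w = unshuffle (koszul d) (\<lambda>a b. h (F a) (G b)) w"

definition deriv_along :: "(nat \<Rightarrow> bool) \<Rightarrow> ('m word \<Rightarrow> 'm) \<Rightarrow> ('m word \<Rightarrow> 'c::ab_group_add) \<Rightarrow> 'm word \<Rightarrow> 'c" where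
  "deriv_along d Y F w = unshuffle (koszul d) (\<lambda>a b. F (Inl (Y a) # b)) w"

definition has_parity :: "(nat \<Rightarrow> bool) \<Rightarrow> bool \<Rightarrow> ('m word \<Rightarrow> 'a::zero) \<Rightarrow> bool" where
  "has_parity d k F \<longleftrightarrow> (\<forall>w. odd_word d w \<noteq> k \<longrightarrow> F w = 0)"

text \<open>Substitution puts the new vector at the front of the word, so this is the slot where
  additivity matters.\<close>

definition front_additive :: "('m::ab_group_add word \<Rightarrow> 'a::ab_group_add) \<Rightarrow> bool" where
  "front_additive F \<longleftrightarrow> (\<forall>w. additive (\<lambda>m. F (Inl m # w)))"

definition unshuffle3 :: "(nat \<Rightarrow> bool) \<Rightarrow> ('m word \<Rightarrow> 'm word \<Rightarrow> 'm word \<Rightarrow> 'c::ab_group_add) \<Rightarrow> 'm word \<Rightarrow> 'c" where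
  "unshuffle3 d f w = unshuffle (koszul d) (\<lambda>a v. unshuffle (koszul d) (\<lambda>b e. f a b e) v) w"

lemma koszul_sym: "koszul d x y = koszul d y x"
  by (auto simp: koszul_def)

lemma unshuffle3_assoc: "unshuffle (koszul d) (\<lambda>v e. unshuffle (koszul d) (\<lambda>a b. f a b e) v) w = unshuffle3 d f w"
  by (simp add: unshuffle3_def unshuffle_assoc)

lemma unshuffle_koszul_cocomm:
  "unshuffle (koszul d) f w = unshuffle (koszul d) (\<lambda>a b. signed (odd_word d a \<and> odd_word d b) (f b a)) w"
  using unshuffle_cocomm[of "koszul d" f w] by (simp add: koszul_sym)

lemma unshuffle3_swap12: "unshuffle3 d f w = unshuffle3 d (\<lambda>a b e. signed (odd_word d a \<and> odd_word d b) (f b a e)) w"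
  unfolding unshuffle3_assoc[symmetric] by (rule unshuffle_cong) (rule unshuffle_koszul_cocomm)

lemma unshuffle3_swap23: "unshuffle3 d f w = unshuffle3 d (\<lambda>a b e. signed (odd_word d b \<and> odd_word d e) (f a e b)) w"
  unfolding unshuffle3_def by (rule unshuffle_cong) (rule unshuffle_koszul_cocomm)

lemma unshuffle3_minus: "unshuffle3 d (\<lambda>a b e. - f a b e) w = - unshuffle3 d f w"
  and unshuffle3_add: "unshuffle3 d (\<lambda>a b e. f a b e + g a b e) w = unshuffle3 d f w + unshuffle3 d g w"
  and unshuffle3_diff: "unshuffle3 d (\<lambda>a b e. f a b e - g a b e) w = unshuffle3 d f w - unshuffle3 d g w"
  and unshuffle3_zero [simp]: "unshuffle3 d (\<lambda>a b e. 0) w = 0"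
  by (auto simp: unshuffle3_def unshuffle_minus unshuffle_add unshuffle_diff)

lemma unshuffle3_odd_swap12:
  assumes "\<And>a b e. \<not> odd_word d a \<or> \<not> odd_word d b \<Longrightarrow> f a b e = 0"
  shows "unshuffle3 d f w = - unshuffle3 d (\<lambda>a b e. f b a e) w"
proof -
  have "unshuffle3 d f w = unshuffle3 d (\<lambda>a b e. - f b a e) w"
    by (subst unshuffle3_swap12) (rule arg_cong[where f = "\<lambda>f. unshuffle3 d f w"], use assms in \<open>auto simp: fun_eq_iff signed_def\<close>)
  then show ?thesis by (simp add: unshuffle3_minus)
qed

lemma unshuffle3_odd_swap23:
  assumes "\<And>a b e. \<not> odd_word d b \<or> \<not> odd_word d e \<Longrightarrow> f a b e = 0"
  shows "unshuffle3 d f w = - unshuffle3 d (\<lambda>a b e. f a e b) w"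
proof -
  have "unshuffle3 d f w = unshuffle3 d (\<lambda>a b e. - f a e b) w"
    by (subst unshuffle3_swap23) (rule arg_cong[where f = "\<lambda>f. unshuffle3 d f w"], use assms in \<open>auto simp: fun_eq_iff signed_def\<close>)
  then show ?thesis by (simp add: unshuffle3_minus)
qed

lemma unshuffle3_odd_rotate:
  assumes "\<And>a b e. \<not> odd_word d a \<or> \<not> odd_word d b \<or> \<not> odd_word d e \<Longrightarrow> f a b e = 0"
  shows "unshuffle3 d f w = unshuffle3 d (\<lambda>a b e. f e a b) w"
proof -
  have "unshuffle3 d f w = - unshuffle3 d (\<lambda>a b e. f b a e) w"
    by (rule unshuffle3_odd_swap12) (use assms in auto)
  also have "unshuffle3 d (\<lambda>a b e. f b a e) w = - unshuffle3 d (\<lambda>a b e. f e a b) w"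
    by (rule unshuffle3_odd_swap23) (use assms in auto)
  finally show ?thesis by simp
qed

text \<open>Three odd factors can be rotated without a sign, so the sum equals both of its
  rotations, and the cyclic identity kills the total. The values lie in an arbitrary abelian group
  here; division by 3 is left to \<open>triple_eq_0D\<close> and
  \<open>triple_eq_0D_M\<close>.\<close>

lemma unshuffle3_cyclic:
  assumes A: "has_parity d True A"
    and zero: "\<And>x y. k 0 x y = 0" "\<And>x y. k x 0 y = 0" "\<And>x y. k x y 0 = 0"
    and cyc: "\<And>x y z. k x y z + k y z x + k z x y = 0"
  shows "unshuffle3 d (\<lambda>a b e. k (A a) (A b) (A e)) w + unshuffle3 d (\<lambda>a b e. k (A a) (A b) (A e)) w
    + unshuffle3 d (\<lambda>a b e. k (A a) (A b) (A e)) w = 0" (is "?t + ?t + ?t = 0")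
proof -
  let ?f = "\<lambda>a b e. k (A a) (A b) (A e)"
  have z: "\<not> odd_word d a \<or> \<not> odd_word d b \<or> \<not> odd_word d e \<Longrightarrow> ?f a b e = 0" for a b e
    using A by (auto simp: has_parity_def zero)
  have 1: "?t = unshuffle3 d (\<lambda>a b e. ?f e a b) w"
    by (rule unshuffle3_odd_rotate[of d ?f]) (use z in auto)
  have 2: "unshuffle3 d (\<lambda>a b e. ?f e a b) w = unshuffle3 d (\<lambda>a b e. ?f b e a) w"
    by (rule unshuffle3_odd_rotate[of d "\<lambda>a b e. ?f e a b"]) (use z in auto)
  have "?t + ?t + ?t = unshuffle3 d (\<lambda>a b e. ?f a b e + ?f b e a + ?f e a b) w"
    using 1 2 by (simp add: unshuffle3_add)
  then show ?thesis by (simp add: cyc)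
qed

lemma has_parity_conv:
  fixes F :: "'m word \<Rightarrow> 'a::ab_group_add" and G :: "'m word \<Rightarrow> 'b::ab_group_add"
  assumes "biadditive h" "has_parity d k F" "has_parity d l G"
  shows "has_parity d (k \<noteq> l) (conv d h F G)"
  unfolding has_parity_def
proof (intro allI impI)
  fix w :: "'m word" assume w: "odd_word d w \<noteq> (k \<noteq> l)"
  have "conv d h F G w = unshuffle (koszul d) (\<lambda>a b. 0) w"
    unfolding conv_def
  proof (rule unshuffle_cong)
    fix a b assume "mset a + mset b = mset w"
    then have "odd_word d a \<noteq> k \<or> odd_word d b \<noteq> l" using w odd_word_split by blast
    then show "h (F a) (G b) = 0"
      using assms by (auto simp: has_parity_def biadditive_simps[OF assms(1)])
  qed
  then show "conv d h F G w = 0" by simp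
qed

lemma front_additive_zero: "front_additive F \<Longrightarrow> F (Inl 0 # w) = 0"
  unfolding front_additive_def using additive.zero by fastforce

text \<open>The inserted vector takes the place of an odd letter, which reverses the parity: hence
  \<open>k = l\<close> where \<open>has_parity_conv\<close> has \<open>k \<noteq> l\<close>.\<close>

lemma has_parity_deriv:
  fixes F :: "'m::ab_group_add word \<Rightarrow> 'a::ab_group_add"
  assumes "front_additive F" "has_parity d k Y" "has_parity d l F"
  shows "has_parity d (k = l) (deriv_along d Y F)"
  unfolding has_parity_def
proof (intro allI impI)
  fix w :: "'m word" assume w: "odd_word d w \<noteq> (k = l)"
  have "deriv_along d Y F w = unshuffle (koszul d) (\<lambda>a b. 0) w"
    unfolding deriv_along_def
  proof (rule unshuffle_cong)
    fix a b assume "mset a + mset b = mset w"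
    then have "odd_word d a \<noteq> k \<or> odd_word d b = l" using w odd_word_split by blast
    then show "F (Inl (Y a) # b) = 0"
      using assms by (auto simp: has_parity_def front_additive_zero)
  qed
  then show "deriv_along d Y F w = 0" by simp
qed

lemma front_additive_unshuffle:
  "front_additive F \<Longrightarrow> F (Inl (unshuffle c f w) # v) = unshuffle c (\<lambda>a b. F (Inl (f a b) # v)) w"
  unfolding front_additive_def using unshuffle_hom[of "\<lambda>m. F (Inl m # v)"] by blast

text \<open>Leibniz rule. Substituting an even \<open>W\<close> for an odd vector is an odd
  operation, so passing the odd \<open>F\<close> costs a sign; moving the even \<open>W\<close>
  itself costs none.\<close>

lemma deriv_along_conv:
  assumes h: "biadditive h" and W: "has_parity d False W" and F: "has_parity d True F"
    and G: "front_additive G"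
  shows "deriv_along d W (conv d h F G) w = conv d h (deriv_along d W F) G w - conv d h F (deriv_along d W G) w"
proof -
  have "unshuffle3 d (\<lambda>a b e. signed (odd_word d b) (h (F b) (G (Inl (W a) # e)))) w
     = unshuffle3 d (\<lambda>a b e. - h (F a) (G (Inl (W b) # e))) w"
    by (subst unshuffle3_swap12)
       (rule arg_cong[where f = "\<lambda>f. unshuffle3 d f w"],
        use F W in \<open>auto simp: fun_eq_iff signed_def has_parity_def biadditive_simps[OF h] front_additive_zero[OF G]\<close>)
  then show ?thesis
    by (simp add: deriv_along_def conv_def unshuffle_add biadditive_unshuffle[OF h] unshuffle3_assoc
        unshuffle3_def[symmetric] unshuffle3_minus)
qed

lemma conv_swap:
  assumes h: "biadditive h" and "has_parity d k F" "has_parity d l G"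
  shows "conv d h F G w = signed (k \<and> l) (conv d (\<lambda>x y. h y x) G F w)"
proof -
  have "signed (odd_word d a \<and> odd_word d b) (h (F b) (G a)) = signed (k \<and> l) (h (F b) (G a))" for a b
    using assms by (cases "odd_word d a = l"; cases "odd_word d b = k") (auto simp: has_parity_def biadditive_simps)
  then show ?thesis
    unfolding conv_def by (subst unshuffle_koszul_cocomm) (auto simp: unshuffle_signed[symmetric])
qed

lemma deriv_along_add: "deriv_along d Y (\<lambda>w. F w + G w) w = deriv_along d Y F w + deriv_along d Y G w"
  and deriv_along_diff: "deriv_along d Y (\<lambda>w. F w - G w) w = deriv_along d Y F w - deriv_along d Y G w"
  by (auto simp: deriv_along_def unshuffle_add unshuffle_diff)

lemma deriv_along_hom: "additive s \<Longrightarrow> deriv_along d Y (\<lambda>w. s (F w)) w = s (deriv_along d Y F w)"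
  by (simp add: deriv_along_def unshuffle_hom)

lemma conv_add:
  assumes "biadditive h"
  shows "conv d h (\<lambda>w. F w + F' w) G w = conv d h F G w + conv d h F' G w"
    "conv d h F (\<lambda>w. G w + G' w) w = conv d h F G w + conv d h F G' w"
  by (auto simp: conv_def biadditive_simps[OF assms] unshuffle_add)

lemma conv_assoc_left:
  assumes "biadditive h"
  shows "conv d h (conv d h' F G) K w = unshuffle3 d (\<lambda>a b e. h (h' (F a) (G b)) (K e)) w"
  by (simp add: conv_def biadditive_unshuffle[OF assms] unshuffle3_assoc)

lemma conv_assoc_right:
  assumes "biadditive h"
  shows "conv d h F (conv d h' G K) w = unshuffle3 d (\<lambda>a b e. h (F a) (h' (G b) (K e))) w"
  by (simp add: conv_def biadditive_unshuffle[OF assms] unshuffle3_def)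

lemmas conv_assoc = conv_assoc_left conv_assoc_right

section \<open>The curvature identity\<close>

locale cocycle_module = lie_module sg bracket sM act
  for sg :: "'k::field_char_0 \<Rightarrow> 'g::ab_group_add \<Rightarrow> 'g" and bracket
    and sM :: "'k \<Rightarrow> 'm::ab_group_add \<Rightarrow> 'm" and act +
  fixes H :: "'g \<Rightarrow> 'g \<Rightarrow> 'm"
  assumes cocycle: "two_cocycle sg bracket sM act H"
begin

lemma H_linear_right: "Vector_Spaces.linear sg sM (H x)"
  and H_linear_left: "Vector_Spaces.linear sg sM (\<lambda>x. H x y)"
  and H_skew: "H x y = - H y x"
  and H_cocycle: "act x (H y z) + act y (H z x) + act z (H x y)
        + H x (bracket y z) + H y (bracket z x) + H z (bracket x y) = 0"
  using cocycle unfolding two_cocycle_def by blast+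

lemmas scale_simps =
  module_hom.scale[OF bracket_linear_left[unfolded linear_iff_module_hom]]
  module_hom.scale[OF bracket_linear_right[unfolded linear_iff_module_hom]]
  module_hom.scale[OF act_linear_left[unfolded linear_iff_module_hom]]
  module_hom.scale[OF act_linear_right[unfolded linear_iff_module_hom]]
  module_hom.scale[OF H_linear_left[unfolded linear_iff_module_hom]]
  module_hom.scale[OF H_linear_right[unfolded linear_iff_module_hom]]

lemma biadditive_bracket: "biadditive bracket"
  using linear_imp_additive[OF bracket_linear_left] linear_imp_additive[OF bracket_linear_right]
  by (simp add: biadditive_def)

lemma biadditive_act: "biadditive act"
  using linear_imp_additive[OF act_linear_left] linear_imp_additive[OF act_linear_right]
  by (simp add: biadditive_def)

lemma biadditive_H: "biadditive H"
  using linear_imp_additive[OF H_linear_left] linear_imp_additive[OF H_linear_right]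
  by (simp add: biadditive_def)

lemmas bracket_simps = biadditive_simps[OF biadditive_bracket]
  and act_simps = biadditive_simps[OF biadditive_act]
  and H_simps = biadditive_simps[OF biadditive_H]

lemma bracket_skew: "bracket x y = - bracket y x"
proof -
  have "bracket (x + y) (x + y) = bracket x y + bracket y x"
    unfolding bracket_simps(1,2) by (simp add: bracket_self)
  then show ?thesis by (simp add: bracket_self eq_neg_iff_add_eq_0)
qed

lemma additive_sg: "additive (sg r)" and additive_sM: "additive (sM r)"
  by (simp_all add: additive_def scale_right_distrib M.scale_right_distrib)

lemma sg_double: "sg 2 x = x + x" and sM_double: "sM 2 u = u + u"
  using scale_left_distrib[of 1 1 x] M.scale_left_distrib[of 1 1 u] by simp_all

lemma sg_half_double: "sg (1/2) (x + x) = x" and sM_half_double: "sM (1/2) (u + u) = u"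
  by (simp_all add: sg_double[symmetric] sM_double[symmetric])

lemma sg_half_add: "sg (1/2) x + sg (1/2) x = x" and sM_half_add: "sM (1/2) u + sM (1/2) u = u"
  using scale_left_distrib[of "1/2" "1/2" x] M.scale_left_distrib[of "1/2" "1/2" u] by simp_all

lemma double_eq_0D: "x = - x \<Longrightarrow> x = 0" for x :: 'g
proof -
  assume "x = - x"
  then have "x + x = 0" by (simp add: eq_neg_iff_add_eq_0)
  then have "sg 2 x = 0" by (simp add: sg_double)
  then show "x = 0" by simp
qed

lemma triple_eq_0D: "x + x + x = 0 \<Longrightarrow> x = 0" for x :: 'g
proof -
  assume "x + x + x = 0"
  then have "sg 3 x = 0" using scale_left_distrib[of 2 1 x] by (simp add: sg_double)
  then show "x = 0" by simp
qed

lemma triple_eq_0D_M: "u + u + u = 0 \<Longrightarrow> u = 0" for u :: 'm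
proof -
  assume "u + u + u = 0"
  then have "sM 3 u = 0" using M.scale_left_distrib[of 2 1 u] by (simp add: sM_double)
  then show "u = 0" by simp
qed

end

text \<open>\<open>U\<close> is the generic odd vector, \<open>A\<close> a generic odd function of it.\<close>

locale odd_map = cocycle_module sg bracket sM act H
  for sg :: "'k::field_char_0 \<Rightarrow> 'g::ab_group_add \<Rightarrow> 'g" and bracket
    and sM :: "'k \<Rightarrow> 'm::ab_group_add \<Rightarrow> 'm" and act H +
  fixes d :: "nat \<Rightarrow> bool" and A :: "'m word \<Rightarrow> 'g" and U :: "'m word \<Rightarrow> 'm"
  assumes A_odd: "has_parity d True A" and U_odd: "has_parity d True U"
    and A_add: "front_additive A" and U_add: "front_additive U"
    and A_skew: "A (Inl u # Inl v # w) = - A (Inl v # Inl u # w)"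
    and U_Cons: "U (Inl u # w) = (if w = [] then u else 0)"
begin

abbreviation "cv \<equiv> conv d"
abbreviation "D \<equiv> deriv_along d"

definition "W w = cv act A U w + sM (1/2) (cv H A A w)"
definition "B w = D W A w - sg (1/2) (cv bracket A A w)"
definition "Z w = cv act B U w + cv H B A w"

lemma W_even: "has_parity d False W"
proof -
  have "has_parity d False (cv act A U)" "has_parity d False (cv H A A)"
    using has_parity_conv[OF biadditive_act A_odd U_odd] has_parity_conv[OF biadditive_H A_odd A_odd] by auto
  then show ?thesis unfolding has_parity_def W_def by auto
qed

lemma DWA_even: "has_parity d False (D W A)"
  using has_parity_deriv[OF A_add W_even A_odd] by simp

lemma bracket_AA_even: "has_parity d False (cv bracket A A)"
  using has_parity_conv[OF biadditive_bracket A_odd A_odd] by simp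

lemma B_even: "has_parity d False B"
  using DWA_even bracket_AA_even unfolding has_parity_def B_def by auto

lemma B_front_eq: "D W A = (\<lambda>w. B w + sg (1/2) (cv bracket A A w))"
  by (simp add: B_def fun_eq_iff)

lemma conv_scale_left:
  "cv act (\<lambda>w. sg r (F w)) G w = sM r (cv act F G w)"
  "cv H (\<lambda>w. sg r (F w)) K w = sM r (cv H F K w)"
  "cv bracket (\<lambda>w. sg r (F w)) K w = sg r (cv bracket F K w)"
  by (simp_all add: conv_def unshuffle_hom[OF additive_sM] unshuffle_hom[OF additive_sg] scale_simps)

lemma conv_scale_right:
  "cv act F (\<lambda>w. sM r (G w)) w = sM r (cv act F G w)"
  by (simp add: conv_def unshuffle_hom[OF additive_sM] scale_simps)

lemma D_U: "D Y U w = Y w"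
  unfolding deriv_along_def U_Cons by (subst unshuffle_left_only) auto

text \<open>Exchanging the two odd factors \<open>A\<close> gives a minus sign, so the commutator in
  \<open>act_bracket\<close> counts the iterated action twice.\<close>

lemma act_act: "cv act A (cv act A U) w = sM (1/2) (cv act (cv bracket A A) U w)"
proof -
  let ?f = "\<lambda>a b e. act (A a) (act (A b) (U e))"
  have "unshuffle3 d ?f w = - unshuffle3 d (\<lambda>a b e. ?f b a e) w"
    by (rule unshuffle3_odd_swap12) (use A_odd in \<open>auto simp: has_parity_def act_simps\<close>)
  moreover have "cv act (cv bracket A A) U w = unshuffle3 d ?f w - unshuffle3 d (\<lambda>a b e. ?f b a e) w"
    by (simp add: conv_assoc[OF biadditive_act] act_bracket unshuffle3_diff)
  moreover have "cv act A (cv act A U) w = unshuffle3 d ?f w"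
    by (simp add: conv_assoc[OF biadditive_act])
  ultimately have "cv act (cv bracket A A) U w = cv act A (cv act A U) w + cv act A (cv act A U) w"
    by simp
  then show ?thesis by (simp only: sM_half_double)
qed

text \<open>For an odd element the three terms of the Jacobi identity coincide, and characteristic
  zero allows division by 3.\<close>

lemma bracket_bracket: "cv bracket (cv bracket A A) A w = 0"
proof -
  let ?k = "\<lambda>x y z. bracket x (bracket y z)"
  have "cv bracket (cv bracket A A) A w = cv (\<lambda>x y. bracket y x) A (cv bracket A A) w"
    using conv_swap[OF biadditive_bracket bracket_AA_even A_odd] by simp
  also have "\<dots> = - cv bracket A (cv bracket A A) w"
    unfolding conv_def by (subst bracket_skew) (simp add: unshuffle_minus)
  also have "cv bracket A (cv bracket A A) w = unshuffle3 d (\<lambda>a b e. ?k (A a) (A b) (A e)) w"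
    by (simp add: conv_assoc[OF biadditive_bracket])
  also have "\<dots> = 0"
    by (rule triple_eq_0D, rule unshuffle3_cyclic[OF A_odd]) (auto simp: bracket_simps jacobi)
  finally show ?thesis by simp
qed

lemma H_bracket: "cv H (cv bracket A A) A w = cv act A (cv H A A) w"
proof -
  \<comment> \<open>The six terms of the cocycle identity are the three rotations of this
    expression.\<close>
  let ?k = "\<lambda>x y z. act x (H y z) + H x (bracket y z)"
  have "cv H (cv bracket A A) A w = cv (\<lambda>x y. H y x) A (cv bracket A A) w"
    using conv_swap[OF biadditive_H bracket_AA_even A_odd] by simp
  also have "\<dots> = - cv H A (cv bracket A A) w"
    unfolding conv_def by (subst H_skew) (simp add: unshuffle_minus)
  finally have 1: "cv H (cv bracket A A) A w = - cv H A (cv bracket A A) w" .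
  have "cv act A (cv H A A) w + cv H A (cv bracket A A) w = unshuffle3 d (\<lambda>a b e. ?k (A a) (A b) (A e)) w"
    by (simp add: conv_assoc[OF biadditive_act] conv_assoc[OF biadditive_H] unshuffle3_add)
  also have "\<dots> = 0"
  proof (rule triple_eq_0D_M, rule unshuffle3_cyclic[OF A_odd])
    show "?k x y z + ?k y z x + ?k z x y = 0" for x y z
      using H_cocycle[of x y z] by (simp add: algebra_simps)
  qed (auto simp: bracket_simps act_simps H_simps)
  finally have "cv act A (cv H A A) w = - cv H A (cv bracket A A) w"
    by (rule eq_neg_iff_add_eq_0[THEN iffD2])
  then show ?thesis using 1 by (simp only:)
qed

text \<open>After \<open>D W A\<close> is replaced by \<open>B\<close> plus half of
  \<open>cv bracket A A\<close>, everything without \<open>B\<close> cancels: the iterated actions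
  by \<open>act_act\<close>, the terms with \<open>H\<close> by \<open>H_bracket\<close>. The two
  Leibniz terms of \<open>cv H A A\<close> agree, which absorbs its factor 1/2.\<close>

lemma W_invariant: "D W W w = Z w"
proof -
  have HA: "cv H A F w = - cv H F A w" if "has_parity d False F" for F w
  proof -
    have "cv H A F w = cv (\<lambda>x y. H y x) F A w"
      using conv_swap[OF biadditive_H A_odd that] by simp
    also have "\<dots> = - cv H F A w"
      unfolding conv_def by (subst H_skew) (simp add: unshuffle_minus)
    finally show ?thesis .
  qed
  have "D W (cv H A A) w = cv H (D W A) A w + cv H (D W A) A w"
    by (simp add: deriv_along_conv[OF biadditive_H W_even A_odd A_add] HA[OF DWA_even])
  moreover have "D W (cv act A U) w = cv act (D W A) U w - cv act A W w"
    using deriv_along_conv[OF biadditive_act W_even A_odd U_add, of w] by (simp add: D_U[abs_def])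
  moreover have "D W W w = D W (cv act A U) w + sM (1/2) (D W (cv H A A) w)"
    by (subst (2) W_def[abs_def]) (simp add: deriv_along_add deriv_along_hom[OF additive_sM])
  ultimately have 1: "D W W w = cv act (D W A) U w - cv act A W w + cv H (D W A) A w"
    by (simp add: sM_half_double)
  have 2: "cv act A W w = sM (1/2) (cv act (cv bracket A A) U w) + sM (1/2) (cv act A (cv H A A) w)"
    by (simp add: W_def[abs_def] conv_add[OF biadditive_act] act_act conv_scale_right)
  have 3: "cv act (D W A) U w = cv act B U w + sM (1/2) (cv act (cv bracket A A) U w)"
    by (simp add: B_front_eq conv_add[OF biadditive_act] conv_scale_left)
  have 4: "cv H (D W A) A w = cv H B A w + sM (1/2) (cv act A (cv H A A) w)"
    by (simp add: B_front_eq conv_add[OF biadditive_H] conv_scale_left H_bracket)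
  show ?thesis unfolding Z_def 1 2 3 4 by simp
qed

text \<open>The square of an odd derivation is again a derivation, here the one along
  \<open>D W W\<close>. The other terms insert \<open>W\<close> in two slots at once; they cancel
  because \<open>W\<close> is even while \<open>A\<close> is skew in these slots.\<close>

lemma D_D: "D W (D W A) w = D Z A w"
proof -
  let ?g = "\<lambda>a b e. A (Inl (W b) # Inl (W a) # e)"
  have A0: "A (Inl 0 # w) = 0" "A (Inl u # Inl 0 # w) = 0" for u w
    using front_additive_zero[OF A_add] A_skew[of u 0 w] by auto
  have W0: "W w = 0" if "odd_word d w" for w
    using W_even that by (auto simp: has_parity_def)
  have "signed (odd_word d a \<and> odd_word d b) (?g b a e) = - ?g a b e" for a b e
  proof (cases "odd_word d a \<or> odd_word d b")
    case True
    then show ?thesis using A0 W0 by auto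
  next
    case False
    then show ?thesis using A_skew[of "W a" "W b" e] by simp
  qed
  then have "unshuffle3 d ?g w = unshuffle3 d (\<lambda>a b e. - ?g a b e) w"
    by (subst unshuffle3_swap12) simp
  then have g0: "unshuffle3 d ?g w = 0"
    unfolding unshuffle3_minus by (rule double_eq_0D)
  have "D W (D W A) w = unshuffle3 d (\<lambda>a b e. A (Inl (W (Inl (W a) # b)) # e)) w
      + unshuffle3 d (\<lambda>a b e. signed (odd_word d b) (?g a b e)) w"
    by (simp add: deriv_along_def unshuffle_add unshuffle3_def)
  also have "unshuffle3 d (\<lambda>a b e. signed (odd_word d b) (?g a b e)) w = unshuffle3 d ?g w"
    by (rule arg_cong[where f = "\<lambda>f. unshuffle3 d f w"]) (auto simp: fun_eq_iff signed_def A0 W0)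
  also have "unshuffle3 d (\<lambda>a b e. A (Inl (W (Inl (W a) # b)) # e)) w = D (D W W) A w"
    by (simp add: deriv_along_def front_additive_unshuffle[OF A_add] unshuffle3_assoc)
  also have "D (D W W) A w = D Z A w" by (simp add: W_invariant[abs_def])
  finally show ?thesis by (simp add: g0)
qed

text \<open>Both Leibniz terms of \<open>cv bracket A A\<close> agree, so half of its derivative is
  \<open>cv bracket (D W A) A\<close>. There \<open>D W A\<close> may be replaced by
  \<open>B\<close>, the difference being zero by the Jacobi identity.\<close>

lemma curvature_identity: "D W B w - D Z A w + cv bracket B A w = 0"
proof -
  have "cv bracket A (D W A) w = cv (\<lambda>x y. bracket y x) (D W A) A w"
    using conv_swap[OF biadditive_bracket A_odd DWA_even] by simp
  also have "\<dots> = - cv bracket (D W A) A w"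
    unfolding conv_def by (subst bracket_skew) (simp add: unshuffle_minus)
  finally have "D W (cv bracket A A) w = cv bracket (D W A) A w + cv bracket (D W A) A w"
    by (simp add: deriv_along_conv[OF biadditive_bracket W_even A_odd A_add])
  moreover have "cv bracket (D W A) A w = cv bracket B A w"
    by (simp add: B_front_eq conv_add[OF biadditive_bracket] conv_scale_left bracket_bracket)
  moreover have "D W B w = D W (D W A) w - sg (1/2) (D W (cv bracket A A) w)"
    unfolding B_def[abs_def] by (simp add: deriv_along_diff deriv_along_hom[OF additive_sg])
  ultimately show ?thesis by (simp add: D_D sg_half_double)
qed

end

section \<open>The brackets as unshuffle sums\<close>

lemma lin_diff: "(\<And>r. additive (t r)) \<Longrightarrow> lin s t f \<Longrightarrow> lin s t g \<Longrightarrow> lin s t (\<lambda>x. f x - g x)"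
  by (auto simp: lin_def additive.diff algebra_simps)

lemma lin_compose: "lin t r g \<Longrightarrow> lin s t f \<Longrightarrow> lin s r (\<lambda>x. g (f x))"
  by (simp add: lin_def)

lemma alternating_compose: "lin t r g \<Longrightarrow> alternating s t P \<Longrightarrow> alternating s r (\<lambda>us. g (P us))"
  unfolding alternating_def by (auto intro: lin_compose dest: linD(3))

lemma alternating_front: "alternating s t P \<Longrightarrow> lin s t (\<lambda>x. P (x # v))"
  using spec[of "\<lambda>u. \<forall>v. lin s t (\<lambda>x. P (u @ x # v))" "[]"] by (simp add: alternating_def)

lemma alternating_tail:
  assumes "alternating s t P"
  shows "alternating s t (\<lambda>us. P (x # us))"
  unfolding alternating_def
proof (intro conjI allI)
  fix u v y
  have "lin s t (\<lambda>y. P ((x # u) @ y # v))" "P ((x # u) @ y # y # v) = 0"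
    using assms unfolding alternating_def by blast+
  then show "lin s t (\<lambda>y. P (x # u @ y # v))" "P (x # u @ y # y # v) = 0" by simp_all
qed

section \<open>Products and insertions of maps on lists\<close>

definition concentrated :: "int \<Rightarrow> ('a list \<Rightarrow> 'b::zero) \<Rightarrow> bool" where
  "concentrated d P \<longleftrightarrow> (\<forall>us. int (length us) \<noteq> d \<longrightarrow> P us = 0)"

lemma concentrated_usum:
  assumes "\<And>a b. int (length a + length b) \<noteq> d \<Longrightarrow> f a b = 0"
  shows "concentrated d (usum f)"
  unfolding concentrated_def
proof (intro allI impI)
  fix us :: "'a list" assume us: "int (length us) \<noteq> d"
  have "usum f us = usum (\<lambda>_ _. 0) us"
  proof (rule unshuffle_cong)
    fix a b assume "mset a + mset b = mset us"
    then have "length a + length b = length us" by (metis size_mset size_union)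
    then show "f a b = 0" using us assms by simp
  qed
  then show "usum f us = 0" by simp
qed

text \<open>The identity of \<open>M\<close> as a map of degree 1: it makes the bare vector in the
  action terms a factor like any other.\<close>

definition single :: "'m list \<Rightarrow> 'm::zero" where
  "single us = (if length us = 1 then hd us else 0)"

text \<open>\<open>list_conv\<close> and \<open>insertion\<close> are \<open>conv\<close> and
  \<open>deriv_along\<close> on words without parameters.\<close>

definition list_conv :: "('a \<Rightarrow> 'b \<Rightarrow> 'c::ab_group_add) \<Rightarrow> ('m list \<Rightarrow> 'a) \<Rightarrow> ('m list \<Rightarrow> 'b) \<Rightarrow> 'm list \<Rightarrow> 'c" where
  "list_conv h P Q = usum (\<lambda>a b. h (P a) (Q b))"

definition insertion :: "('m list \<Rightarrow> 'c::ab_group_add) \<Rightarrow> ('m list \<Rightarrow> 'm) \<Rightarrow> 'm list \<Rightarrow> 'c" where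
  "insertion P Y = usum (\<lambda>a b. P (Y a # b))"

lemma concentrated_single: "concentrated 1 single"
  by (simp add: concentrated_def single_def)

lemma concentrated_list_conv:
  fixes P :: "'c list \<Rightarrow> 'a::ab_group_add" and Q :: "'c list \<Rightarrow> 'b::ab_group_add"
  assumes "biadditive h" "concentrated p P" "concentrated q Q"
  shows "concentrated (p + q) (list_conv h P Q)"
  unfolding list_conv_def
proof (rule concentrated_usum)
  fix a b :: "'c list" assume "int (length a + length b) \<noteq> p + q"
  then have "int (length a) \<noteq> p \<or> int (length b) \<noteq> q" by auto
  then show "h (P a) (Q b) = 0"
    using assms by (auto simp: concentrated_def biadditive_simps)
qed

lemma concentrated_insertion:
  fixes P :: "'m::ab_group_add list \<Rightarrow> 'c::ab_group_add"
  assumes "alternating s t P" "concentrated p P" "concentrated y Y"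
  shows "concentrated (p + y - 1) (insertion P Y)"
  unfolding insertion_def
proof (rule concentrated_usum)
  fix a b :: "'m list" assume "int (length a + length b) \<noteq> p + y - 1"
  then have "int (length a) \<noteq> y \<or> int (length (Y a # b)) \<noteq> p" by auto
  then show "P (Y a # b) = 0"
    using assms(2,3) linD(3)[OF alternating_front[OF assms(1)]] by (auto simp: concentrated_def)
qed

lemma alternating_single:
  assumes "vector_space s"
  shows "alternating s s single"
proof -
  have "lin s s (\<lambda>x. single (u @ x # v))" for u v
    using module.scale_zero_right[of s] assms
    by (cases u; cases v) (auto simp: lin_def single_def module_iff_vector_space)
  then show ?thesis by (auto simp: alternating_def single_def)
qed

lemma alternating_list_conv:
  assumes "\<And>r. additive (t r)" "\<And>y. lin s' t (\<lambda>x. h x y)" "\<And>x. lin s'' t (h x)"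
    and P: "alternating s s' P" and Q: "alternating s s'' Q"
  shows "alternating s t (list_conv h P Q)"
  unfolding list_conv_def
  by (rule alternating_usum, rule assms(1), rule alternating_compose[OF assms(2) P], rule alternating_compose[OF assms(3) Q])

lemma alternating_insertion:
  assumes "\<And>r. additive (t r)" and P: "alternating s t P" and Y: "alternating s s Y"
  shows "alternating s t (insertion P Y)"
  unfolding insertion_def
  by (rule alternating_usum, rule assms(1), rule alternating_compose[OF alternating_front[OF P] Y], rule alternating_tail[OF P])

lemma lin_list_conv_left:
  assumes "\<And>r. additive (t r)" "\<And>y. lin s t (\<lambda>x. h x y)"
  shows "lin (hom_scale s) t (\<lambda>P. list_conv h P Q us)"
  unfolding list_conv_def
  by (rule lin_usum, rule assms(1)) (use assms(2) in \<open>auto simp: lin_def hom_scale_def\<close>)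

lemma lin_list_conv_right:
  assumes "\<And>r. additive (t r)" "\<And>x. lin s t (h x)"
  shows "lin (hom_scale s) t (\<lambda>Q. list_conv h P Q us)"
  unfolding list_conv_def
  by (rule lin_usum, rule assms(1)) (use assms(2) in \<open>auto simp: lin_def hom_scale_def\<close>)

lemma lin_insertion_left:
  assumes "\<And>r. additive (t r)"
  shows "lin (hom_scale t) t (\<lambda>P. insertion P Y us)"
  unfolding insertion_def
  by (rule lin_usum, rule assms(1)) (auto simp: lin_def hom_scale_def)

lemma lin_insertion_right:
  assumes "\<And>r. additive (t r)" "alternating s t P"
    and "\<And>us. lin q s (\<lambda>Y. F Y us)"
  shows "lin q t (\<lambda>Y. insertion P (F Y) us)"
  unfolding insertion_def
  by (rule lin_usum, rule assms(1)) (rule lin_compose[OF alternating_front[OF assms(2)] assms(3)])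

lemma (in module) scale_minus_one_power: "scale ((-1) ^ k) x = signed (odd k) x"
  by (cases "even k") auto

context cocycle_module
begin

lemma lin_bracket: "lin sg sg (\<lambda>x. bracket x y)" "lin sg sg (bracket x)"
  and lin_act: "lin sg sM (\<lambda>x. act x u)" "lin sM sM (act x)"
  and lin_H: "lin sg sM (\<lambda>x. H x y)" "lin sg sM (H x)"
  by (simp_all add: lin_def bracket_simps act_simps H_simps scale_simps)

text \<open>The truth values \<open>p\<close>, \<open>q\<close>, \<open>r\<close> say whether the degrees of \<open>P\<close>, \<open>Q\<close>, \<open>R\<close> are odd.\<close>

definition "br2 p q P Q us = insertion P (list_conv act Q single) us
  - signed (p \<and> q) (insertion Q (list_conv act P single) us)
  + signed (p \<and> q) (list_conv bracket P Q us)"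

definition "hins P Q R = insertion P (list_conv H Q R)"

text \<open>The signs are the exponents of \<open>ternary_bracket\<close> modulo 2. In the second,
  fourth and sixth term the product of the inner degrees in \<open>H_insertion_sign\<close> cancels
  against the same product in the exchange sign.\<close>

definition "br3 p q r P Q R us = sg (1/2)
   (signed ((\<not> p) \<noteq> (q \<and> r)) (hins P Q R us)
  - signed (\<not> p) (hins P R Q us)
  - signed ((\<not> q) \<noteq> ((p \<and> r) \<noteq> (p \<and> q))) (hins Q P R us)
  + signed ((\<not> q) \<noteq> (p \<and> q)) (hins Q R P us)
  + signed ((\<not> r) \<noteq> ((p \<and> q) \<noteq> ((p \<noteq> q) \<and> r))) (hins R P Q us)
  - signed ((\<not> r) \<noteq> ((p \<noteq> q) \<and> r)) (hins R Q P us))"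

lemmas lin_intros = lin_insertion_left[OF additive_sg] lin_insertion_right[OF additive_sg, of sM]
  lin_list_conv_left[OF additive_sM lin_act(1)] lin_list_conv_left[OF additive_sg lin_bracket(1)]
  lin_list_conv_left[OF additive_sM lin_H(1)] lin_list_conv_right[OF additive_sg lin_bracket(2)]
  lin_list_conv_right[OF additive_sM lin_H(2)] lin_add[OF additive_sg] lin_diff[OF additive_sg]
  lin_signed[OF additive_sg]

lemmas alternating_intros = alternating_insertion[OF additive_sg] alternating_list_conv[OF additive_sM lin_act]
  alternating_list_conv[OF additive_sg lin_bracket] alternating_list_conv[OF additive_sM lin_H]

lemma lin_br2_left: "alternating sM sg Q \<Longrightarrow> lin (hom_scale sg) sg (\<lambda>P. br2 p q P Q us)"
  unfolding br2_def by (intro lin_intros)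

lemma lin_br2_right: "alternating sM sg P \<Longrightarrow> lin (hom_scale sg) sg (\<lambda>Q. br2 p q P Q us)"
  unfolding br2_def by (intro lin_intros)

lemma lin_scale: "lin sg sg (sg r)"
  by (simp add: lin_def scale_right_distrib scale_left_commute)

lemma lin_br3_left:
  "alternating sM sg Q \<Longrightarrow> alternating sM sg R \<Longrightarrow> lin (hom_scale sg) sg (\<lambda>P. br3 p q r P Q R us)"
  unfolding br3_def hins_def by (intro lin_compose[OF lin_scale] lin_intros)

lemma lin_br3_middle:
  "alternating sM sg P \<Longrightarrow> alternating sM sg R \<Longrightarrow> lin (hom_scale sg) sg (\<lambda>Q. br3 p q r P Q R us)"
  unfolding br3_def hins_def by (intro lin_compose[OF lin_scale] lin_intros)

lemma lin_br3_right:
  "alternating sM sg P \<Longrightarrow> alternating sM sg Q \<Longrightarrow> lin (hom_scale sg) sg (\<lambda>R. br3 p q r P Q R us)"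
  unfolding br3_def hins_def by (intro lin_compose[OF lin_scale] lin_intros)

lemma grading_iff: "P \<in> hom_grading sM sg d \<longleftrightarrow> alternating sM sg P \<and> concentrated d P"
  unfolding concentrated_def by (rule hom_grading_iff) unfold_locales

lemma alternating_add: "alternating sM sg P \<Longrightarrow> alternating sM sg Q \<Longrightarrow> alternating sM sg (\<lambda>us. P us + Q us)"
  by (auto simp: alternating_def intro: lin_add additive_sg)

lemma alternating_diff: "alternating sM sg P \<Longrightarrow> alternating sM sg Q \<Longrightarrow> alternating sM sg (\<lambda>us. P us - Q us)"
  by (auto simp: alternating_def intro: lin_diff additive_sg)

lemma alternating_signed: "alternating sM sg P \<Longrightarrow> alternating sM sg (\<lambda>us. signed b (P us))"
  by (auto simp: alternating_def intro: lin_signed additive_sg)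

lemma br2_grading:
  assumes P: "P \<in> hom_grading sM sg d" and Q: "Q \<in> hom_grading sM sg e"
  shows "br2 p q P Q \<in> hom_grading sM sg (d + e)"
proof -
  have a: "alternating sM sg P" "alternating sM sg Q" and c: "concentrated d P" "concentrated e Q"
    using P Q by (auto simp: grading_iff)
  have s: "alternating sM sM single" by (rule alternating_single) unfold_locales
  have "alternating sM sg (br2 p q P Q)"
    unfolding br2_def[abs_def]
    by (intro alternating_add alternating_diff alternating_signed alternating_intros a s)
  moreover have "concentrated (d + e) (insertion P (list_conv act Q single))"
    using concentrated_insertion[OF a(1) c(1) concentrated_list_conv[OF biadditive_act c(2) concentrated_single]]
    by (simp add: algebra_simps)
  moreover have "concentrated (d + e) (insertion Q (list_conv act P single))"
    using concentrated_insertion[OF a(2) c(2) concentrated_list_conv[OF biadditive_act c(1) concentrated_single]]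
    by (simp add: algebra_simps)
  moreover have "concentrated (d + e) (list_conv bracket P Q)"
    by (rule concentrated_list_conv[OF biadditive_bracket c])
  ultimately show ?thesis by (simp add: grading_iff concentrated_def br2_def)
qed

lemma concentrated_hins:
  assumes "P \<in> hom_grading sM sg d" "Q \<in> hom_grading sM sg e" "R \<in> hom_grading sM sg f"
  shows "concentrated (d + e + f - 1) (hins P Q R)"
  using concentrated_insertion[of sM sg P d "e + f" "list_conv H Q R"] concentrated_list_conv[OF biadditive_H, of e Q f R] assms
  by (simp add: grading_iff hins_def algebra_simps)

lemma alternating_hins:
  assumes "alternating sM sg P" "alternating sM sg Q" "alternating sM sg R"
  shows "alternating sM sg (hins P Q R)"
  unfolding hins_def
  by (intro alternating_intros assms)

lemma br3_grading:
  assumes P: "P \<in> hom_grading sM sg d" and Q: "Q \<in> hom_grading sM sg e" and R: "R \<in> hom_grading sM sg f"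
  shows "br3 p q r P Q R \<in> hom_grading sM sg (d + e + f - 1)"
proof -
  have a: "alternating sM sg P" "alternating sM sg Q" "alternating sM sg R"
    using assms by (auto simp: grading_iff)
  have "alternating sM sg (br3 p q r P Q R)"
    unfolding br3_def[abs_def]
    by (intro alternating_compose[OF lin_scale] alternating_add alternating_diff alternating_signed alternating_hins a)
  moreover have "concentrated (d + e + f - 1) (br3 p q r P Q R)"
    using concentrated_hins[OF P Q R] concentrated_hins[OF P R Q] concentrated_hins[OF Q P R]
      concentrated_hins[OF Q R P] concentrated_hins[OF R P Q] concentrated_hins[OF R Q P]
    by (simp add: concentrated_def br3_def algebra_simps)
  ultimately show ?thesis by (simp add: grading_iff)
qed

lemma sign_scale: "\<sigma> permutes {..<n} \<Longrightarrow> sg (of_int (sign \<sigma>)) x = signed (inversions (\<lambda>_ _. True) (map \<sigma> [0..<n])) x"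
  by (simp add: sign_eq_inversions)

text \<open>The shuffles prescribe block lengths, the unshuffle sums do not. Since \<open>Q\<close>
  and \<open>R\<close> vanish on lists of other lengths, the additional terms are zero.\<close>

lemma H_insertion_eq:
  assumes P: "P \<in> hom_grading sM sg (int p)" and Q: "Q \<in> hom_grading sM sg (int q)" and R: "R \<in> hom_grading sM sg (int r)"
    and n: "length us + 1 = p + q + r"
  shows "H_insertion sg H p q r P Q R us = hins P Q R us"
proof (cases p)
  \<comment> \<open>This is the block size -1: there is no shuffle, and a map without arguments has
    no slot to insert into.\<close>
  case 0
  then have "P (m # b) = 0" for m b using P by (auto simp: grading_iff concentrated_def)
  then show ?thesis using 0 by (simp add: H_insertion_def hins_def insertion_def Sh3_def)
next
  case (Suc k)
  have P0: "P (0 # b) = 0" for b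
    using P linD(3)[OF alternating_front] by (auto simp: grading_iff)
  have P': "additive (\<lambda>m. P (m # b))" for b
    using P linD(5)[OF alternating_front] by (auto simp: grading_iff)
  have n': "length us = q + r + k" using n Suc by simp
  have "H_insertion sg H p q r P Q R us = (\<Sum>\<sigma>\<in>Sh3 q r (int k). signed (inversions (\<lambda>_ _. True) (map \<sigma> [0..<length us]))
      (P (H (Q (take q (permute_list \<sigma> us))) (R (take r (drop q (permute_list \<sigma> us)))) # drop (q + r) (permute_list \<sigma> us))))"
    unfolding H_insertion_def
    by (rule sum.cong) (auto simp: Suc Let_def Sh3_def n' intro!: sign_scale)
  also have "\<dots> = usum (\<lambda>\<alpha> v. usum (\<lambda>\<beta> \<gamma>. if length \<alpha> = q \<and> length \<beta> = r then P (H (Q \<alpha>) (R \<beta>) # \<gamma>) else 0) v) us"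
    using n' by (rule sum_Sh3_list)
  also have "\<dots> = usum (\<lambda>\<alpha> v. usum (\<lambda>\<beta> \<gamma>. P (H (Q \<alpha>) (R \<beta>) # \<gamma>)) v) us"
    by (intro unshuffle_cong) (use Q R in \<open>auto simp: grading_iff concentrated_def H_simps P0\<close>)
  also have "\<dots> = hins P Q R us"
    by (simp add: hins_def insertion_def list_conv_def unshuffle_hom[OF P'] unshuffle_assoc[symmetric])
  finally show ?thesis .
qed

lemma act_insertion_eq:
  assumes P: "P \<in> hom_grading sM sg (int p)" and Q: "Q \<in> hom_grading sM sg (int q)"
    and n: "length us = p + q"
  shows "(\<Sum>\<sigma> \<in> Sh3 q 1 (int p - 1). let v = permute_list \<sigma> us in
          sg (of_int (sign \<sigma>)) (P (act (Q (take q v)) (v ! q) # drop (q + 1) v)))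
     = insertion P (list_conv act Q single) us"
proof (cases p)
  case 0
  then have "P (m # b) = 0" for m b using P by (auto simp: grading_iff concentrated_def)
  then show ?thesis using 0 by (simp add: insertion_def Sh3_def)
next
  case (Suc k)
  have P0: "P (0 # b) = 0" for b
    using P linD(3)[OF alternating_front] by (auto simp: grading_iff)
  have P': "additive (\<lambda>m. P (m # b))" for b
    using P linD(5)[OF alternating_front] by (auto simp: grading_iff)
  have n': "length us = q + 1 + k" using n Suc by simp
  have "(\<Sum>\<sigma> \<in> Sh3 q 1 (int p - 1). let v = permute_list \<sigma> us in
          sg (of_int (sign \<sigma>)) (P (act (Q (take q v)) (v ! q) # drop (q + 1) v)))
     = (\<Sum>\<sigma>\<in>Sh3 q 1 (int k). signed (inversions (\<lambda>_ _. True) (map \<sigma> [0..<length us]))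
      (P (act (Q (take q (permute_list \<sigma> us))) (single (take 1 (drop q (permute_list \<sigma> us)))) # drop (q + 1) (permute_list \<sigma> us))))"
    by (rule sum.cong) (auto simp: Suc Let_def Sh3_def n' single_def hd_drop_conv_nth sign_scale[of _ "Suc (q + k)"])
  also have "\<dots> = usum (\<lambda>\<alpha> v. usum (\<lambda>\<beta> \<gamma>. if length \<alpha> = q \<and> length \<beta> = 1 then P (act (Q \<alpha>) (single \<beta>) # \<gamma>) else 0) v) us"
    using n' by (rule sum_Sh3_list)
  also have "\<dots> = usum (\<lambda>\<alpha> v. usum (\<lambda>\<beta> \<gamma>. P (act (Q \<alpha>) (single \<beta>) # \<gamma>)) v) us"
    by (intro unshuffle_cong) (use Q in \<open>auto simp: grading_iff concentrated_def act_simps P0 single_def\<close>)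
  also have "\<dots> = insertion P (list_conv act Q single) us"
    by (simp add: insertion_def list_conv_def unshuffle_hom[OF P'] unshuffle_assoc[symmetric])
  finally show ?thesis .
qed

lemma bracket_conv_eq:
  assumes P: "P \<in> hom_grading sM sg (int p)" and n: "length us = p + q"
  shows "(\<Sum>\<sigma> \<in> Sh2 p q. let v = permute_list \<sigma> us in
          sg (of_int (sign \<sigma>)) (bracket (P (take p v)) (Q (drop p v))))
     = list_conv bracket P Q us"
proof -
  have "(\<Sum>\<sigma> \<in> Sh2 p q. let v = permute_list \<sigma> us in
          sg (of_int (sign \<sigma>)) (bracket (P (take p v)) (Q (drop p v))))
     = (\<Sum>\<sigma>\<in>Sh2 p q. signed (inversions (\<lambda>_ _. True) (map \<sigma> [0..<length us]))
      (bracket (P (take p (permute_list \<sigma> us))) (Q (drop p (permute_list \<sigma> us)))))"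
    by (rule sum.cong) (auto simp: Let_def Sh2_def n intro!: sign_scale)
  also have "\<dots> = usum (\<lambda>\<alpha> \<beta>. if length \<alpha> = p then bracket (P \<alpha>) (Q \<beta>) else 0) us"
    using n by (rule sum_Sh2_list)
  also have "\<dots> = usum (\<lambda>\<alpha> \<beta>. bracket (P \<alpha>) (Q \<beta>)) us"
    by (intro unshuffle_cong) (use P in \<open>auto simp: grading_iff concentrated_def bracket_simps\<close>)
  finally show ?thesis by (simp add: list_conv_def)
qed

lemma binary_bracket_eq:
  assumes P: "P \<in> hom_grading sM sg (int p)" and Q: "Q \<in> hom_grading sM sg (int q)"
  shows "binary_bracket sg bracket act p q P Q = br2 (odd p) (odd q) P Q"
proof
  fix us
  show "binary_bracket sg bracket act p q P Q us = br2 (odd p) (odd q) P Q us"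
  proof (cases "length us = p + q")
    case True
    then show ?thesis
      unfolding binary_bracket_def br2_def
      using act_insertion_eq[OF P Q True] act_insertion_eq[OF Q P, of us] bracket_conv_eq[OF P True, of Q]
      by (simp add: scale_minus_one_power add.commute)
  next
    case False
    then have "br2 (odd p) (odd q) P Q us = 0"
      using br2_grading[OF P Q] by (simp add: grading_iff concentrated_def flip: of_nat_add)
    then show ?thesis using False by (simp add: binary_bracket_def)
  qed
qed

lemma ternary_bracket_eq:
  assumes P: "P \<in> hom_grading sM sg (int p)" and Q: "Q \<in> hom_grading sM sg (int q)" and R: "R \<in> hom_grading sM sg (int r)"
  shows "ternary_bracket sg H p q r P Q R = br3 (odd p) (odd q) (odd r) P Q R"
proof
  fix us
  show "ternary_bracket sg H p q r P Q R us = br3 (odd p) (odd q) (odd r) P Q R us"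
  proof (cases "length us + 1 = p + q + r")
    case True
    have *: "H_insertion_sign a b c * (-1) ^ k = (-1 :: 'k) ^ (a + 1 + b * c + k)" for a b c k
      by (simp add: H_insertion_sign_def power_add)
    show ?thesis
      unfolding ternary_bracket_def br3_def * unfolding H_insertion_sign_def
      using H_insertion_eq[OF P Q R] H_insertion_eq[OF P R Q] H_insertion_eq[OF Q P R]
        H_insertion_eq[OF Q R P] H_insertion_eq[OF R P Q] H_insertion_eq[OF R Q P] True
      by (simp add: scale_minus_one_power ac_simps)
        (cases "odd p"; cases "odd q"; cases "odd r"; simp)
  next
    case False
    then have "br3 (odd p) (odd q) (odd r) P Q R us = 0"
      using br3_grading[OF P Q R] by (auto simp: grading_iff concentrated_def)
    then show ?thesis using False by (simp add: ternary_bracket_def)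
  qed
qed

end

section \<open>Coefficients of the curvature identity\<close>

fun vecs :: "'m word \<Rightarrow> 'm list" where
  "vecs [] = []"
| "vecs (Inl u # w) = u # vecs w"
| "vecs (Inr i # w) = vecs w"

fun params :: "'m word \<Rightarrow> nat list" where
  "params [] = []"
| "params (Inl u # w) = params w"
| "params (Inr i # w) = i # params w"

lemma vecs_append [simp]: "vecs (v @ w) = vecs v @ vecs w"
  by (induction v rule: vecs.induct) auto

lemma params_append [simp]: "params (v @ w) = params v @ params w"
  by (induction v rule: params.induct) auto

lemma vecs_map [simp]: "vecs (map Inl us) = us" "vecs (map Inr I) = []"
  and params_map [simp]: "params (map Inl us) = []" "params (map Inr I) = I"
proof -
  show "vecs (map Inl us) = us" "params (map Inl us) = []" by (induction us) auto
  show "vecs (map Inr I) = []" "params (map Inr I) = I" by (induction I) auto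
qed

lemma unshuffle_zero_length:
  assumes "\<And>a b. length a + length b = length w \<Longrightarrow> f a b = 0"
  shows "unshuffle c f w = 0"
proof -
  have "unshuffle c f w = unshuffle c (\<lambda>_ _. 0) w"
    by (rule unshuffle_cong, rule assms) (metis size_mset size_union)
  then show ?thesis by simp
qed

lemma list_conv_swap:
  assumes h: "biadditive h" and P: "concentrated p P" and Q: "concentrated q Q"
  shows "list_conv h P Q us = signed (odd p \<and> odd q) (list_conv (\<lambda>x y. h y x) Q P us)"
proof -
  have "signed (odd (length a) \<and> odd (length b)) (h (P b) (Q a)) = signed (odd p \<and> odd q) (h (P b) (Q a))" for a b
  proof (cases "int (length a) = q \<and> int (length b) = p")
    case True
    then show ?thesis by (auto simp: conj_commute)
  next
    case False
    then show ?thesis using P Q by (auto simp: concentrated_def biadditive_simps[OF h])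
  qed
  then show ?thesis
    unfolding list_conv_def unshuffle_signed[symmetric] by (subst unshuffle_cocomm) simp_all
qed

locale odd_family = cocycle_module sg bracket sM act H
  for sg :: "'k::field_char_0 \<Rightarrow> 'g::ab_group_add \<Rightarrow> 'g" and bracket
    and sM :: "'k \<Rightarrow> 'm::ab_group_add \<Rightarrow> 'm" and act H +
  fixes d :: "nat \<Rightarrow> int" and P :: "nat \<Rightarrow> 'm list \<Rightarrow> 'g"
  assumes P_grading: "P i \<in> hom_grading sM sg (d i)"
begin

definition "odd_deg i = odd (d i)"

text \<open>
  The parameter \<open>Inr i\<close> has degree \<open>1 - d i\<close> modulo 2, which makes the sum of the \<open>P i\<close>, each
  multiplied by its parameter, odd.
\<close>

definition A :: "'m word \<Rightarrow> 'g" where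
  "A w = (case params w of [i] \<Rightarrow> P i (vecs w) | _ \<Rightarrow> 0)"

definition U :: "'m word \<Rightarrow> 'm" where
  "U w = (if params w = [] then single (vecs w) else 0)"

definition podd :: "nat list \<Rightarrow> bool" where
  "podd I = odd_word odd_deg (map Inr I :: 'm word)"

lemma podd_simps [simp]: "podd [] = False" "podd (i # I) = ((\<not> odd (d i)) \<noteq> podd I)"
  by (simp_all add: podd_def odd_deg_def)

lemma odd_word_Inl [simp]: "odd_word e (map Inl us) = odd (length us)"
  by (induction us) auto

lemma odd_word_eq: "odd_word odd_deg w = (odd (length (vecs w)) \<noteq> podd (params w))"
  by (induction w rule: vecs.induct) (auto simp: odd_deg_def)

lemma P_alternating: "alternating sM sg (P i)" and P_concentrated: "concentrated (d i) (P i)"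
  using P_grading by (auto simp: grading_iff)

sublocale odd_map sg bracket sM act H odd_deg A U
proof
  show "has_parity odd_deg True A"
    using P_concentrated unfolding has_parity_def A_def odd_word_eq concentrated_def
    by (auto split: list.split) (metis even_of_nat)+
  show "has_parity odd_deg True U"
    unfolding has_parity_def U_def odd_word_eq by (auto simp: single_def)
  show "front_additive A"
    unfolding front_additive_def A_def additive_def
    by (auto split: list.split simp: linD(1)[OF alternating_front[OF P_alternating]])
  show "front_additive U"
    unfolding front_additive_def U_def additive_def
    by (auto simp: linD(1)[OF alternating_front[OF alternating_single[OF M.vector_space_axioms]]])
  show "A (Inl u # Inl v # w) = - A (Inl v # Inl u # w)" for u v w
  proof (cases "\<exists>i. params w = [i]")
    case True
    then obtain i where "params w = [i]" by blast
    then show ?thesis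
      using alternating_swap[OF P_alternating[of i], of "[]" u v "vecs w"] by (simp add: A_def)
  qed (auto simp: A_def split: list.split)
  show "U (Inl u # w) = (if w = [] then u else 0)" for u w
  proof -
    have "w = [] \<longleftrightarrow> params w = [] \<and> vecs w = []" by (cases w rule: vecs.cases) auto
    then show ?thesis by (auto simp: U_def single_def)
  qed
qed

text \<open>The coefficient of a monomial in the parameters, all of which are moved behind the vectors.\<close>

definition ev :: "('m word \<Rightarrow> 'c) \<Rightarrow> nat list \<Rightarrow> 'm list \<Rightarrow> 'c" where
  "ev F I us = F (map Inl us @ map Inr I)"

text \<open>The parameter of index \<open>i\<close> is odd iff \<open>d i\<close> is even, so these
  are the pairs of parameters that anticommute.\<close>

abbreviation "both_even i j \<equiv> even (d i) \<and> even (d j)"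
abbreviation "psum \<equiv> unshuffle both_even"

lemma crossings_both_even: "crossings both_even I J = (podd I \<and> podd J)"
proof -
  have "crossing both_even i J = (even (d i) \<and> podd J)" for i
    by (induction J) auto
  then show ?thesis by (induction I) auto
qed

lemma podd_split: "mset I + mset J = mset K \<Longrightarrow> podd K = (podd I \<noteq> podd J)"
  unfolding podd_def by (rule odd_word_split) (metis image_mset_union mset_map)

text \<open>Vectors and parameters are split independently. The sign comes from moving the
  parameters \<open>I\<close> of the left factor behind the vectors \<open>b\<close> of the right
  one.\<close>

lemma unshuffle_emb:
  fixes f :: "'m word \<Rightarrow> 'm word \<Rightarrow> 'c::ab_group_add"
  shows "unshuffle (koszul odd_deg) f (map Inl us @ map Inr K)
     = psum (\<lambda>I J. usum (\<lambda>a b. signed (odd (length b) \<and> podd I)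
         (f (map Inl a @ map Inr I) (map Inl b @ map Inr J))) us) K"
proof -
  have "unshuffle (koszul odd_deg) f (map Inl us @ map Inr K)
     = usum (\<lambda>a b. psum (\<lambda>I J. signed (odd (length b) \<and> podd I)
         (f (map Inl a @ map Inr I) (map Inl b @ map Inr J))) K) us"
    unfolding unshuffle_append unshuffle_map by (simp add: koszul_def odd_deg_def podd_def)
  also have "\<dots> = psum (\<lambda>I J. usum (\<lambda>a b. signed (odd (length b) \<and> podd I)
         (f (map Inl a @ map Inr I) (map Inl b @ map Inr J))) us) K"
    by (rule unshuffle_comm)
  finally show ?thesis .
qed

text \<open>On nonzero terms the parity of \<open>G\<close> ties the number of vectors in the right
  factor to the parity of \<open>J\<close>. The sign then no longer depends on the splitting of the
  vectors and leaves the inner sum.\<close>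

lemma ev_conv:
  assumes h: "biadditive h" and G: "has_parity odd_deg g G"
  shows "ev (cv h F G) K us = psum (\<lambda>I J. signed ((g \<noteq> podd J) \<and> podd I) (list_conv h (ev F I) (ev G J) us)) K"
proof -
  have "signed (odd (length b) \<and> s) (h x (G (map Inl b @ map Inr J))) = signed ((g \<noteq> podd J) \<and> s) (h x (G (map Inl b @ map Inr J)))" for b J s x
  proof (cases "odd (length b) = (g \<noteq> podd J)")
    case False
    then have "G (map Inl b @ map Inr J) = 0"
      by (intro G[unfolded has_parity_def, rule_format]) (auto simp: odd_word_eq)
    then show ?thesis by (simp add: biadditive_simps[OF h])
  qed simp
  then show ?thesis
    unfolding ev_def conv_def unshuffle_emb list_conv_def unshuffle_signed[symmetric] by simp
qed

text \<open>As in \<open>ev_conv\<close>, except that the inserted vector is one more odd letter of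
  the word to which \<open>F\<close> is applied; hence \<open>f = podd J\<close>.\<close>

lemma ev_D:
  assumes F: "has_parity odd_deg f F"
  shows "ev (D Y F) K us = psum (\<lambda>I J. signed ((f = podd J) \<and> podd I) (insertion (ev F J) (ev Y I) us)) K"
proof -
  have "signed (odd (length b) \<and> s) (F (Inl y # map Inl b @ map Inr J)) = signed ((f = podd J) \<and> s) (F (Inl y # map Inl b @ map Inr J))" for b J s y
  proof (cases "odd (length b) = (f = podd J)")
    case False
    then have "F (Inl y # map Inl b @ map Inr J) = 0"
      by (intro F[unfolded has_parity_def, rule_format]) (auto simp: odd_word_eq)
    then show ?thesis by simp
  qed simp
  then show ?thesis
    unfolding ev_def deriv_along_def unshuffle_emb insertion_def unshuffle_signed[symmetric] by simp
qed

lemma ev_A: "ev A I = (case I of [i] \<Rightarrow> P i | _ \<Rightarrow> (\<lambda>us. 0))"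
  by (auto simp: ev_def A_def fun_eq_iff split: list.split)

lemma ev_A_simps [simp]: "ev A [] = (\<lambda>us. 0)" "ev A [i] = P i" "ev A (i # j # I) = (\<lambda>us. 0)"
  by (simp_all add: ev_A)

lemma ev_U: "ev U I us = (if I = [] then single us else 0)"
  by (auto simp: ev_def U_def)

lemma list_conv_zero_left [simp]: "biadditive h \<Longrightarrow> list_conv h (\<lambda>us. 0) Q = (\<lambda>us. 0)"
  by (simp add: list_conv_def biadditive_simps fun_eq_iff)

lemma list_conv_zero_right [simp]: "biadditive h \<Longrightarrow> list_conv h Q (\<lambda>us. 0) = (\<lambda>us. 0)"
  by (simp add: list_conv_def biadditive_simps fun_eq_iff)

lemma insertion_zero_left [simp]: "insertion (\<lambda>us. 0) Y us = 0"
  by (simp add: insertion_def)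

lemma insertion_zero_right: "alternating sM sg Q \<Longrightarrow> insertion Q (\<lambda>us. 0) us = 0"
  by (simp add: insertion_def linD(3)[OF alternating_front])

lemma ev_conv_U: "ev (cv act F U) I us = signed (podd I) (list_conv act (ev F I) single us)"
  unfolding ev_conv[OF biadditive_act U_odd]
proof (subst unshuffle_left_only)
  show "signed ((True \<noteq> podd b) \<and> podd a) (list_conv act (ev F a) (ev U b) us) = 0" if "b \<noteq> []" for a b
    using that by (simp add: ev_U[abs_def] biadditive_act)
qed (simp add: ev_U[abs_def])

lemma ev_W: "ev W I us = signed (podd I) (list_conv act (ev A I) single us)
   + sM (1/2) (psum (\<lambda>I1 I2. signed ((\<not> podd I2) \<and> podd I1) (list_conv H (ev A I1) (ev A I2) us)) I)"
  using ev_conv_U[of A I us] ev_conv[OF biadditive_H A_odd, of A I us]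
  by (simp add: ev_def W_def)

lemma ev_A_length: "length I \<noteq> 1 \<Longrightarrow> ev A I = (\<lambda>us. 0)"
  by (cases I rule: remdups_adj.cases) auto

text \<open>\<open>A\<close> is linear in the parameters, and \<open>W\<close> has a part linear in
  \<open>A\<close> and a part quadratic in \<open>A\<close>; so only coefficients with one or two
  parameters survive.\<close>

lemma ev_W_simps:
  "ev W [] = (\<lambda>us. 0)"
  "ev W [i] = (\<lambda>us. signed (even (d i)) (list_conv act (P i) single us))"
  "ev W [i, j] = (\<lambda>us. sM (1/2) (signed (odd (d j) \<and> even (d i)) (list_conv H (P i) (P j) us)
      + signed (even (d j)) (list_conv H (P j) (P i) us)))"
  "length I > 2 \<Longrightarrow> ev W I = (\<lambda>us. 0)"
proof -
  show "ev W [] = (\<lambda>us. 0)" "ev W [i] = (\<lambda>us. signed (even (d i)) (list_conv act (P i) single us))"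
    by (auto simp: ev_W fun_eq_iff biadditive_H biadditive_act)
  show "ev W [i, j] = (\<lambda>us. sM (1/2) (signed (odd (d j) \<and> even (d i)) (list_conv H (P i) (P j) us)
      + signed (even (d j)) (list_conv H (P j) (P i) us)))"
    by (auto simp: ev_W fun_eq_iff biadditive_H biadditive_act intro!: arg_cong2[where f = signed])
  assume I: "length I > 2"
  have "psum (\<lambda>I1 I2. signed ((\<not> podd I2) \<and> podd I1) (list_conv H (ev A I1) (ev A I2) us)) I = 0" for us
  proof (rule unshuffle_zero_length)
    fix a b :: "nat list" assume "length a + length b = length I"
    then have "length a \<noteq> 1 \<or> length b \<noteq> 1" using I by linarith
    then have "ev A a = (\<lambda>us. 0) \<or> ev A b = (\<lambda>us. 0)" using ev_A_length by blast
    then show "signed ((\<not> podd b) \<and> podd a) (list_conv H (ev A a) (ev A b) us) = 0"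
      by (auto simp: biadditive_H)
  qed
  moreover have z: "ev A I = (\<lambda>us. 0)" using I by (intro ev_A_length) simp
  ultimately show "ev W I = (\<lambda>us. 0)" by (intro ext) (simp add: ev_W z biadditive_act)
qed

lemma insertion_sM: "alternating sM sg Q \<Longrightarrow> insertion Q (\<lambda>us. sM r (Y us)) us = sg r (insertion Q Y us)"
  by (simp add: insertion_def unshuffle_hom[OF additive_sg] linD(2)[OF alternating_front])

lemma insertion_signed: "alternating sM sg Q \<Longrightarrow> insertion Q (\<lambda>us. signed s (Y us)) us = signed s (insertion Q Y us)"
  by (simp add: insertion_def unshuffle_signed additive_signed[OF linD(5)[OF alternating_front]])

lemma insertion_add: "alternating sM sg Q \<Longrightarrow> insertion Q (\<lambda>us. Y us + Y' us) us = insertion Q Y us + insertion Q Y' us"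
  by (simp add: insertion_def unshuffle_add linD(1)[OF alternating_front])

lemma ev_B: "ev B K us = psum (\<lambda>I J. signed (podd J \<and> podd I) (insertion (ev A J) (ev W I) us)) K
   - sg (1/2) (psum (\<lambda>I J. signed ((\<not> podd J) \<and> podd I) (list_conv bracket (ev A I) (ev A J) us)) K)"
  using ev_D[OF A_odd, of W K us] ev_conv[OF biadditive_bracket A_odd, of A K us]
  by (simp add: ev_def B_def)

lemma list_conv_bracket_swap:
  assumes "concentrated p Q" "concentrated q R"
  shows "list_conv bracket Q R us = - signed (odd p \<and> odd q) (list_conv bracket R Q us)"
proof -
  have "list_conv (\<lambda>x y. bracket y x) R Q us = - list_conv bracket R Q us"
    unfolding list_conv_def by (subst bracket_skew) (simp add: unshuffle_minus)
  then show ?thesis using list_conv_swap[OF biadditive_bracket assms, of us] by simp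
qed

lemma list_conv_H_swap:
  assumes "concentrated p Q" "concentrated q R"
  shows "list_conv H Q R us = - signed (odd p \<and> odd q) (list_conv H R Q us)"
proof -
  have "list_conv (\<lambda>x y. H y x) R Q us = - list_conv H R Q us"
    unfolding list_conv_def by (subst H_skew) (simp add: unshuffle_minus)
  then show ?thesis using list_conv_swap[OF biadditive_H assms, of us] by simp
qed

lemma ev_B_2: "ev B [i, j] us = signed (even (d j)) (br2 (odd (d i)) (odd (d j)) (P i) (P j) us)"
proof -
  \<comment> \<open>Both orders of the pair occur in \<open>cv bracket A A\<close>; after this
    exchange they agree and absorb the factor 1/2.\<close>
  have sw: "list_conv bracket (P j) (P i) us = - signed (odd (d j) \<and> odd (d i)) (list_conv bracket (P i) (P j) us)"
    by (rule list_conv_bracket_swap[OF P_concentrated P_concentrated])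
  show ?thesis
    unfolding ev_B br2_def
    by (simp add: ev_W_simps insertion_signed P_alternating biadditive_bracket insertion_zero_right)
       (cases "odd (d i)"; cases "odd (d j)"; simp add: sw scale_right_distrib scale_right_diff_distrib sg_half_add algebra_simps; metis sg_half_add)
qed

text \<open>The six terms come from the choice of the parameter for the outer \<open>A\<close> and
  of the order of the two others inside \<open>H\<close>. The Koszul signs of the parameters
  reproduce \<open>H_insertion_sign\<close> up to one common factor.\<close>

lemma ev_B_3: "ev B [i, j, k] us = signed (even (d i) = even (d k)) (br3 (odd (d i)) (odd (d j)) (odd (d k)) (P i) (P j) (P k) us)"
  unfolding ev_B br3_def hins_def
  by (simp add: ev_W_simps insertion_signed insertion_sM insertion_add P_alternating biadditive_bracket insertion_zero_right)
     (cases "odd (d i)"; cases "odd (d j)"; cases "odd (d k)"; simp add: scale_right_distrib scale_right_diff_distrib algebra_simps)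

text \<open>An insertion joins one parameter of the outer \<open>A\<close> with one or two of
  \<open>W\<close>, and \<open>cv bracket A A\<close> has two.\<close>

lemma ev_B_length: 
  assumes "length K \<noteq> 2" "length K \<noteq> 3"
  shows "ev B K us = 0"
proof -
  have "psum (\<lambda>I J. signed (podd J \<and> podd I) (insertion (ev A J) (ev W I) us)) K = 0"
  proof (rule unshuffle_zero_length)
    fix I J :: "nat list" assume "length I + length J = length K"
    then have "length J \<noteq> 1 \<or> length I = 0 \<or> length I > 2" using assms by linarith
    then have "ev A J = (\<lambda>us. 0) \<or> ev W I = (\<lambda>us. 0)" using ev_A_length ev_W_simps(1,4) by blast
    moreover have "alternating sM sg (ev A J)"
      using P_alternating scale_zero_right by (auto simp: ev_A alternating_def lin_def split: list.split)
    ultimately show "signed (podd J \<and> podd I) (insertion (ev A J) (ev W I) us) = 0"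
      by (auto simp: insertion_zero_right)
  qed
  moreover have "psum (\<lambda>I J. signed ((\<not> podd J) \<and> podd I) (list_conv bracket (ev A I) (ev A J) us)) K = 0"
  proof (rule unshuffle_zero_length)
    fix a b :: "nat list" assume "length a + length b = length K"
    then have "length a \<noteq> 1 \<or> length b \<noteq> 1" using assms by linarith
    then have "ev A a = (\<lambda>us. 0) \<or> ev A b = (\<lambda>us. 0)" using ev_A_length by blast
    then show "signed ((\<not> podd b) \<and> podd a) (list_conv bracket (ev A a) (ev A b) us) = 0"
      by (auto simp: biadditive_bracket)
  qed
  ultimately show ?thesis by (simp add: ev_B)
qed

end

lemma list_length_2_3_cases:
  obtains i j where "I = [i, j]" | i j k where "I = [i, j, k]" | "length I \<noteq> 2" "length I \<noteq> 3"
proof -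
  have "length I = 2 \<Longrightarrow> \<exists>i j. I = [i, j]" "length I = 3 \<Longrightarrow> \<exists>i j k. I = [i, j, k]"
    by (auto simp: numeral_2_eq_2 numeral_3_eq_3 length_Suc_conv)
  then show ?thesis using that by blast
qed

section \<open>The brackets on homogeneous elements\<close>

context cocycle_module
begin

abbreviation "l \<equiv> twisted_brackets sg bracket act H"

lemma br2_zero: "alternating sM sg Q \<Longrightarrow> br2 p q 0 Q = 0" "alternating sM sg Q \<Longrightarrow> br2 p q Q 0 = 0"
  using linD(3)[OF lin_br2_left] linD(3)[OF lin_br2_right] by (auto simp: fun_eq_iff)

lemma br3_zero:
  "alternating sM sg Q \<Longrightarrow> alternating sM sg R \<Longrightarrow> br3 p q r 0 Q R = 0"
  "alternating sM sg Q \<Longrightarrow> alternating sM sg R \<Longrightarrow> br3 p q r Q 0 R = 0"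
  "alternating sM sg Q \<Longrightarrow> alternating sM sg R \<Longrightarrow> br3 p q r Q R 0 = 0"
  using linD(3)[OF lin_br3_left] linD(3)[OF lin_br3_middle] linD(3)[OF lin_br3_right] by (auto simp: fun_eq_iff)

lemma zero_grading: "0 \<in> hom_grading sM sg d"
  by (simp add: grading_iff alternating_def lin_def concentrated_def)

lemma degrees_zero [simp]: "degrees 0 = {}"
  by (simp add: degrees_def)

text \<open>The zero map lies in every degree, negative ones included, while \<open>degrees\<close>
  assigns it none; it is therefore a case of its own.\<close>

lemma homogeneous_cases:
  assumes "P \<in> hom_grading sM sg d"
  obtains "P = 0" | n where "d = int n" "degrees P = {n}" "component n P = P" "P \<in> hom_grading sM sg (int n)"
proof (cases "P = 0")
  case False
  then obtain us where us: "P us \<noteq> 0" by (auto simp: fun_eq_iff)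
  then have d: "d = int (length us)" using assms by (auto simp: grading_iff concentrated_def)
  have "degrees P = {length us}"
    using us assms unfolding grading_iff concentrated_def degrees_def d by auto
  moreover have "component (length us) P = P"
    using assms by (auto simp: component_def fun_eq_iff grading_iff concentrated_def d)
  ultimately show ?thesis using that d assms by blast
qed

lemma l_2:
  assumes P: "P \<in> hom_grading sM sg d" and Q: "Q \<in> hom_grading sM sg e"
  shows "l 2 [P, Q] = br2 (odd d) (odd e) P Q"
  using P
proof (cases rule: homogeneous_cases)
  case 1
  then show ?thesis using Q by (simp add: twisted_brackets_def br2_zero grading_iff)
next
  case p: (2 m)
  show ?thesis using Q
  proof (cases rule: homogeneous_cases)
    case 1
    then show ?thesis using P by (simp add: twisted_brackets_def br2_zero grading_iff)
  next
    case q: (2 n)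
    then show ?thesis using p
      by (simp add: twisted_brackets_def binary_bracket_eq)
  qed
qed

lemma l_3:
  assumes P: "P \<in> hom_grading sM sg d" and Q: "Q \<in> hom_grading sM sg e" and R: "R \<in> hom_grading sM sg f"
  shows "l 3 [P, Q, R] = br3 (odd d) (odd e) (odd f) P Q R"
  using P
proof (cases rule: homogeneous_cases)
  case 1
  then show ?thesis using Q R by (simp add: twisted_brackets_def br3_zero grading_iff)
next
  case p: (2 m)
  show ?thesis using Q
  proof (cases rule: homogeneous_cases)
    case 1
    then show ?thesis using P R by (simp add: twisted_brackets_def br3_zero grading_iff)
  next
    case q: (2 n)
    show ?thesis using R
    proof (cases rule: homogeneous_cases)
      case 1
      then show ?thesis using P Q by (simp add: twisted_brackets_def br3_zero grading_iff)
    next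
      case r: (2 n)
      then show ?thesis using p q
        by (simp add: twisted_brackets_def ternary_bracket_eq numeral_2_eq_2)
    qed
  qed
qed

lemma l_other: "k \<noteq> 2 \<Longrightarrow> k \<noteq> 3 \<Longrightarrow> l k Ps = 0"
  by (simp add: twisted_brackets_def fun_eq_iff)

lemma br2_signed: "alternating sM sg Q \<Longrightarrow> br2 p q (signed s P) Q us = signed s (br2 p q P Q us)"
  using additive_signed[OF linD(5)[OF lin_br2_left]] by blast

lemma br3_signed: "alternating sM sg Q \<Longrightarrow> alternating sM sg R \<Longrightarrow> br3 p q r (signed s P) Q R us = signed s (br3 p q r P Q R us)"
  using additive_signed[OF linD(5)[OF lin_br3_left]] by blast

end

section \<open>From coefficients to graded skew-symmetric brackets\<close>

context odd_family
begin

definition "deg I = sum_list (map d I)"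

lemma podd_eq: "podd I = odd (deg I + int (length I))"
  by (induction I) (auto simp: deg_def)

lemma l_P_grading: "l (length I) (map P I) \<in> hom_grading sM sg (deg I + 2 - int (length I))"
proof -
  consider i j where "I = [i, j]" | i j k where "I = [i, j, k]" | "length I \<noteq> 2" "length I \<noteq> 3"
    by (rule list_length_2_3_cases)
  then show ?thesis
  proof cases
    case 1
    then show ?thesis
      using br2_grading[OF P_grading[of i] P_grading[of j]] l_2[OF P_grading[of i] P_grading[of j]]
      by (simp add: deg_def flip: numeral_2_eq_2)
  next
    case 2
    then show ?thesis
      using br3_grading[OF P_grading[of i] P_grading[of j] P_grading[of k]] l_3[OF P_grading[of i] P_grading[of j] P_grading[of k]]
      by (simp add: deg_def algebra_simps flip: numeral_3_eq_3)
  next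
    case 3
    then show ?thesis by (simp add: l_other zero_grading)
  qed
qed

text \<open>The sign of the shift from graded symmetric brackets of degree 1 to graded skew-symmetric ones.\<close>

primrec decalage :: "nat list \<Rightarrow> bool" where
  "decalage [] = False"
| "decalage (i # I) = ((odd (length I) \<and> odd (d i)) \<noteq> decalage I)"

text \<open>Besides \<open>decalage\<close> there remains a sign that depends only on the total
  degree. For lengths other than 2 and 3 both sides vanish.\<close>

lemma ev_B_eq: "ev B I = signed (decalage I \<noteq> even (deg I)) (l (length I) (map P I))"
proof -
  consider i j where "I = [i, j]" | i j k where "I = [i, j, k]" | "length I \<noteq> 2" "length I \<noteq> 3"
    by (rule list_length_2_3_cases)
  then show ?thesis
  proof cases
    case 1
    then show ?thesis
      using l_2[OF P_grading[of i] P_grading[of j]]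
      by (auto simp: fun_eq_iff ev_B_2 deg_def signed_apply simp flip: numeral_2_eq_2 intro!: arg_cong2[where f = signed])
  next
    case 2
    then show ?thesis
      using l_3[OF P_grading[of i] P_grading[of j] P_grading[of k]]
      by (auto simp: fun_eq_iff ev_B_3 deg_def signed_apply simp flip: numeral_3_eq_3 intro!: arg_cong2[where f = signed])
  next
    case 3
    then show ?thesis by (simp add: l_other ev_B_length fun_eq_iff)
  qed
qed

lemma signed_grading: "Q \<in> hom_grading sM sg e \<Longrightarrow> signed s Q \<in> hom_grading sM sg e"
proof -
  have eq: "signed s Q = (\<lambda>us. signed s (Q us))" by (simp add: fun_eq_iff signed_apply)
  show "Q \<in> hom_grading sM sg e \<Longrightarrow> signed s Q \<in> hom_grading sM sg e"
    unfolding grading_iff eq by (auto intro: alternating_signed simp: concentrated_def)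
qed

lemma ev_B_grading: "ev B I \<in> hom_grading sM sg (deg I + 2 - int (length I))"
  unfolding ev_B_eq by (intro signed_grading l_P_grading)

lemma ev_B_alternating: "alternating sM sg (ev B I)"
  and ev_B_concentrated: "concentrated (deg I + 2 - int (length I)) (ev B I)"
  using ev_B_grading by (auto simp: grading_iff)

lemma ev_A_alternating: "alternating sM sg (ev A J)"
  using P_alternating scale_zero_right by (auto simp: ev_A alternating_def lin_def split: list.split)

lemma insertion_unshuffle:
  assumes "alternating sM sg Q"
  shows "insertion Q (\<lambda>us. unshuffle c (\<lambda>a b. Y a b us) K) us = unshuffle c (\<lambda>a b. insertion Q (Y a b) us) K"
proof -
  have "Q (unshuffle c (\<lambda>a b. Y a b v) K # w) = unshuffle c (\<lambda>a b. Q (Y a b v # w)) K" for v w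
    by (rule unshuffle_hom) (rule linD(5)[OF alternating_front[OF assms]])
  then show ?thesis unfolding insertion_def by (simp add: unshuffle_comm[of _ _ _ K])
qed

text \<open>
  The terms of the curvature identity in which \<open>B\<close> takes the parameters \<open>I\<close>, and the remaining
  factors \<open>A\<close> take the parameters \<open>J\<close>.
\<close>

definition "jacobiator I J us = signed (podd J) (insertion (ev B I) (ev W J) us)
   - signed ((podd J \<and> podd I) \<noteq> podd I) (insertion (ev A J) (list_conv act (ev B I) single) us)
   - psum (\<lambda>J1 J2. signed ((podd J2 \<and> (podd I \<noteq> podd J1)) \<noteq> ((\<not> podd J1) \<and> podd I))
       (insertion (ev A J2) (list_conv H (ev B I) (ev A J1)) us)) J
   + signed ((\<not> podd J) \<and> podd I) (list_conv bracket (ev B I) (ev A J) us)"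

lemma sum_jacobiator: "psum (\<lambda>I J. jacobiator I J us) K = 0"
proof -
  \<comment> \<open>\<open>ev_D\<close> gives the first block of parameters to the inserted
    \<open>W\<close>; cocommutativity passes this block to \<open>B\<close>, as
    \<open>jacobiator\<close> requires.\<close>
  have 1: "ev (D W B) K us = psum (\<lambda>I J. signed (podd J) (insertion (ev B I) (ev W J) us)) K"
    unfolding ev_D[OF B_even]
    by (subst unshuffle_cocomm) (auto simp: crossings_both_even intro!: unshuffle_cong arg_cong2[where f = signed])
  have Z: "ev Z I = (\<lambda>us. signed (podd I) (list_conv act (ev B I) single us)
      + psum (\<lambda>I1 I2. signed ((\<not> podd I2) \<and> podd I1) (list_conv H (ev B I1) (ev A I2) us)) I)" for I
    using ev_conv_U[of B I] ev_conv[OF biadditive_H A_odd, of B I]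
    by (simp add: ev_def Z_def fun_eq_iff)
  let ?H = "\<lambda>I J1 J2. insertion (ev A J2) (list_conv H (ev B I) (ev A J1)) us"
  have "ev (D Z A) K us = psum (\<lambda>I J. signed (podd J \<and> podd I) (insertion (ev A J) (ev Z I) us)) K"
    using ev_D[OF A_odd, of Z K us] by simp
  also have "\<dots> = psum (\<lambda>I J. signed ((podd J \<and> podd I) \<noteq> podd I) (insertion (ev A J) (list_conv act (ev B I) single) us)) K
     + psum (\<lambda>I J. psum (\<lambda>I1 I2. signed (podd J \<and> podd I) (signed ((\<not> podd I2) \<and> podd I1) (?H I1 I2 J))) I) K"
    unfolding Z insertion_add[OF ev_A_alternating] insertion_signed[OF ev_A_alternating]
      insertion_unshuffle[OF ev_A_alternating] unshuffle_add[symmetric] signed_add unshuffle_signed by simp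
  also have "psum (\<lambda>I J. psum (\<lambda>I1 I2. signed (podd J \<and> podd I) (signed ((\<not> podd I2) \<and> podd I1) (?H I1 I2 J))) I) K
    = psum (\<lambda>I J. psum (\<lambda>I1 I2. signed ((podd J \<and> (podd I1 \<noteq> podd I2)) \<noteq> ((\<not> podd I2) \<and> podd I1)) (?H I1 I2 J)) I) K"
  proof (intro unshuffle_cong)
    fix I J I1 I2 :: "nat list" assume "mset I1 + mset I2 = mset I"
    then have "podd I = (podd I1 \<noteq> podd I2)" by (rule podd_split)
    then show "signed (podd J \<and> podd I) (signed ((\<not> podd I2) \<and> podd I1) (?H I1 I2 J))
      = signed ((podd J \<and> (podd I1 \<noteq> podd I2)) \<noteq> ((\<not> podd I2) \<and> podd I1)) (?H I1 I2 J)" by simp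
  qed
  \<comment> \<open>Regrouping by coassociativity: \<open>B\<close> keeps the first block, and the
    parameters of the two factors \<open>A\<close> together form the second.\<close>
  also have "\<dots> = psum (\<lambda>I J. psum (\<lambda>J1 J2. signed ((podd J2 \<and> (podd I \<noteq> podd J1)) \<noteq> ((\<not> podd J1) \<and> podd I)) (?H I J1 J2)) J) K"
    by (rule unshuffle_assoc)
  finally have 2: "ev (D Z A) K us = psum (\<lambda>I J. signed ((podd J \<and> podd I) \<noteq> podd I) (insertion (ev A J) (list_conv act (ev B I) single) us)) K
     + psum (\<lambda>I J. psum (\<lambda>J1 J2. signed ((podd J2 \<and> (podd I \<noteq> podd J1)) \<noteq> ((\<not> podd J1) \<and> podd I)) (?H I J1 J2)) J) K" .
  have 3: "ev (cv bracket B A) K us = psum (\<lambda>I J. signed ((\<not> podd J) \<and> podd I) (list_conv bracket (ev B I) (ev A J) us)) K"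
    using ev_conv[OF biadditive_bracket A_odd, of B K us] by simp
  have "ev (D W B) K us - ev (D Z A) K us + ev (cv bracket B A) K us = 0"
    using curvature_identity by (simp add: ev_def)
  then show ?thesis
    unfolding 1 2 3 jacobiator_def by (simp add: unshuffle_add unshuffle_diff algebra_simps)
qed

text \<open>With one parameter left the \<open>H\<close> term drops out, as it has two factors
  \<open>A\<close>, and \<open>W\<close> reduces to its linear part.\<close>

lemma jacobiator_1: "jacobiator I [k] us = br2 (podd I) (odd (d k)) (ev B I) (P k) us"
proof -
  have "psum (\<lambda>J1 J2. signed ((podd J2 \<and> (podd I \<noteq> podd J1)) \<noteq> ((\<not> podd J1) \<and> podd I))
       (insertion (ev A J2) (list_conv H (ev B I) (ev A J1)) us)) [k] = 0"
    by (simp add: biadditive_H insertion_zero_right[OF P_alternating] fun_eq_iff[symmetric])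
  then show ?thesis
    unfolding jacobiator_def br2_def
    by (simp add: ev_W_simps insertion_signed[OF ev_B_alternating])
      (auto intro!: arg_cong2[where f = signed] simp: signed_def)
qed

lemma hins_swap:
  assumes "alternating sM sg Q" "concentrated p S" "concentrated r R"
  shows "hins Q S R us = signed (\<not> (odd p \<and> odd r)) (hins Q R S us)"
proof -
  have "list_conv H S R = (\<lambda>us. signed (\<not> (odd p \<and> odd r)) (list_conv H R S us))"
    using list_conv_H_swap[OF assms(2,3)] by (auto simp: fun_eq_iff signed_def)
  then show ?thesis unfolding hins_def by (simp add: insertion_signed[OF assms(1)])
qed

lemma half_sum: "sg (1/2) (a + b + (c + c) + (e + e)) = sg (1/2) (a + b) + c + e"
  by (simp only: scale_right_distrib[of _ "a + b + (c + c)"] scale_right_distrib[of _ "a + b"] sg_half_double)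

text \<open>When \<open>B\<close> stands inside \<open>H\<close>, the curvature identity has one
  order of the two arguments with coefficient 1, the ternary bracket both orders with coefficient
  1/2; skew-symmetry of \<open>H\<close> identifies them. The terms with \<open>B\<close> outside
  come from \<open>W\<close> and keep the 1/2.\<close>

lemma jacobiator_2: "jacobiator I [k, m] us = signed (podd I = odd (d k)) (br3 (podd I) (odd (d k)) (odd (d m)) (ev B I) (P k) (P m) us)"
proof -
  let ?x = "podd I" and ?q = "odd (d k)" and ?r = "odd (d m)"
  let ?h = "\<lambda>F G K. hins F G K us"
  let ?c = "signed (?q \<noteq> ((?x \<and> ?r) \<noteq> (?x \<and> ?q))) (?h (P k) (ev B I) (P m))"
  let ?e = "signed ((\<not> ?r) \<noteq> ((?x \<and> ?q) \<noteq> ((?x \<noteq> ?q) \<and> ?r))) (?h (P m) (ev B I) (P k))"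
  have x: "odd (deg I + 2 - int (length I)) = ?x" by (simp add: podd_eq)
  have s1: "?h (P k) (P m) (ev B I) = signed (\<not> (?r \<and> ?x)) (?h (P k) (ev B I) (P m))"
    using hins_swap[OF P_alternating[of k] P_concentrated[of m] ev_B_concentrated[of I]] unfolding x .
  have s2: "?h (P m) (P k) (ev B I) = signed (\<not> (?q \<and> ?x)) (?h (P m) (ev B I) (P k))"
    using hins_swap[OF P_alternating[of m] P_concentrated[of k] ev_B_concentrated[of I]] unfolding x .
  have "br3 ?x ?q ?r (ev B I) (P k) (P m) us
     = sg (1/2) (signed ((\<not> ?x) \<noteq> (?q \<and> ?r)) (?h (ev B I) (P k) (P m)) + signed ?x (?h (ev B I) (P m) (P k))
         + (?c + ?c) + (?e + ?e))"
    unfolding br3_def s1 s2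
    by (rule arg_cong[where f = "sg (1/2)"]) (cases ?x; cases ?q; cases ?r; simp add: algebra_simps)
  then have 1: "br3 ?x ?q ?r (ev B I) (P k) (P m) us
     = sg (1/2) (signed ((\<not> ?x) \<noteq> (?q \<and> ?r)) (?h (ev B I) (P k) (P m)) + signed ?x (?h (ev B I) (P m) (P k)))
         + ?c + ?e"
    by (simp only: half_sum)
  show ?thesis
    unfolding 1 unfolding jacobiator_def hins_def
    by (simp add: ev_W_simps insertion_sM[OF ev_B_alternating] insertion_add[OF ev_B_alternating] insertion_signed[OF ev_B_alternating]
        insertion_zero_right[OF P_alternating] biadditive_H biadditive_bracket biadditive_act fun_eq_iff[symmetric])
      (cases ?x; cases ?q; cases ?r; simp add: scale_right_distrib scale_right_diff_distrib algebra_simps)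
qed

lemma jacobiator_length:
  assumes "length J \<noteq> 1" "length J \<noteq> 2"
  shows "jacobiator I J us = 0"
proof -
  have A: "ev A J = (\<lambda>us. 0)" using assms by (intro ev_A_length) auto
  have W: "ev W J = (\<lambda>us. 0)"
    using assms ev_W_simps(1,4) by (cases "length J > 2") (auto simp: numeral_2_eq_2 less_Suc_eq not_less le_Suc_eq)
  have "psum (\<lambda>J1 J2. signed ((podd J2 \<and> (podd I \<noteq> podd J1)) \<noteq> ((\<not> podd J1) \<and> podd I))
       (insertion (ev A J2) (list_conv H (ev B I) (ev A J1)) us)) J = 0"
  proof (rule unshuffle_zero_length)
    fix a b :: "nat list" assume "length a + length b = length J"
    then have "length a \<noteq> 1 \<or> length b \<noteq> 1" using assms by linarith
    then have "ev A a = (\<lambda>us. 0) \<or> ev A b = (\<lambda>us. 0)" using ev_A_length by blast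
    then have "insertion (ev A b) (list_conv H (ev B I) (ev A a)) us = 0"
    proof
      assume "ev A a = (\<lambda>us. 0)"
      then have "list_conv H (ev B I) (ev A a) = (\<lambda>us. 0)" by (simp add: biadditive_H)
      then show ?thesis by (simp add: insertion_zero_right ev_A_alternating)
    qed simp
    then show "signed ((podd b \<and> (podd I \<noteq> podd a)) \<noteq> ((\<not> podd a) \<and> podd I))
       (insertion (ev A b) (list_conv H (ev B I) (ev A a)) us) = 0" by simp
  qed
  then show ?thesis
    unfolding jacobiator_def A W by (simp add: insertion_zero_right ev_B_alternating biadditive_bracket)
qed

text \<open>The signs of inner and outer bracket combine by \<open>dec\<close>. As the inner bracket
  has degree \<open>deg I + 2 - int (length I)\<close> and not \<open>deg I\<close>, the product of
  the two lengths is left over; this is the sign \<open>(-1) ^ (i * (j - 1))\<close> of the higher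
  Jacobi identity. The total length is common to all splittings and is removed in
  \<open>sum_l\<close>.\<close>

lemma jacobiator_eq: "jacobiator I J us = signed ((decalage (I @ J) \<noteq> (odd (length I) \<and> odd (length J))) \<noteq> odd (length I + length J))
    (l (Suc (length J)) (l (length I) (map P I) # map P J) us)"
proof -
  let ?X = "l (length I) (map P I)"
  have x: "odd (deg I + 2 - int (length I)) = podd I" by (simp add: podd_eq)
  have dec: "decalage (I @ J) = (decalage I \<noteq> ((odd (length J) \<and> odd (deg I)) \<noteq> decalage J))"
    by (induction I) (auto simp: deg_def)
  consider k where "J = [k]" | k m where "J = [k, m]" | "length J \<noteq> 1" "length J \<noteq> 2"
    by (auto simp: numeral_2_eq_2 length_Suc_conv)
  then show ?thesis
  proof cases
    case 1
    have "l 2 [?X, P k] = br2 (podd I) (odd (d k)) ?X (P k)"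
      using l_2[OF l_P_grading[of I] P_grading[of k]] x by simp
    then show ?thesis
      unfolding 1 jacobiator_1 ev_B_eq br2_signed[OF P_alternating] dec[unfolded 1]
      by (auto simp: podd_eq simp flip: numeral_2_eq_2 intro!: arg_cong2[where f = signed])
  next
    case 2
    have "l 3 [?X, P k, P m] = br3 (podd I) (odd (d k)) (odd (d m)) ?X (P k) (P m)"
      using l_3[OF l_P_grading[of I] P_grading[of k] P_grading[of m]] x by simp
    then show ?thesis
      unfolding 2 jacobiator_2 ev_B_eq br3_signed[OF P_alternating P_alternating] dec[unfolded 2]
      by (auto simp: podd_eq simp flip: numeral_3_eq_3 intro!: arg_cong2[where f = signed])
  next
    case 3
    then show ?thesis by (simp add: jacobiator_length l_other)
  qed
qed

lemma sum_l: "psum (\<lambda>I J. signed (decalage (I @ J)) (signed (odd (length I) \<and> odd (length J))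
    (l (Suc (length J)) (l (length I) (map P I) # map P J) us))) K = 0"
proof -
  have "signed (odd (length K)) (psum (\<lambda>I J. jacobiator I J us) K) = psum (\<lambda>I J. signed (decalage (I @ J)) (signed (odd (length I) \<and> odd (length J))
    (l (Suc (length J)) (l (length I) (map P I) # map P J) us))) K"
    unfolding unshuffle_signed[symmetric]
  proof (rule unshuffle_cong)
    fix I J assume "mset I + mset J = mset K"
    then have "length K = length I + length J" by (metis size_mset size_union)
    then show "signed (odd (length K)) (jacobiator I J us) = signed (decalage (I @ J)) (signed (odd (length I) \<and> odd (length J))
      (l (Suc (length J)) (l (length I) (map P I) # map P J) us))"
      unfolding jacobiator_eq by (auto intro!: arg_cong2[where f = signed])
  qed
  then show ?thesis by (simp add: sum_jacobiator)
qed

lemma crossing_decalage: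
  "crossing (\<lambda>i j. \<not> (odd (d i) \<and> odd (d j))) x a = (crossing both_even x a \<noteq> ((odd (length a) \<and> odd (d x)) \<noteq> odd (deg a)))"
  by (induction a) (auto simp: deg_def)

text \<open>The two exchange rules differ on pairs with exactly one odd degree, and for such
  neighbours, and no others, an exchange changes \<open>decalage\<close>.\<close>

lemma unshuffle_decalage:
  "unshuffle (\<lambda>i j. \<not> (odd (d i) \<and> odd (d j))) f K
     = signed (decalage K) (psum (\<lambda>I J. signed (decalage (I @ J)) (f I J)) K)"
proof (induction K arbitrary: f)
  case (Cons x K)
  have dec: "decalage (I @ x # J) = (decalage (I @ J) \<noteq> ((odd (length J) \<and> odd (d x)) \<noteq> odd (deg I)))" for I J
    by (induction I) (auto simp: deg_def)
  have len: "mset I + mset J = mset K \<Longrightarrow> length K = length I + length J" for I J :: "nat list"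
    by (metis size_mset size_union)
  show ?case
    unfolding unshuffle.simps Cons signed_add unshuffle_signed[symmetric] crossing_decalage
    by (intro arg_cong2[where f = "(+)"] unshuffle_cong)
      (auto simp: dec dest!: len intro!: arg_cong2[where f = signed])
qed simp

lemma sum_l_koszul: "unshuffle (\<lambda>i j. \<not> (odd (d i) \<and> odd (d j))) (\<lambda>I J. signed (odd (length I) \<and> odd (length J))
    (l (Suc (length J)) (l (length I) (map P I) # map P J) us)) K = 0"
  unfolding unshuffle_decalage by (simp only: sum_l signed_simps(3))

end

section \<open>The L-infinity algebra\<close>

text \<open>Merges the signature and the Koszul sign into a single exchange rule.\<close>

lemma inversions_xor: "inversions c w \<noteq> inversions e w \<longleftrightarrow> inversions (\<lambda>x y. c x y \<noteq> e x y) w"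
proof -
  have "(crossing (\<lambda>x y. y < x \<and> c x y) x w \<noteq> crossing (\<lambda>x y. y < x \<and> e x y) x w)
     = crossing (\<lambda>x y. y < x \<and> c x y \<noteq> e x y) x w" for x :: nat and w
    by (induction w) auto
  then show ?thesis by (induction w) auto
qed

lemma unshuffle_sum: "finite S \<Longrightarrow> unshuffle c (\<lambda>a b. \<Sum>i\<in>S. f i a b) w = (\<Sum>i\<in>S. unshuffle c (f i) w)"
  by (induction S rule: finite_induct) (auto simp: unshuffle_add)

lemma sum_fun_eval: "(sum f S) x = (\<Sum>i\<in>S. f i x)"
  by (induction S rule: infinite_finite_induct) auto

context cocycle_module
begin

lemma vector_space_hom_scale: "vector_space (hom_scale sg :: _ \<Rightarrow> ('m list \<Rightarrow> 'g) \<Rightarrow> _)"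
  by unfold_locales (simp_all add: hom_scale_def fun_eq_iff scale_right_distrib scale_left_distrib)

interpretation V: vector_space "hom_scale sg :: _ \<Rightarrow> ('m list \<Rightarrow> 'g) \<Rightarrow> _"
  by (rule vector_space_hom_scale)

section \<open>Multilinearity on the direct sum\<close>

lemma grading_add: "P \<in> hom_grading sM sg d \<Longrightarrow> Q \<in> hom_grading sM sg d \<Longrightarrow> P + Q \<in> hom_grading sM sg d"
  using alternating_add[of P Q] by (auto simp: grading_iff concentrated_def plus_fun_def)

lemma grading_scale: "P \<in> hom_grading sM sg d \<Longrightarrow> hom_scale sg c P \<in> hom_grading sM sg d"
  using alternating_compose[OF lin_scale[of c], of sM P] by (auto simp: grading_iff concentrated_def hom_scale_def)

lemma subspace_grading: "V.subspace (hom_grading sM sg d)"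
  by (simp add: V.subspace_def zero_grading grading_add grading_scale)

text \<open>What multilinearity uses of an element of the span. Finiteness is essential: a sum over
  infinitely many degrees would be 0 by convention.\<close>

definition "graded_sum P \<longleftrightarrow> finite (degrees P) \<and> (\<forall>n. component n P \<in> hom_grading sM sg (int n))"

lemma component_add: "component n (P + Q) = component n P + component n Q"
  and component_scale: "component n (hom_scale sg c P) = hom_scale sg c (component n P)"
  and component_zero: "component n (0 :: 'm list \<Rightarrow> 'g) = 0"
  for P Q :: "'m list \<Rightarrow> 'g"
  by (auto simp: component_def hom_scale_def fun_eq_iff)

lemma degrees_add: "degrees (P + Q) \<subseteq> degrees P \<union> degrees Q" for P :: "'m list \<Rightarrow> 'g"
  by (auto simp: degrees_def)

lemma degrees_scale: "degrees (hom_scale sg c P) \<subseteq> degrees P"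
  by (auto simp: degrees_def hom_scale_def)

lemma graded_sum_span:
  assumes "P \<in> V.span (\<Union>i. hom_grading sM sg i)"
  shows "graded_sum P"
  using assms
proof (rule V.span_induct)
  show "V.subspace (Collect graded_sum)"
    unfolding V.subspace_def graded_sum_def
    by (auto simp: component_add component_scale component_zero grading_add grading_scale zero_grading
        intro: finite_subset[OF degrees_add] finite_subset[OF degrees_scale])
next
  fix Q assume "Q \<in> (\<Union>i. hom_grading sM sg i)"
  then obtain d where Q: "Q \<in> hom_grading sM sg d" by blast
  then show "graded_sum Q"
  proof (cases rule: homogeneous_cases)
    case 1
    then show ?thesis by (simp add: graded_sum_def component_zero zero_grading)
  next
    case (2 n)
    have "component m Q = (if m = n then Q else 0)" for m
      using 2 by (auto simp: component_def fun_eq_iff grading_iff concentrated_def)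
    then show ?thesis using 2 by (simp add: graded_sum_def zero_grading)
  qed
qed

lemma component_not_degree: "n \<notin> degrees P \<Longrightarrow> component n P = 0" for P :: "'m list \<Rightarrow> 'g"
  by (auto simp: component_def degrees_def fun_eq_iff)

lemma graded_sum_component: "graded_sum P \<Longrightarrow> component n P \<in> hom_grading sM sg (int n)" "graded_sum P \<Longrightarrow> alternating sM sg (component n P)"
  by (auto simp: graded_sum_def grading_iff)

text \<open>Components may cancel, so a sum can have fewer degrees than its summands. Larger index
  sets, on which the additional terms vanish, give all three brackets of a linearity statement the
  same range.\<close>

lemma l_2_graded_sum:
  assumes "graded_sum P" "graded_sum Q" "finite S" "degrees P \<subseteq> S" "finite T" "degrees Q \<subseteq> T"
  shows "l 2 [P, Q] = (\<Sum>p\<in>S. \<Sum>q\<in>T. br2 (odd p) (odd q) (component p P) (component q Q))"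
proof -
  have "l 2 [P, Q] = (\<Sum>p\<in>degrees P. \<Sum>q\<in>degrees Q. br2 (odd p) (odd q) (component p P) (component q Q))"
    by (simp add: twisted_brackets_def binary_bracket_eq graded_sum_component assms)
  also have "\<dots> = (\<Sum>p\<in>degrees P. \<Sum>q\<in>T. br2 (odd p) (odd q) (component p P) (component q Q))"
    by (intro sum.cong sum.mono_neutral_left) (auto simp: assms component_not_degree br2_zero graded_sum_component)
  also have "\<dots> = (\<Sum>p\<in>S. \<Sum>q\<in>T. br2 (odd p) (odd q) (component p P) (component q Q))"
    by (intro sum.mono_neutral_left) (auto simp: assms component_not_degree br2_zero graded_sum_component)
  finally show ?thesis .
qed

lemma l_3_graded_sum:
  assumes "graded_sum P" "graded_sum Q" "graded_sum R" "finite S" "degrees P \<subseteq> S" "finite T" "degrees Q \<subseteq> T" "finite X" "degrees R \<subseteq> X"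
  shows "l 3 [P, Q, R] = (\<Sum>p\<in>S. \<Sum>q\<in>T. \<Sum>r\<in>X. br3 (odd p) (odd q) (odd r) (component p P) (component q Q) (component r R))"
proof -
  have "l 3 [P, Q, R] = (\<Sum>p\<in>degrees P. \<Sum>q\<in>degrees Q. \<Sum>r\<in>degrees R. br3 (odd p) (odd q) (odd r) (component p P) (component q Q) (component r R))"
    by (simp add: twisted_brackets_def ternary_bracket_eq graded_sum_component assms numeral_2_eq_2)
  also have "\<dots> = (\<Sum>p\<in>degrees P. \<Sum>q\<in>degrees Q. \<Sum>r\<in>X. br3 (odd p) (odd q) (odd r) (component p P) (component q Q) (component r R))"
    by (intro sum.cong sum.mono_neutral_left) (auto simp: assms component_not_degree br3_zero graded_sum_component)
  also have "\<dots> = (\<Sum>p\<in>degrees P. \<Sum>q\<in>T. \<Sum>r\<in>X. br3 (odd p) (odd q) (odd r) (component p P) (component q Q) (component r R))"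
    by (intro sum.cong sum.mono_neutral_left) (auto simp: assms component_not_degree br3_zero graded_sum_component)
  also have "\<dots> = (\<Sum>p\<in>S. \<Sum>q\<in>T. \<Sum>r\<in>X. br3 (odd p) (odd q) (odd r) (component p P) (component q Q) (component r R))"
    by (intro sum.mono_neutral_left) (auto simp: assms component_not_degree br3_zero graded_sum_component)
  finally show ?thesis .
qed

lemma graded_sum_combine: "graded_sum P \<Longrightarrow> graded_sum Q \<Longrightarrow> graded_sum (hom_scale sg c P + Q)"
  unfolding graded_sum_def
  by (auto simp: component_add component_scale grading_add grading_scale
        intro: finite_subset[OF degrees_add] finite_subset[OF degrees_scale])

lemma degrees_combine: "degrees (hom_scale sg c P + Q) \<subseteq> degrees P \<union> degrees Q"
  for P Q :: "'m list \<Rightarrow> 'g"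
  using degrees_add[of "hom_scale sg c P" Q] degrees_scale[of c P] by blast

lemma br2_combine:
  "alternating sM sg Q \<Longrightarrow> br2 p q (hom_scale sg c P + P') Q = hom_scale sg c (br2 p q P Q) + br2 p q P' Q"
  "alternating sM sg Q \<Longrightarrow> br2 p q Q (hom_scale sg c P + P') = hom_scale sg c (br2 p q Q P) + br2 p q Q P'"
  by (auto simp: fun_eq_iff linD(1,2)[OF lin_br2_left] linD(1,2)[OF lin_br2_right] hom_scale_def[of sg c "br2 _ _ _ _"])

lemma br3_combine:
  assumes "alternating sM sg Q" "alternating sM sg R"
  shows "br3 p q r (hom_scale sg c P + P') Q R = hom_scale sg c (br3 p q r P Q R) + br3 p q r P' Q R"
  "br3 p q r Q (hom_scale sg c P + P') R = hom_scale sg c (br3 p q r Q P R) + br3 p q r Q P' R"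
  "br3 p q r Q R (hom_scale sg c P + P') = hom_scale sg c (br3 p q r Q R P) + br3 p q r Q R P'"
  by (auto simp: fun_eq_iff linD(1,2)[OF lin_br3_left[OF assms]] linD(1,2)[OF lin_br3_middle[OF assms]]
      linD(1,2)[OF lin_br3_right[OF assms]] hom_scale_def[of sg c "br3 _ _ _ _ _ _"])

lemma l_2_combine:
  assumes "graded_sum P" "graded_sum P'" "graded_sum Q"
  shows "l 2 [hom_scale sg c P + P', Q] = hom_scale sg c (l 2 [P, Q]) + l 2 [P', Q]"
    "l 2 [Q, hom_scale sg c P + P'] = hom_scale sg c (l 2 [Q, P]) + l 2 [Q, P']"
proof -
  let ?S = "degrees P \<union> degrees P'"
  have fin: "finite ?S" "finite (degrees Q)" using assms by (auto simp: graded_sum_def)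
  note l = l_2_graded_sum[OF _ _ fin(1) _ fin(2)] l_2_graded_sum[OF _ _ fin(2) _ fin(1)]
  note simps = degrees_combine assms graded_sum_combine component_add component_scale br2_combine graded_sum_component
    sum.distrib V.scale_sum_right
  show "l 2 [hom_scale sg c P + P', Q] = hom_scale sg c (l 2 [P, Q]) + l 2 [P', Q]"
    by (simp add: l(1) simps)
  show "l 2 [Q, hom_scale sg c P + P'] = hom_scale sg c (l 2 [Q, P]) + l 2 [Q, P']"
    by (simp add: l(2) simps)
qed

lemma l_3_combine:
  assumes "graded_sum P" "graded_sum P'" "graded_sum Q" "graded_sum R"
  shows "l 3 [hom_scale sg c P + P', Q, R] = hom_scale sg c (l 3 [P, Q, R]) + l 3 [P', Q, R]"
    "l 3 [Q, hom_scale sg c P + P', R] = hom_scale sg c (l 3 [Q, P, R]) + l 3 [Q, P', R]"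
    "l 3 [Q, R, hom_scale sg c P + P'] = hom_scale sg c (l 3 [Q, R, P]) + l 3 [Q, R, P']"
proof -
  let ?S = "degrees P \<union> degrees P'"
  have fin: "finite ?S" "finite (degrees Q)" "finite (degrees R)" using assms by (auto simp: graded_sum_def)
  note l = l_3_graded_sum[OF _ _ _ fin(1) _ fin(2) _ fin(3)] l_3_graded_sum[OF _ _ _ fin(2) _ fin(1) _ fin(3)]
    l_3_graded_sum[OF _ _ _ fin(2) _ fin(3) _ fin(1)]
  note simps = degrees_combine assms graded_sum_combine component_add component_scale br3_combine graded_sum_component
    sum.distrib V.scale_sum_right
  show "l 3 [hom_scale sg c P + P', Q, R] = hom_scale sg c (l 3 [P, Q, R]) + l 3 [P', Q, R]"
    by (simp add: l(1) simps)
  show "l 3 [Q, hom_scale sg c P + P', R] = hom_scale sg c (l 3 [Q, P, R]) + l 3 [Q, P', R]"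
    by (simp add: l(2) simps)
  show "l 3 [Q, R, hom_scale sg c P + P'] = hom_scale sg c (l 3 [Q, R, P]) + l 3 [Q, R, P']"
    by (simp add: l(3) simps)
qed

section \<open>Graded skew-symmetry\<close>

lemma br2_swap:
  assumes "concentrated d P" "concentrated e Q"
  shows "br2 (odd e) (odd d) Q P = signed (\<not> (odd d \<and> odd e)) (br2 (odd d) (odd e) P Q)"
proof
  fix us
  have "list_conv bracket Q P us = - signed (odd e \<and> odd d) (list_conv bracket P Q us)"
  proof -
    have "list_conv (\<lambda>x y. bracket y x) P Q us = - list_conv bracket P Q us"
      unfolding list_conv_def by (subst bracket_skew) (simp add: unshuffle_minus)
    then show ?thesis using list_conv_swap[OF biadditive_bracket assms(2,1), of us] by simp
  qed
  then show "br2 (odd e) (odd d) Q P us = signed (\<not> (odd d \<and> odd e)) (br2 (odd d) (odd e) P Q) us"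
    by (cases "odd d"; cases "odd e"; simp add: br2_def signed_apply algebra_simps)
qed

text \<open>Exchanging arguments permutes the six terms, so only signs have to be compared, in eight
  cases of parities. Together with \<open>br3_swap23\<close> this reaches all permutations of three
  arguments.\<close>

lemma br3_swap12: "br3 q p r Q P R = signed (\<not> (p \<and> q)) (br3 p q r P Q R)"
  unfolding br3_def by (rule ext, cases p; cases q; cases r)
    (simp_all add: br3_def signed_apply scale_right_distrib scale_right_diff_distrib algebra_simps)

lemma br3_swap23: "br3 p r q P R Q = signed (\<not> (q \<and> r)) (br3 p q r P Q R)"
  by (rule ext, cases p; cases q; cases r)
    (simp_all add: br3_def signed_apply scale_right_distrib scale_right_diff_distrib algebra_simps)

lemma hom_scale_sign: "hom_scale sg (of_int (if s then - 1 else 1)) X = signed s X"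
  by (auto simp: hom_scale_def fun_eq_iff)

lemma hom_scale_sign_koszul:
  assumes "p permutes {..<length ds}"
  shows "hom_scale sg (of_int (sign p * koszul_sign ds p)) X
     = signed (inversions (\<lambda>i j. \<not> (odd (ds ! i) \<and> odd (ds ! j))) (map p [0..<length ds])) X"
proof -
  let ?w = "map p [0..<length ds]"
  have "sign p * koszul_sign ds p
     = (if inversions (\<lambda>_ _. True) ?w \<noteq> inversions (\<lambda>i j. odd (ds ! i * ds ! j)) ?w then - 1 else 1)"
    unfolding sign_eq_inversions[OF assms] koszul_sign_eq_inversions by simp
  then show ?thesis unfolding inversions_xor by (simp only: hom_scale_sign) simp
qed

lemma graded_skew_2:
  assumes xs: "length xs = 2" "length ds = 2" "\<And>j. j < 2 \<Longrightarrow> xs ! j \<in> hom_grading sM sg (ds ! j)"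
    and p: "p permutes {..<2}"
  shows "l 2 (permute_list p xs) = hom_scale sg (of_int (sign p * koszul_sign ds p)) (l 2 xs)"
proof -
  obtain x y where x: "xs = [x, y]" using xs(1) by (auto simp: numeral_2_eq_2 length_Suc_conv)
  obtain d e where d: "ds = [d, e]" using xs(2) by (auto simp: numeral_2_eq_2 length_Suc_conv)
  have g: "x \<in> hom_grading sM sg d" "y \<in> hom_grading sM sg e" using xs(3)[of 0] xs(3)[of 1] by (auto simp: x d)
  have "p 0 < 2" "p 1 < 2" "p 0 \<noteq> p 1"
    using permutes_in_image[OF p, of 0] permutes_in_image[OF p, of 1] permutes_inj[OF p] by (auto dest: injD)
  then have "p 0 = 0 \<and> p 1 = 1 \<or> p 0 = 1 \<and> p 1 = 0" by auto
  moreover have "[0..<2] = [0, 1::nat]" by (simp add: numeral_2_eq_2)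
  moreover have "br2 (odd e) (odd d) y x = signed (\<not> (odd d \<and> odd e)) (br2 (odd d) (odd e) x y)"
    by (rule br2_swap) (use g in \<open>auto simp: grading_iff\<close>)
  ultimately show ?thesis
    using hom_scale_sign_koszul[of p ds "l 2 xs"] p
    by (auto simp: x d permute_list_def l_2[OF g] l_2[OF g(2,1)] disj_commute simp flip: numeral_2_eq_2)
qed

lemma graded_skew_3:
  assumes xs: "length xs = 3" "length ds = 3" "\<And>j. j < 3 \<Longrightarrow> xs ! j \<in> hom_grading sM sg (ds ! j)"
    and p: "p permutes {..<3}"
  shows "l 3 (permute_list p xs) = hom_scale sg (of_int (sign p * koszul_sign ds p)) (l 3 xs)"
proof -
  obtain x y z where x: "xs = [x, y, z]" using xs(1) by (auto simp: numeral_3_eq_3 length_Suc_conv)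
  obtain d e f where d: "ds = [d, e, f]" using xs(2) by (auto simp: numeral_3_eq_3 length_Suc_conv)
  have g: "x \<in> hom_grading sM sg d" "y \<in> hom_grading sM sg e" "z \<in> hom_grading sM sg f"
    using xs(3)[of 0] xs(3)[of 1] xs(3)[of 2] by (auto simp: x d)
  have lt: "p 0 < 3" "p 1 < 3" "p 2 < 3"
    using permutes_in_image[OF p, of 0] permutes_in_image[OF p, of 1] permutes_in_image[OF p, of 2] by simp_all
  have ne: "p 0 \<noteq> p 1" "p 1 \<noteq> p 2" "p 0 \<noteq> p 2"
    using permutes_inj[OF p] by (simp_all add: inj_eq)
  have l: "l 3 [x, y, z] = br3 (odd d) (odd e) (odd f) x y z" "l 3 [x, z, y] = br3 (odd d) (odd f) (odd e) x z y"
    "l 3 [y, x, z] = br3 (odd e) (odd d) (odd f) y x z" "l 3 [y, z, x] = br3 (odd e) (odd f) (odd d) y z x"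
    "l 3 [z, x, y] = br3 (odd f) (odd d) (odd e) z x y" "l 3 [z, y, x] = br3 (odd f) (odd e) (odd d) z y x"
    using g by (simp_all add: l_3)
  have s: "br3 (odd d) (odd f) (odd e) x z y = signed (\<not> (odd e \<and> odd f)) (br3 (odd d) (odd e) (odd f) x y z)"
    "br3 (odd e) (odd d) (odd f) y x z = signed (\<not> (odd d \<and> odd e)) (br3 (odd d) (odd e) (odd f) x y z)"
    by (rule br3_swap23, rule br3_swap12)
  have s': "br3 (odd e) (odd f) (odd d) y z x = signed (\<not> (odd d \<and> odd f)) (br3 (odd e) (odd d) (odd f) y x z)"
    "br3 (odd f) (odd d) (odd e) z x y = signed (\<not> (odd d \<and> odd f)) (br3 (odd d) (odd f) (odd e) x z y)"
    by (rule br3_swap23, rule br3_swap12)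
  have s'': "br3 (odd f) (odd e) (odd d) z y x = signed (\<not> (odd d \<and> odd e)) (br3 (odd f) (odd d) (odd e) z x y)"
    by (rule br3_swap23)
  have p3: "[0..<3] = [0, 1, 2::nat]" by (simp add: numeral_3_eq_3 numeral_2_eq_2)
  have "a = 0 \<and> b = 1 \<and> c = 2 \<or> a = 0 \<and> b = 2 \<and> c = 1 \<or> a = 1 \<and> b = 0 \<and> c = 2 \<or>
    a = 1 \<and> b = 2 \<and> c = 0 \<or> a = 2 \<and> b = 0 \<and> c = 1 \<or> a = 2 \<and> b = 1 \<and> c = 0"
    if "a < 3" "b < 3" "c < 3" "a \<noteq> b" "b \<noteq> c" "a \<noteq> c" for a b c :: nat
    using that by presburger
  from this[OF lt ne]
  have "p 0 = 0 \<and> p 1 = 1 \<and> p 2 = 2 \<or> p 0 = 0 \<and> p 1 = 2 \<and> p 2 = 1 \<or> p 0 = 1 \<and> p 1 = 0 \<and> p 2 = 2 \<or>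
    p 0 = 1 \<and> p 1 = 2 \<and> p 2 = 0 \<or> p 0 = 2 \<and> p 1 = 0 \<and> p 2 = 1 \<or> p 0 = 2 \<and> p 1 = 1 \<and> p 2 = 0" .
  moreover have "hom_scale sg (of_int (sign p * koszul_sign ds p)) (l 3 xs)
     = signed (inversions (\<lambda>i j. \<not> (odd (ds ! i) \<and> odd (ds ! j))) [p 0, p 1, p 2]) (l 3 [x, y, z])"
    using hom_scale_sign_koszul[of p ds "l 3 xs"] p unfolding xs(2) p3 by (simp add: x)
  moreover have "permute_list p xs = [xs ! p 0, xs ! p 1, xs ! p 2]"
    unfolding permute_list_def xs(1) p3 by simp
  ultimately show ?thesis
    by (elim disjE) (simp_all add: x d l s s' s'' p3, (rule arg_cong2[where f = signed], argo, rule refl)+)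
qed

end

section \<open>The axioms of an L-infinity algebra\<close>

context cocycle_module
begin

interpretation V: vector_space "hom_scale sg :: _ \<Rightarrow> ('m list \<Rightarrow> 'g) \<Rightarrow> _"
  by (rule vector_space_hom_scale)

lemma l_zero_head: "l k (0 # Ps) = 0"
  by (simp add: twisted_brackets_def)

lemma l_degree:
  assumes "length xs = k" "length ds = k" "\<And>j. j < k \<Longrightarrow> xs ! j \<in> hom_grading sM sg (ds ! j)"
  shows "l k xs \<in> hom_grading sM sg (sum_list ds + 2 - int k)"
proof -
  consider x y where "xs = [x, y]" | x y z where "xs = [x, y, z]" | "length xs \<noteq> 2" "length xs \<noteq> 3"
    by (rule list_length_2_3_cases)
  then show ?thesis
  proof cases
    case 1
    then have k: "k = 2" using assms by simp
    then obtain d e where d: "ds = [d, e]" using assms(2) by (auto simp: numeral_2_eq_2 length_Suc_conv)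
    have g: "x \<in> hom_grading sM sg d" "y \<in> hom_grading sM sg e" using assms(3)[of 0] assms(3)[of 1] by (auto simp: 1 d k)
    show ?thesis using br2_grading[OF g] l_2[OF g] by (simp add: 1 d k)
  next
    case 2
    then have k: "k = 3" using assms by simp
    then obtain d e f where d: "ds = [d, e, f]" using assms(2) by (auto simp: numeral_3_eq_3 length_Suc_conv)
    have g: "x \<in> hom_grading sM sg d" "y \<in> hom_grading sM sg e" "z \<in> hom_grading sM sg f"
      using assms(3)[of 0] assms(3)[of 1] assms(3)[of 2] by (auto simp: 2 d k)
    show ?thesis using br3_grading[OF g] l_3[OF g] by (simp add: 2 d k algebra_simps)
  next
    case 3
    then show ?thesis using assms by (simp add: l_other zero_grading)
  qed
qed

lemma l_multilinear:
  assumes xs: "length xs = k" "set xs \<subseteq> Collect graded_sum" and j: "j < k" and a: "graded_sum a" and b: "graded_sum b"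
  shows "l k (xs[j := hom_scale sg c a + b]) = hom_scale sg c (l k (xs[j := a])) + l k (xs[j := b])"
proof -
  consider x y where "xs = [x, y]" | x y z where "xs = [x, y, z]" | "length xs \<noteq> 2" "length xs \<noteq> 3"
    by (rule list_length_2_3_cases)
  then show ?thesis
  proof cases
    case 1
    then have k: "k = 2" using xs by simp
    have "graded_sum x" "graded_sum y" using xs by (auto simp: 1)
    moreover have "j = 0 \<or> j = 1" using j k by auto
    ultimately show ?thesis using a b by (auto simp: 1 k l_2_combine)
  next
    case 2
    then have k: "k = 3" using xs by simp
    have "graded_sum x" "graded_sum y" "graded_sum z" using xs by (auto simp: 2)
    moreover have "j = 0 \<or> j = 1 \<or> j = 2" using j k by auto
    ultimately show ?thesis using a b by (auto simp: 2 k l_3_combine numeral_2_eq_2)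
  next
    case 3
    then show ?thesis using xs by (simp add: l_other)
  qed
qed

lemma grading_direct_sum:
  assumes I: "finite I" and x: "\<And>i. i \<in> I \<Longrightarrow> x i \<in> hom_grading sM sg i" and 0: "(\<Sum>i\<in>I. x i) = 0" and i: "i \<in> I"
  shows "x i = 0"
proof
  fix us
  show "x i us = (0 :: 'm list \<Rightarrow> 'g) us"
  proof (cases "int (length us) = i")
    case True
    have "(\<Sum>j\<in>I. x j us) = (\<Sum>j\<in>I. if j = i then x i us else 0)"
      by (rule sum.cong) (use x True in \<open>auto simp: grading_iff concentrated_def\<close>)
    then have "x i us = (\<Sum>j\<in>I. x j) us" using I i by (simp add: sum_fun_eval)
    then show ?thesis by (simp add: 0)
  next
    case False
    then show ?thesis using x[OF i] by (simp add: grading_iff concentrated_def)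
  qed
qed

lemma higher_jacobi:
  assumes n: "n \<ge> 1" "length xs = n" "length ds = n" and xs: "\<And>j. j < n \<Longrightarrow> xs ! j \<in> hom_grading sM sg (ds ! j)"
  shows "(\<Sum>(i, j) \<in> {(i, j). 1 \<le> i \<and> 1 \<le> j \<and> i + j = n + 1}. \<Sum>p \<in> Sh2 i (n - i).
          hom_scale sg (of_int (sign p * koszul_sign ds p * (-1) ^ (i * (j - 1))))
            (l j (l i (take i (permute_list p xs)) # drop i (permute_list p xs)))) = 0"
proof -
  \<comment> \<open>The family has to be indexed by all naturals; it is continued by the zero map,
    which lies in degree 0.\<close>
  define d where "d i = (if i < n then ds ! i else 0)" for i
  define P where "P i = (if i < n then xs ! i else 0)" for i
  interpret odd_family sg bracket sM act H d P
    by unfold_locales (simp add: P_def d_def xs zero_grading)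
  define c where "c i j = (\<not> (odd (d i) \<and> odd (d j)))" for i j
  define F where "F I J = signed (odd (length I) \<and> odd (length J)) (l (Suc (length J)) (l (length I) (map P I) # map P J))" for I J
  have summand: "hom_scale sg (of_int (sign p * koszul_sign ds p * (-1) ^ (i * (j - 1))))
            (l j (l i (take i (permute_list p xs)) # drop i (permute_list p xs)))
      = signed (inversions c (map p [0..<n])) (F (map p [0..<i]) (map p [i..<n]))"
    if ij: "1 \<le> i" "1 \<le> j" "i + j = n + 1" and p: "p \<in> Sh2 i (n - i)" for i j p
  proof -
    have pp: "p permutes {..<n}" using p ij by (simp add: Sh2_def)
    have lt: "k < n \<Longrightarrow> p k < n" for k using permutes_in_image[OF pp, of k] by simp
    have perm: "take i (permute_list p xs) = map P (map p [0..<i])" "drop i (permute_list p xs) = map P (map p [i..<n])"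
      using ij lt n by (auto simp: permute_list_def take_map drop_map P_def)
    \<comment> \<open>Thus \<open>j - 1\<close> is the length of the second block, and
      \<open>(-1) ^ (i * (j - 1))\<close> becomes the sign in \<open>F\<close>.\<close>
    have j: "j = Suc (n - i)" using ij by simp
    have inv: "inversions (\<lambda>i j. \<not> (odd (ds ! i) \<and> odd (ds ! j))) (map p [0..<n]) = inversions c (map p [0..<n])"
    proof -
      have "inversions (\<lambda>i j. \<not> (odd (ds ! i) \<and> odd (ds ! j))) w = inversions c w" if "set w \<subseteq> {..<n}" for w
        using that
      proof (induction w)
        case (Cons x w)
        have "crossing (\<lambda>x y. y < x \<and> \<not> (odd (ds ! x) \<and> odd (ds ! y))) x v = crossing (\<lambda>x y. y < x \<and> c x y) x v"
          if "set v \<subseteq> {..<n}" for v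
          using that Cons.prems by (induction v) (auto simp: c_def d_def)
        then show ?case using Cons by simp
      qed simp
      then show ?thesis by (rule, use lt in auto)
    qed
    have split: "hom_scale sg (of_int (s * (-1) ^ k)) X = hom_scale sg (of_int s) (signed (odd k) X)" for s :: int and k X
      by (cases "even k") (auto simp: hom_scale_def fun_eq_iff)
    show ?thesis
      unfolding split hom_scale_sign_koszul[OF pp[folded n(3)]] unfolding n(3) inv perm F_def j
      by simp
  qed
  have "(\<Sum>(i, j) \<in> {(i, j). 1 \<le> i \<and> 1 \<le> j \<and> i + j = n + 1}. \<Sum>p \<in> Sh2 i (n - i).
          hom_scale sg (of_int (sign p * koszul_sign ds p * (-1) ^ (i * (j - 1))))
            (l j (l i (take i (permute_list p xs)) # drop i (permute_list p xs))))
     = (\<Sum>(i, j) \<in> {(i, j). 1 \<le> i \<and> 1 \<le> j \<and> i + j = n + 1}. \<Sum>p \<in> Sh2 i (n - i).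
          signed (inversions c (map p [0..<n])) (F (map p [0..<i]) (map p [i..<n])))"
    by (rule sum.cong[OF refl], clarify, rule sum.cong[OF refl]) (rule summand)
  also have "\<dots> = (\<Sum>i\<in>{1..n}. \<Sum>p \<in> Sh2 i (n - i). signed (inversions c (map p [0..<n])) (F (map p [0..<i]) (map p [i..<n])))"
    by (rule sum.reindex_bij_witness[of _ "\<lambda>i. (i, Suc n - i)" fst]) auto
  also have "\<dots> = (\<Sum>i\<in>{1..n}. unshuffle c (\<lambda>I J. if length I = i then F I J else 0) [0..<n])"
    by (intro sum.cong refl sum_Sh2) (auto simp: c_def)
  also have "\<dots> = unshuffle c (\<lambda>I J. \<Sum>i\<in>{1..n}. if length I = i then F I J else 0) [0..<n]"
    by (rule unshuffle_sum[symmetric]) simp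
  also have "\<dots> = unshuffle c F [0..<n]"
  proof (rule unshuffle_cong)
    fix I J assume "mset I + mset J = mset [0..<n]"
    then have "length I + length J = n" by (metis size_mset size_union length_upt diff_zero)
    \<comment> \<open>The unshuffle sum contains the splitting with empty \<open>I\<close>, which
      the sum over positive \<open>i\<close> omits; its term vanishes because the bracket without
      arguments is zero.\<close>
    moreover have "F [] J = 0" by (simp add: F_def l_other l_zero_head)
    ultimately show "(\<Sum>i\<in>{1..n}. if length I = i then F I J else 0) = F I J"
      by (cases "I = []") (auto simp: Suc_le_eq)
  qed
  also have "\<dots> = 0"
  proof
    fix us
    have "additive (\<lambda>Q :: 'm list \<Rightarrow> 'g. Q us)" by (simp add: additive_def)
    from unshuffle_hom[OF this, of c F]
    have "unshuffle c F [0..<n] us = unshuffle c (\<lambda>I J. F I J us) [0..<n]" .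
    also have "\<dots> = 0"
      using sum_l_koszul[of us "[0..<n]"] by (simp add: c_def[abs_def] F_def signed_apply)
    finally show "unshuffle c F [0..<n] us = (0 :: 'm list \<Rightarrow> 'g) us" by simp
  qed
  finally show ?thesis .
qed

lemma linfinity: "linfinity_algebra (hom_scale sg) (hom_grading sM sg) l"
proof unfold_locales
  show "V.subspace (hom_grading sM sg i)" for i by (rule subspace_grading)
  show "x i = 0" if "finite I" "\<And>i. i \<in> I \<Longrightarrow> x i \<in> hom_grading sM sg i" "(\<Sum>i\<in>I. x i) = 0" "i \<in> I" for I x i
    using that by (rule grading_direct_sum)
  show "l k (xs[j := hom_scale sg c a + b]) = hom_scale sg c (l k (xs[j := a])) + l k (xs[j := b])"
    if "1 \<le> k" "length xs = k" "set xs \<subseteq> V.span (\<Union>i. hom_grading sM sg i)" "j < k"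
      "a \<in> V.span (\<Union>i. hom_grading sM sg i)" "b \<in> V.span (\<Union>i. hom_grading sM sg i)" for k xs j a b c
    by (rule l_multilinear) (use that graded_sum_span in auto)
  show "l k xs \<in> hom_grading sM sg (sum_list ds + 2 - int k)"
    if "1 \<le> k" "length xs = k" "length ds = k" "\<And>j. j < k \<Longrightarrow> xs ! j \<in> hom_grading sM sg (ds ! j)" for k xs ds
    using that(2-4) by (rule l_degree)
  show "l k (permute_list p xs) = hom_scale sg (of_int (sign p * koszul_sign ds p)) (l k xs)"
    if "1 \<le> k" "length xs = k" "length ds = k" "\<And>j. j < k \<Longrightarrow> xs ! j \<in> hom_grading sM sg (ds ! j)" "p permutes {..<k}" for k xs ds p
  proof -
    consider "k = 2" | "k = 3" | "k \<noteq> 2" "k \<noteq> 3" by blast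
    then show ?thesis
      by cases (use graded_skew_2[of xs ds p] graded_skew_3[of xs ds p] that in \<open>auto simp: l_other\<close>)
  qed
  show "(\<Sum>(i, j) \<in> {(i, j). 1 \<le> i \<and> 1 \<le> j \<and> i + j = n + 1}. \<Sum>p \<in> Sh2 i (n - i).
          hom_scale sg (of_int (sign p * koszul_sign ds p * (-1) ^ (i * (j - 1))))
            (l j (l i (take i (permute_list p xs)) # drop i (permute_list p xs)))) = 0"
    if "1 \<le> n" "length xs = n" "length ds = n" "\<And>j. j < n \<Longrightarrow> xs ! j \<in> hom_grading sM sg (ds ! j)" for n xs ds
    using that by (rule higher_jacobi)
qed

section \<open>Maurer-Cartan elements\<close>

lemma hom1_grading:
  assumes "Vector_Spaces.linear sM sg T"
  shows "hom1 T \<in> hom_grading sM sg 1"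
proof -
  have "Vector_Spaces.linear sM sg (\<lambda>v. T (hd (us[i := v])))" if "length us = 1" "i < 1" for us i
    using that assms by (cases us) auto
  then show ?thesis by (auto simp: hom_grading_def alt_hom_def hom1_def)
qed

lemma maurer_cartan_iff:
  assumes T: "Vector_Spaces.linear sM sg T"
  shows "maurer_cartan (hom_scale sg) (hom_grading sM sg) l (hom1 T) \<longleftrightarrow>
    (\<forall>u v. bracket (T u) (T v) = T (act (T u) v - act (T v) u + H (T u) (T v)))"
proof -
  let ?t = "hom1 T"
  note t = hom1_grading[OF T]
  have T': "T (x + y) = T x + T y" "T (x - y) = T x - T y" "T (- x) = - T x" "T 0 = 0" for x y
    using linear_imp_additive[OF T] by (auto simp: additive.add additive.diff additive.minus additive.zero)
  define E where "E = hom_scale sg (1/2) (l 2 [?t, ?t]) - hom_scale sg (1/6) (l 3 [?t, ?t, ?t])"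
  let ?K = "{k. k \<ge> 1 \<and> l k (replicate k ?t) \<noteq> 0}"
  \<comment> \<open>The index set may be a proper subset of \<open>{2, 3}\<close>, as a bracket can
    vanish on \<open>T\<close>; hence the passage to the full set.\<close>
  have K: "?K \<subseteq> {2, 3}" using l_other by auto
  have "(\<Sum>k\<in>?K. hom_scale sg ((-1) ^ ((k - 1) * (k - 2) div 2) / fact k) (l k (replicate k ?t)))
      = (\<Sum>k\<in>{2, 3}. hom_scale sg ((-1) ^ ((k - 1) * (k - 2) div 2) / fact k) (l k (replicate k ?t)))"
    by (rule sum.mono_neutral_left) (use K in \<open>auto simp: V.scale_zero_right\<close>)
  also have "\<dots> = E"
    by (simp add: E_def numeral_3_eq_3 numeral_2_eq_2 fact_numeral)
  finally have "maurer_cartan (hom_scale sg) (hom_grading sM sg) l ?t \<longleftrightarrow> E = 0"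
    using t finite_subset[OF K] by (simp add: maurer_cartan_def)
  also have "E = 0 \<longleftrightarrow> (\<forall>u v. E [u, v] = 0)"
  proof
    assume E: "\<forall>u v. E [u, v] = 0"
    have "E \<in> hom_grading sM sg 2"
    proof -
      have "l 2 [?t, ?t] \<in> hom_grading sM sg 2" "l 3 [?t, ?t, ?t] \<in> hom_grading sM sg 2"
        using br2_grading[OF t t] br3_grading[OF t t t] by (simp_all add: l_2[OF t t] l_3[OF t t t])
      then show ?thesis unfolding E_def by (intro V.subspace_diff subspace_grading grading_scale)
    qed
    then have "E us = 0" if "length us \<noteq> 2" for us using that by (auto simp: grading_iff concentrated_def)
    moreover have "E us = 0" if "length us = 2" for us
      using that E by (auto simp: numeral_2_eq_2 length_Suc_conv)
    ultimately show "E = 0" by (auto simp: fun_eq_iff)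
  qed auto
  finally have MC: "maurer_cartan (hom_scale sg) (hom_grading sM sg) l ?t \<longleftrightarrow> (\<forall>u v. E [u, v] = 0)" .
  have "E [u, v] = T (act (T u) v - act (T v) u + H (T u) (T v)) - bracket (T u) (T v)" for u v
  proof -
    define a where "a = T (act (T u) v - act (T v) u) - bracket (T u) (T v)"
    define h where "h = T (H (T u) (T v))"
    have "br2 True True ?t ?t [u, v] = a + a"
      using bracket_skew[of "T v" "T u"]
      by (simp add: br2_def insertion_def list_conv_def single_def hom1_def a_def T' bracket_simps act_simps)
    then have 2: "l 2 [?t, ?t] [u, v] = a + a" by (simp add: l_2[OF t t])
    have "hins ?t ?t ?t [u, v] = h + h"
      using H_skew[of "T v" "T u"]
      by (simp add: hins_def insertion_def list_conv_def hom1_def h_def T' H_simps)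
    then have 3: "l 3 [?t, ?t, ?t] [u, v] = sg (1/2) (- (h + h) - (h + h) - (h + h) - (h + h) - (h + h) - (h + h))"
      by (simp add: l_3[OF t t t] br3_def)
    \<comment> \<open>All degrees are 1, so the six ternary terms agree and each contributes
      \<open>- (h + h)\<close>. The factors 1/2 of the bracket and -1/6 of the Maurer-Cartan
      equation turn -12 into 1.\<close>
    have 6: "- (h + h) - (h + h) - (h + h) - (h + h) - (h + h) - (h + h) = sg (-12) h"
    proof -
      have "sg 12 h = sg (2 + 2 + 2 + 2 + 2 + 2) h" by simp
      also have "\<dots> = (h + h) + (h + h) + (h + h) + (h + h) + (h + h) + (h + h)"
        by (simp only: scale_left_distrib sg_double)
      finally show ?thesis by (simp add: scale_minus_left algebra_simps)
    qed
    have "l 3 [?t, ?t, ?t] [u, v] = sg (-6) h"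
      using 3 unfolding 6 by simp
    then have "E [u, v] = a + h"
      unfolding E_def by (simp add: hom_scale_def 2 sg_half_double)
    then show ?thesis by (simp add: a_def h_def T' algebra_simps)
  qed
  then have "E [u, v] = 0 \<longleftrightarrow> bracket (T u) (T v) = T (act (T u) v - act (T v) u + H (T u) (T v))" for u v
    by (simp only: right_minus_eq) (rule eq_commute)
  then show ?thesis by (simp only: MC)
qed

end

theorem theorem3p2:
  fixes sg :: "'k::field_char_0 \<Rightarrow> 'g::ab_group_add \<Rightarrow> 'g"
    and bracket :: "'g \<Rightarrow> 'g \<Rightarrow> 'g"
    and sM :: "'k \<Rightarrow> 'm::ab_group_add \<Rightarrow> 'm"
    and act :: "'g \<Rightarrow> 'm \<Rightarrow> 'm"
    and H :: "'g \<Rightarrow> 'g \<Rightarrow> 'm"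
  assumes "lie_module sg bracket sM act"
    and "two_cocycle sg bracket sM act H"
  shows "linfinity_algebra (hom_scale sg) (hom_grading sM sg) (twisted_brackets sg bracket act H)
     \<and> (\<forall>T. Vector_Spaces.linear sM sg T \<longrightarrow>
          (twisted_rota_baxter sg bracket sM act H T \<longleftrightarrow>
           maurer_cartan (hom_scale sg) (hom_grading sM sg) (twisted_brackets sg bracket act H) (hom1 T)))"
proof -
  interpret cocycle_module sg bracket sM act H
    by (intro cocycle_module.intro cocycle_module_axioms.intro assms)
  show ?thesis
    using linfinity maurer_cartan_iff by (simp add: twisted_rota_baxter_def)
qed

end
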